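(* Let $n>k>0$ and let $L\subset\mathbb{R}^n$ be an $(n-k)$-dimensional subspace none of whose Plücker coordinates vanishes. Then there exist real numbers $t_1,t_2,\ldots,t_{k(n-k)}\in\mathbb{R}^\times$ such that for every $\alpha\in\binom{[n]}{k}$ the intersection $$\Omega_\alpha\cap\Omega(t_1.L)\cap\Omega(t_2.L)\cap\cdots\cap\Omega(t_{|\alpha|}.L)$$ in $\mathrm{Gr}(k,n)$ is transverse, consists of exactly $d(\alpha)$ points, and all of these points are real.
   Context: $\mathrm{Gr}(k,n)$ is the Grassmannian of $k$-dimensional subspaces of $\mathbb{C}^n$, with fixed basis $e_1,\ldots,e_n$ (real structure from $\mathbb{R}^n$). $\binom{[n]}{k}$ is the set of sequences $\alpha=(1\le\alpha_1<\cdots<\alpha_k\le n)$, partially ordered by $\beta\le\alpha$ iff $\beta_j\le\alpha_j$ for all $j$ (Bruhat order), with $|\alpha|=\sum_j(\alpha_j-j)$ and minimum $\hat0=(1,\ldots,k)$. Writing a $k$-plane $K$ as the row space of a $k\times n$ matrix, its Plücker coordinate $p_\alpha(K)$ is the maximal minor in columns $\alpha$; Plücker coordinates of an $(n-k)$-plane are defined analogously by $(n-k)\times(n-k)$ minors. $\Omega_\alpha=\{K\in\mathrm{Gr}(k,n): p_\beta(K)=0 \text{ for all } \beta\not\le\alpha\}$. For an $(n-k)$-plane $M$, $\Omega(M)=\{K: K\cap M\ne\{0\}\}$. $\mathbb{R}^\times$ acts on $\mathbb{R}^n$ (and $\mathbb{C}^n$) by $t.e_j=t^je_j$, and $t.L$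 is the image of $L$. $d(\alpha)$ is the number of saturated chains $\hat0\lessdot\cdots\lessdot\alpha$ in the Bruhat order (it is the degree of $\Omega_\alpha$ in the Plücker embedding). *)

theory Defs
  imports Complex_Main "Jordan_Normal_Form.Determinant"
begin

text \<open>Index sets: elements of binom([n],k) are k-subsets of {1..n}; the sorted list
  of such a set is the increasing sequence alpha_1 < ... < alpha_k.
  Matrix columns are 0-indexed, so basis vector e_j corresponds to column j-1.\<close>

definition kset :: "nat \<Rightarrow> nat \<Rightarrow> nat set set" where
  "kset n k = {A. A \<subseteq> {1..n} \<and> card A = k}"

definition seq :: "nat set \<Rightarrow> nat list" where
  "seq A = sorted_list_of_set A"

definition bruhat_le :: "nat set \<Rightarrow> nat set \<Rightarrow> bool" where
  "bruhat_le \<beta> \<alpha> = (\<forall>j < card \<alpha>. seq \<beta> ! j \<le> seq \<alpha> ! j)"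

definition wt :: "nat set \<Rightarrow> nat" where
  "wt \<alpha> = (\<Sum>j < card \<alpha>. seq \<alpha> ! j - (j + 1))"

definition hat0 :: "nat \<Rightarrow> nat set" where
  "hat0 k = {1..k}"

definition bruhat_cover :: "nat \<Rightarrow> nat \<Rightarrow> nat set \<Rightarrow> nat set \<Rightarrow> bool" where
  "bruhat_cover n k \<beta> \<alpha> = (\<beta> \<in> kset n k \<and> \<alpha> \<in> kset n k \<and> bruhat_le \<beta> \<alpha> \<and> \<beta> \<noteq> \<alpha> \<and>
     \<not> (\<exists>\<gamma> \<in> kset n k. bruhat_le \<beta> \<gamma> \<and> bruhat_le \<gamma> \<alpha> \<and> \<gamma> \<noteq> \<beta> \<and> \<gamma> \<noteq> \<alpha>))"

definition sat_chains :: "nat \<Rightarrow> nat \<Rightarrow> nat set \<Rightarrow> nat set list set" where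
  "sat_chains n k \<alpha> = {cs. cs \<noteq> [] \<and> hd cs = hat0 k \<and> last cs = \<alpha> \<and>
      (\<forall>i. Suc i < length cs \<longrightarrow> bruhat_cover n k (cs ! i) (cs ! Suc i))}"

definition dnum :: "nat \<Rightarrow> nat \<Rightarrow> nat set \<Rightarrow> nat" where
  "dnum n k \<alpha> = card (sat_chains n k \<alpha>)"

definition cols_of :: "'a::zero mat \<Rightarrow> nat set \<Rightarrow> 'a mat" where
  "cols_of X \<gamma> = mat (dim_row X) (card \<gamma>) (\<lambda>(i, j). X $$ (i, seq \<gamma> ! j - 1))"

definition plucker :: "'a::comm_ring_1 mat \<Rightarrow> nat set \<Rightarrow> 'a" where
  "plucker X \<gamma> = det (cols_of X \<gamma>)"

definition rowspace :: "'a::comm_ring_1 mat \<Rightarrow> 'a vec set" where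
  "rowspace X = {transpose_mat X *\<^sub>v c | c. c \<in> carrier_vec (dim_row X)}"

definition full_rank :: "nat \<Rightarrow> nat \<Rightarrow> complex mat \<Rightarrow> bool" where
  "full_rank n k X = (X \<in> carrier_mat k n \<and> (\<exists>\<gamma> \<in> kset n k. plucker X \<gamma> \<noteq> 0))"

definition Gr :: "nat \<Rightarrow> nat \<Rightarrow> complex vec set set" where
  "Gr k n = {rowspace X | X. full_rank n k X}"

text \<open>The torus action t.e_j = t^j e_j applied to (the rows of) a matrix.\<close>
definition tact :: "'a::comm_ring_1 \<Rightarrow> 'a mat \<Rightarrow> 'a mat" where
  "tact t M = mat (dim_row M) (dim_col M) (\<lambda>(i, c). M $$ (i, c) * t ^ (c + 1))"

text \<open>Defining equations (on representing matrices X) of Omega_alpha and Omega(M):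
  p_beta(X) = 0 for beta not \<le> alpha, resp. K \<inter> M \<noteq> 0 iff det [X; M] = 0,
  where M is a matrix whose rows form a basis of the (n-k)-plane.\<close>
definition in_Omega_alpha :: "nat \<Rightarrow> nat \<Rightarrow> nat set \<Rightarrow> complex mat \<Rightarrow> bool" where
  "in_Omega_alpha n k \<alpha> X = (\<forall>\<beta> \<in> kset n k. \<not> bruhat_le \<beta> \<alpha> \<longrightarrow> plucker X \<beta> = 0)"

definition meets :: "complex mat \<Rightarrow> complex mat \<Rightarrow> bool" where
  "meets X M = (det (X @\<^sub>r M) = 0)"

definition isect :: "nat \<Rightarrow> nat \<Rightarrow> nat set \<Rightarrow> complex mat list \<Rightarrow> complex vec set set" where
  "isect n k \<alpha> Ms = {K \<in> Gr k n. \<exists>X. full_rank n k X \<and> K = rowspace X \<and>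
      in_Omega_alpha n k \<alpha> X \<and> (\<forall>M \<in> set Ms. meets X M)}"

text \<open>Transversality at a point K of the intersection: in the standard affine chart
  (X with identity in the columns gamma, where p_gamma(K) \<noteq> 0) the Zariski tangent space of
  the intersection scheme (defined by the equations above) is zero, i.e. the only tangent
  direction V (with V zero in the columns gamma) annihilated by the differentials of all
  defining equations is V = 0.\<close>
definition transverse_at :: "nat \<Rightarrow> nat \<Rightarrow> nat set \<Rightarrow> complex mat list \<Rightarrow> complex vec set \<Rightarrow> bool" where
  "transverse_at n k \<alpha> Ms K = (\<exists>\<gamma> \<in> kset n k. \<exists>X. X \<in> carrier_mat k n \<and> rowspace X = K \<and>
      cols_of X \<gamma> = 1\<^sub>m k \<and>
      (\<forall>V \<in> carrier_mat k n. cols_of V \<gamma> = 0\<^sub>m k k \<and>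
          (\<forall>\<beta> \<in> kset n k. \<not> bruhat_le \<beta> \<alpha> \<longrightarrow>
              ((\<lambda>s. plucker (X + s \<cdot>\<^sub>m V) \<beta>) has_field_derivative 0) (at 0)) \<and>
          (\<forall>M \<in> set Ms. ((\<lambda>s. det ((X + s \<cdot>\<^sub>m V) @\<^sub>r M)) has_field_derivative 0) (at 0))
        \<longrightarrow> V = 0\<^sub>m k n))"

definition transverse :: "nat \<Rightarrow> nat \<Rightarrow> nat set \<Rightarrow> complex mat list \<Rightarrow> bool" where
  "transverse n k \<alpha> Ms = (\<forall>K \<in> isect n k \<alpha> Ms. transverse_at n k \<alpha> Ms K)"

definition real_point :: "nat \<Rightarrow> nat \<Rightarrow> complex vec set \<Rightarrow> bool" where
  "real_point n k K = (\<exists>Y :: real mat. Y \<in> carrier_mat k n \<and> K = rowspace (map_mat complex_of_real Y))"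

end

theory Submission
  imports Defs
begin

text \<open>The parameters are chosen one at a time, each small compared with its predecessors.
  As \<open>t\<close> tends to 0, the lowest-order term in \<open>t\<close> of the equation of \<open>\<Omega>(t.L)\<close> on
  \<open>\<Omega>\<^sub>\<alpha>\<close> is a nonzero multiple of \<open>p\<^sub>\<alpha>\<close>, so the intersection degenerates to the union of the
  intersections for the Schubert varieties \<open>\<Omega>\<^sub>\<beta>\<close> with \<open>\<beta>\<close> covered by \<open>\<alpha>\<close>; by induction
  these consist of \<open>d(\<alpha>)\<close> reduced real points. Near such a point \<open>\<Omega>\<^sub>\<alpha>\<close> is an affine space in the
  chart \<open>p\<^sub>\<beta> \<noteq> 0\<close>, and the implicit function theorem deforms the point to a unique nearby solution,
  which is real because its complex conjugate is also a nearby solution. Compactness of the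
  Grassmannian shows that for small \<open>t\<close> there are no further solutions.\<close>

subsection \<open>Strict differentiability and a parametric inverse function theorem\<close>

text \<open>One list of parameters must serve every \<alpha>, so the induction is on the length of
  the list, and each new parameter has to meet finitely many conditions that hold for all small
  positive t. Compactness alone would let a limit of solutions drift into a Schubert variety of too
  small weight, where no chart of a covered \<beta> is available. The induction therefore also
  carries \<open>dimensionally_proper\<close>: the conditions chosen so far have no common point on
  \<Omega>_\<delta> if \<open>wt \<delta>\<close> is below their number. In the chart of a covered
  \<beta>, \<Omega>_\<alpha> has \<open>wt \<beta> + 1\<close> free entries, one more than
  \<Omega>_\<beta>, and there are \<open>wt \<beta> + 1\<close> equations. Rescaling rows and
  columns by powers of t turns the newest equation into one that is polynomial in t; at t = 0 it is
  a nonzero multiple of the additional entry. The system at t = 0 is thus that of \<Omega>_\<beta>,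
  nondegenerate by induction, and t becomes one more coordinate of the equations. Deformed points
  may live in different charts, so their distinctness needs a separate argument,
  \<open>separated\<close>.\<close>

definition approx_linear ::
  "'i set \<Rightarrow> ('i \<Rightarrow> complex) \<Rightarrow> (('i \<Rightarrow> complex) \<Rightarrow> complex) \<Rightarrow> ('i \<Rightarrow> complex) \<Rightarrow> real \<Rightarrow> real \<Rightarrow> bool" where
  "approx_linear I p f d e r \<longleftrightarrow> r > 0 \<and> (\<forall>x y.
     (\<forall>i\<in>I. cmod (x i - p i) < r) \<longrightarrow> (\<forall>i\<in>I. cmod (y i - p i) < r) \<longrightarrow>
     cmod (f x - f y - (\<Sum>i\<in>I. d i * (x i - y i))) \<le> e * (\<Sum>i\<in>I. cmod (x i - y i)))"

text \<open>Both \<open>x\<close> and \<open>y\<close> move, instead of \<open>y\<close> being fixed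
  at \<open>p\<close>, because the contraction estimate compares two nearby points. Only coordinates
  in \<open>I\<close> are measured, so functions on all of \<open>'i\<close> can be treated without
  a norm on that space.\<close>

definition strict_deriv ::
  "'i set \<Rightarrow> ('i \<Rightarrow> complex) \<Rightarrow> (('i \<Rightarrow> complex) \<Rightarrow> complex) \<Rightarrow> ('i \<Rightarrow> complex) \<Rightarrow> bool" where
  "strict_deriv I p f d \<longleftrightarrow> (\<forall>e>0. \<exists>r. approx_linear I p f d e r)"

lemma approx_linearD:
  assumes "approx_linear I p f d e r"
  shows "r > 0"
    "\<And>x y. (\<And>i. i \<in> I \<Longrightarrow> cmod (x i - p i) < r) \<Longrightarrow> (\<And>i. i \<in> I \<Longrightarrow> cmod (y i - p i) < r) \<Longrightarrow>
      cmod (f x - f y - (\<Sum>i\<in>I. d i * (x i - y i))) \<le> e * (\<Sum>i\<in>I. cmod (x i - y i))"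
  using assms unfolding approx_linear_def by blast+

lemma strict_derivD:
  assumes "strict_deriv I p f d" "e > 0"
  obtains r where "approx_linear I p f d e r"
  using assms unfolding strict_deriv_def by blast

lemma cmod_linear_le:
  assumes "finite I"
  shows "cmod (\<Sum>i\<in>I. d i * v i) \<le> (\<Sum>i\<in>I. cmod (d i)) * (\<Sum>i\<in>I. cmod (v i))"
proof -
  have "cmod (\<Sum>i\<in>I. d i * v i) \<le> (\<Sum>i\<in>I. cmod (d i) * cmod (v i))"
    by (rule order_trans[OF norm_sum]) (simp add: norm_mult)
  also have "\<dots> \<le> (\<Sum>i\<in>I. (\<Sum>i\<in>I. cmod (d i)) * cmod (v i))"
    by (intro sum_mono mult_right_mono member_le_sum) (auto simp: assms)
  finally show ?thesis by (simp add: sum_distrib_left)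
qed

lemma strict_deriv_continuous:
  assumes fin: "finite I" and f: "strict_deriv I p f d" and e: "e > 0"
  obtains r where "r > 0" "\<And>x. (\<And>i. i \<in> I \<Longrightarrow> cmod (x i - p i) < r) \<Longrightarrow> cmod (f x - f p) \<le> e"
proof -
  obtain r1 where "approx_linear I p f d 1 r1"
    using strict_derivD[OF f, of 1] by auto
  note r1 = approx_linearD[OF this]
  \<comment> \<open>The last summand keeps \<open>C\<close> positive even for empty
    \<open>I\<close>.\<close>
  define C where "C = (1 + (\<Sum>i\<in>I. cmod (d i))) * real (card I) + 1"
  have C: "C > 0" unfolding C_def
    by (intro add_nonneg_pos mult_nonneg_nonneg add_nonneg_nonneg sum_nonneg) auto
  show ?thesis
  proof (rule that[of "min r1 (e / C)"])
    show "0 < min r1 (e / C)" using r1 C e by simp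
    fix x assume x: "\<And>i. i \<in> I \<Longrightarrow> cmod (x i - p i) < min r1 (e / C)"
    let ?S = "\<Sum>i\<in>I. cmod (x i - p i)"
    have "cmod (f x - f p) \<le> cmod (f x - f p - (\<Sum>i\<in>I. d i * (x i - p i)))
        + cmod (\<Sum>i\<in>I. d i * (x i - p i))"
      by (metis diff_add_cancel norm_triangle_ineq)
    also have "\<dots> \<le> 1 * ?S + (\<Sum>i\<in>I. cmod (d i)) * ?S"
      using x r1 by (intro add_mono r1(2) cmod_linear_le fin) auto
    also have "\<dots> = (1 + (\<Sum>i\<in>I. cmod (d i))) * ?S" by (simp add: algebra_simps)
    also have "\<dots> \<le> (1 + (\<Sum>i\<in>I. cmod (d i))) * (real (card I) * (e / C))"
      using sum_bounded_above[of I "\<lambda>i. cmod (x i - p i)" "e / C"] x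
      by (intro mult_left_mono add_nonneg_nonneg sum_nonneg) (auto simp: less_imp_le)
    also have "\<dots> = (C - 1) * (e / C)"
      by (simp add: C_def)
    also have "\<dots> \<le> C * (e / C)" using C e by (intro mult_right_mono) auto
    also have "\<dots> = e" using C by simp
    finally show "cmod (f x - f p) \<le> e" .
  qed
qed

lemma strict_deriv_const: "strict_deriv I p (\<lambda>x. c) (\<lambda>i. 0)"
  unfolding strict_deriv_def approx_linear_def
  by (auto intro!: exI[of _ 1] mult_nonneg_nonneg sum_nonneg)

lemma strict_deriv_coord:
  assumes "finite I" "j \<in> I"
  shows "strict_deriv I p (\<lambda>x. x j) (\<lambda>i. if i = j then 1 else 0)"
proof -
  have "(\<Sum>i\<in>I. (if i = j then 1 else 0) * (x i - y i)) = x j - y j" for x y :: "'a \<Rightarrow> complex"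
    using assms by (subst sum.remove[of I j]) (auto intro: sum.neutral)
  thus ?thesis unfolding strict_deriv_def approx_linear_def
  by (auto intro!: exI[of _ 1] mult_nonneg_nonneg sum_nonneg)
qed

lemma strict_deriv_add:
  assumes f: "strict_deriv I p f d" and g: "strict_deriv I p g d'"
  shows "strict_deriv I p (\<lambda>x. f x + g x) (\<lambda>i. d i + d' i)"
  unfolding strict_deriv_def
proof (intro allI impI)
  fix e :: real assume e: "e > 0"
  obtain r1 where "approx_linear I p f d (e/2) r1"
    using strict_derivD[OF f, of "e/2"] e by auto
  note r1 = approx_linearD[OF this]
  obtain r2 where "approx_linear I p g d' (e/2) r2"
    using strict_derivD[OF g, of "e/2"] e by auto
  note r2 = approx_linearD[OF this]
  show "\<exists>r. approx_linear I p (\<lambda>x. f x + g x) (\<lambda>i. d i + d' i) e r"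
    unfolding approx_linear_def
  proof (intro exI[of _ "min r1 r2"] conjI allI impI)
    fix x y assume xy: "\<forall>i\<in>I. cmod (x i - p i) < min r1 r2" "\<forall>i\<in>I. cmod (y i - p i) < min r1 r2"
    have "f x + g x - (f y + g y) - (\<Sum>i\<in>I. (d i + d' i) * (x i - y i)) =
      (f x - f y - (\<Sum>i\<in>I. d i * (x i - y i))) + (g x - g y - (\<Sum>i\<in>I. d' i * (x i - y i)))"
      by (simp add: algebra_simps sum.distrib sum_subtractf)
    also have "cmod \<dots> \<le> (e/2) * (\<Sum>i\<in>I. cmod (x i - y i)) + (e/2) * (\<Sum>i\<in>I. cmod (x i - y i))"
      using xy by (intro norm_triangle_le add_mono r1(2) r2(2)) auto
    finally show "cmod (f x + g x - (f y + g y) - (\<Sum>i\<in>I. (d i + d' i) * (x i - y i)))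
       \<le> e * (\<Sum>i\<in>I. cmod (x i - y i))" by (simp add: algebra_simps)
  qed (use r1 r2 in auto)
qed

lemma strict_deriv_mult:
  assumes fin: "finite I" and f: "strict_deriv I p f d" and g: "strict_deriv I p g d'"
  shows "strict_deriv I p (\<lambda>x. f x * g x) (\<lambda>i. f p * d' i + g p * d i)"
  unfolding strict_deriv_def
proof (intro allI impI)
  fix e :: real assume e: "e > 0"
  define C where "C = (\<Sum>i\<in>I. cmod (d i))"
  define C' where "C' = (\<Sum>i\<in>I. cmod (d' i))"
  have C0: "C \<ge> 0" "C' \<ge> 0" unfolding C_def C'_def by (auto intro: sum_nonneg)
  \<comment> \<open>\<open>K\<close> collects the coefficients of \<open>e1 * S\<close> in the four
    error terms below. The summands 1 come from the bounds on \<open>f x\<close> and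
    \<open>g y\<close>, which exceed \<open>f p\<close> and \<open>g p\<close> in modulus by at most
    \<open>e1 \<le> 1\<close>.\<close>
  define K where "K = cmod (f p) + 1 + C' + (cmod (g p) + 1) + C"
  have K: "K > 0" unfolding K_def using C0 by (smt (verit) norm_ge_zero)
  define e1 where "e1 = min 1 (e / K)"
  have e1: "e1 > 0" "e1 \<le> 1" "e1 * K \<le> e" unfolding e1_def using e K
    by (auto simp: min_def field_simps)
  obtain r1 where "approx_linear I p f d e1 r1"
    using strict_derivD[OF f e1(1)] by auto
  note r1 = approx_linearD[OF this]
  obtain r2 where "approx_linear I p g d' e1 r2"
    using strict_derivD[OF g e1(1)] by auto
  note r2 = approx_linearD[OF this]
  obtain r3 where r3: "r3 > 0" "\<And>x. (\<And>i. i \<in> I \<Longrightarrow> cmod (x i - p i) < r3) \<Longrightarrow> cmod (f x - f p) \<le> e1"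
    using strict_deriv_continuous[OF fin f e1(1)] by blast
  obtain r4 where r4: "r4 > 0" "\<And>x. (\<And>i. i \<in> I \<Longrightarrow> cmod (x i - p i) < r4) \<Longrightarrow> cmod (g x - g p) \<le> e1"
    using strict_deriv_continuous[OF fin g e1(1)] by blast
  define r where "r = min (min r1 r2) (min r3 r4)"
  show "\<exists>r. approx_linear I p (\<lambda>x. f x * g x) (\<lambda>i. f p * d' i + g p * d i) e r"
    unfolding approx_linear_def
  proof (intro exI[of _ r] conjI allI impI)
    show "r > 0" unfolding r_def using r1 r2 r3 r4 by auto
    fix x y assume "\<forall>i\<in>I. cmod (x i - p i) < r" "\<forall>i\<in>I. cmod (y i - p i) < r"
    hence xy: "\<And>i. i \<in> I \<Longrightarrow> cmod (x i - p i) < r1" "\<And>i. i \<in> I \<Longrightarrow> cmod (y i - p i) < r1"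
      "\<And>i. i \<in> I \<Longrightarrow> cmod (x i - p i) < r2" "\<And>i. i \<in> I \<Longrightarrow> cmod (y i - p i) < r2"
      "\<And>i. i \<in> I \<Longrightarrow> cmod (x i - p i) < r3" "\<And>i. i \<in> I \<Longrightarrow> cmod (y i - p i) < r4"
      unfolding r_def by auto
    define S where "S = (\<Sum>i\<in>I. cmod (x i - y i))"
    have S0: "S \<ge> 0" unfolding S_def by (auto intro: sum_nonneg)
    define D where "D = (\<Sum>i\<in>I. d i * (x i - y i))"
    define D' where "D' = (\<Sum>i\<in>I. d' i * (x i - y i))"
    have D: "cmod D \<le> C * S" "cmod D' \<le> C' * S"
      unfolding D_def D'_def C_def C'_def S_def by (rule cmod_linear_le[OF fin])+
    have a1: "cmod (f x - f y - D) \<le> e1 * S" unfolding D_def S_def using xy by (intro r1(2)) auto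
    have a2: "cmod (g x - g y - D') \<le> e1 * S" unfolding D'_def S_def using xy by (intro r2(2)) auto
    have a3: "cmod (f x - f p) \<le> e1" using xy by (intro r3(2)) auto
    have a4: "cmod (g y - g p) \<le> e1" using xy by (intro r4(2)) auto
    have a5: "cmod (f x) \<le> cmod (f p) + 1" using a3 e1 norm_triangle_sub[of "f x" "f p"] by linarith
    have a6: "cmod (g y) \<le> cmod (g p) + 1" using a4 e1 norm_triangle_sub[of "g y" "g p"] by linarith
    have "(\<Sum>i\<in>I. (f p * d' i + g p * d i) * (x i - y i)) = f p * D' + g p * D"
      unfolding D_def D'_def by (simp add: sum_distrib_left sum.distrib[symmetric] algebra_simps)
    hence "f x * g x - f y * g y - (\<Sum>i\<in>I. (f p * d' i + g p * d i) * (x i - y i)) =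
      f x * (g x - g y - D') + (f x - f p) * D' + (g y * (f x - f y - D) + (g y - g p) * D)"
      by (simp add: algebra_simps)
    also have "cmod \<dots> \<le> (cmod (f p) + 1) * (e1 * S) + e1 * (C' * S) +
        ((cmod (g p) + 1) * (e1 * S) + e1 * (C * S))"
      using a1 a2 a3 a4 a5 a6 D C0 S0 e1
      by (intro norm_triangle_le add_mono)
         (auto simp: norm_mult intro!: mult_mono)
    also have "\<dots> = (e1 * K) * S" by (simp add: K_def algebra_simps)
    also have "\<dots> \<le> e * S" using e1 S0 by (intro mult_right_mono) auto
    finally show "cmod (f x * g x - f y * g y - (\<Sum>i\<in>I. (f p * d' i + g p * d i) * (x i - y i)))
       \<le> e * (\<Sum>i\<in>I. cmod (x i - y i))" by (simp add: S_def)
  qed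
qed

text \<open>Only the existence of a gradient is recorded: the equations are polynomial in the
  entries, and their gradients matter later only through derivatives along lines.\<close>

definition sdiff :: "'i set \<Rightarrow> ('i \<Rightarrow> complex) \<Rightarrow> (('i \<Rightarrow> complex) \<Rightarrow> complex) \<Rightarrow> bool" where
  "sdiff I p f \<longleftrightarrow> (\<exists>d. strict_deriv I p f d)"

lemma sdiff_const: "sdiff I p (\<lambda>x. c)"
  unfolding sdiff_def by (rule exI, rule strict_deriv_const)

lemma sdiff_coord: "finite I \<Longrightarrow> j \<in> I \<Longrightarrow> sdiff I p (\<lambda>x. x j)"
  unfolding sdiff_def by (rule exI, rule strict_deriv_coord)

lemma sdiff_add: "sdiff I p f \<Longrightarrow> sdiff I p g \<Longrightarrow> sdiff I p (\<lambda>x. f x + g x)"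
  unfolding sdiff_def by (elim exE, rule exI, rule strict_deriv_add)

lemma sdiff_mult: "finite I \<Longrightarrow> sdiff I p f \<Longrightarrow> sdiff I p g \<Longrightarrow> sdiff I p (\<lambda>x. f x * g x)"
  unfolding sdiff_def by (elim exE, rule exI, rule strict_deriv_mult)

lemma sdiff_sum: "(\<And>a. a \<in> A \<Longrightarrow> sdiff I p (f a)) \<Longrightarrow> sdiff I p (\<lambda>x. \<Sum>a\<in>A. f a x)"
  by (induction A rule: infinite_finite_induct) (auto intro: sdiff_const sdiff_add)

lemma sdiff_prod:
  "finite I \<Longrightarrow> (\<And>a. a \<in> A \<Longrightarrow> sdiff I p (f a)) \<Longrightarrow> sdiff I p (\<lambda>x. \<Prod>a\<in>A. f a x)"
  by (induction A rule: infinite_finite_induct) (auto intro: sdiff_const sdiff_mult)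

lemma sdiff_power: "finite I \<Longrightarrow> sdiff I p f \<Longrightarrow> sdiff I p (\<lambda>x. f x ^ m)"
  by (induction m) (auto intro: sdiff_const sdiff_mult)

lemma sdiff_det:
  assumes fin: "finite I" and c: "\<And>x. A x \<in> carrier_mat n n"
    and e: "\<And>i j. i < n \<Longrightarrow> j < n \<Longrightarrow> sdiff I p (\<lambda>x. A x $$ (i, j))"
  shows "sdiff I p (\<lambda>x. det (A x))"
proof -
  have "sdiff I p (\<lambda>x. \<Sum>q\<in>{q. q permutes {0..<n}}. signof q * (\<Prod>i = 0..<n. A x $$ (i, q i)))"
    by (intro sdiff_sum sdiff_mult sdiff_prod sdiff_const fin e) (auto simp: permutes_in_image)
  thus ?thesis using det_def'[OF c] by simp
qed

text \<open>Leads back from gradients to the derivatives along lines in which transversality is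
  phrased.\<close>

lemma strict_deriv_has_field_derivative:
  assumes fin: "finite I" and f: "strict_deriv I p f d"
  shows "((\<lambda>s. f (\<lambda>i. p i + s * v i)) has_field_derivative (\<Sum>i\<in>I. d i * v i)) (at 0)"
proof -
  define S where "S = (\<Sum>i\<in>I. cmod (v i)) + 1"
  have S: "S > 0" unfolding S_def by (intro add_nonneg_pos sum_nonneg) auto
  have vS: "cmod (v i) \<le> S" if "i \<in> I" for i
    using member_le_sum[of i I "\<lambda>i. cmod (v i)"] that fin unfolding S_def by auto
  have "(\<lambda>h. (f (\<lambda>i. p i + h * v i) - f p) / h) \<midarrow>0\<rightarrow> (\<Sum>i\<in>I. d i * v i)"
  proof (rule LIM_I)
    fix e :: real assume e: "e > 0"
    obtain r where "approx_linear I p f d (e / (2 * S)) r"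
    using strict_derivD[OF f, of "e / (2 * S)"] e S by auto
  note r = approx_linearD[OF this]
    show "\<exists>s>0. \<forall>h. h \<noteq> 0 \<and> norm (h - 0) < s \<longrightarrow>
        norm ((f (\<lambda>i. p i + h * v i) - f p) / h - (\<Sum>i\<in>I. d i * v i)) < e"
    proof (intro exI[of _ "r / S"] conjI allI impI)
      fix h :: complex assume h: "h \<noteq> 0 \<and> norm (h - 0) < r / S"
      have "cmod (h * v i) < r" if "i \<in> I" for i
      proof -
        have "cmod (h * v i) \<le> cmod h * S" using vS[OF that] by (auto simp: norm_mult intro: mult_left_mono)
        also have "\<dots> < r" using h S by (simp add: field_simps)
        finally show ?thesis .
      qed
      hence "cmod (f (\<lambda>i. p i + h * v i) - f p - (\<Sum>i\<in>I. d i * (p i + h * v i - p i)))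
        \<le> (e / (2 * S)) * (\<Sum>i\<in>I. cmod (p i + h * v i - p i))"
        using r(1) by (intro r(2)) auto
      hence "cmod (f (\<lambda>i. p i + h * v i) - f p - h * (\<Sum>i\<in>I. d i * v i))
        \<le> (e / (2 * S)) * (cmod h * (\<Sum>i\<in>I. cmod (v i)))"
        by (simp add: norm_mult sum_distrib_left mult_ac)
      also have "\<dots> \<le> (e / (2 * S)) * (cmod h * S)"
        using e S by (intro mult_left_mono) (auto simp: S_def)
      also have "\<dots> = cmod h * (e / 2)" using S by simp
      finally have "cmod (f (\<lambda>i. p i + h * v i) - f p - h * (\<Sum>i\<in>I. d i * v i)) / cmod h \<le> e / 2"
        using h by (simp add: field_simps)
      also have "cmod (f (\<lambda>i. p i + h * v i) - f p - h * (\<Sum>i\<in>I. d i * v i)) / cmod h =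
        cmod ((f (\<lambda>i. p i + h * v i) - f p) / h - (\<Sum>i\<in>I. d i * v i))"
        using h by (simp add: norm_divide[symmetric] diff_divide_distrib)
      finally show "norm ((f (\<lambda>i. p i + h * v i) - f p) / h - (\<Sum>i\<in>I. d i * v i)) < e"
        using e by simp
    qed (use r S in auto)
  qed
  thus ?thesis unfolding DERIV_def by simp
qed

section \<open>Fixed points and zeros depending on a parameter\<close>

text \<open>Iteration from the centre \<open>p\<close> in the sum norm over \<open>J\<close>: the
  increments are dominated by a geometric series, so each coordinate in \<open>J\<close> converges.
  Coordinates outside \<open>J\<close> are never controlled, hence the fixed point equation is
  claimed on \<open>J\<close> only.\<close>

lemma contraction_fixed_point:
  fixes G :: "('j \<Rightarrow> complex) \<Rightarrow> ('j \<Rightarrow> complex)"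
  assumes fin: "finite J" and r: "r \<ge> 0"
    and maps: "\<And>x. (\<Sum>j\<in>J. cmod (x j - p j)) \<le> r \<Longrightarrow> (\<Sum>j\<in>J. cmod (G x j - p j)) \<le> r"
    and contr: "\<And>x y. (\<Sum>j\<in>J. cmod (x j - p j)) \<le> r \<Longrightarrow> (\<Sum>j\<in>J. cmod (y j - p j)) \<le> r \<Longrightarrow>
       (\<Sum>j\<in>J. cmod (G x j - G y j)) \<le> (1/2) * (\<Sum>j\<in>J. cmod (x j - y j))"
  shows "\<exists>x. (\<Sum>j\<in>J. cmod (x j - p j)) \<le> r \<and> (\<forall>j\<in>J. G x j = x j)"
proof -
  define X where "X = (\<lambda>m. (G ^^ m) p)"
  have X0: "X 0 = p" and XS: "X (Suc m) = G (X m)" for m by (auto simp: X_def)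
  have inB: "(\<Sum>j\<in>J. cmod (X m j - p j)) \<le> r" for m
    by (induction m) (auto simp: X0 XS r intro: maps)
  define c where "c = (\<Sum>j\<in>J. cmod (X 1 j - X 0 j))"
  have step: "(\<Sum>j\<in>J. cmod (X (Suc m) j - X m j)) \<le> c * (1/2) ^ m" for m
  proof (induction m)
    case (Suc m)
    have "(\<Sum>j\<in>J. cmod (X (Suc (Suc m)) j - X (Suc m) j)) \<le> (1/2) * (\<Sum>j\<in>J. cmod (X (Suc m) j - X m j))"
      using contr[OF inB[of "Suc m"] inB[of m]] by (simp add: XS)
    thus ?case using Suc by simp
  qed (simp add: c_def)
  have conv: "\<exists>l. (\<lambda>m. X m j) \<longlonglongrightarrow> l" if j: "j \<in> J" for j
  proof -
    have "summable (\<lambda>m. X (Suc m) j - X m j)"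
    proof (rule summable_comparison_test[of _ "\<lambda>m. c * (1/2) ^ m"])
      have "norm (X (Suc m) j - X m j) \<le> c * (1/2) ^ m" for m
        using member_le_sum[of j J "\<lambda>j. cmod (X (Suc m) j - X m j)"] step[of m] j fin by force
      thus "\<exists>N. \<forall>m\<ge>N. norm (X (Suc m) j - X m j) \<le> c * (1/2) ^ m" by blast
    qed (auto intro: summable_mult summable_geometric)
    hence "(\<lambda>m. \<Sum>i<m. X (Suc i) j - X i j) \<longlonglongrightarrow> (\<Sum>m. X (Suc m) j - X m j)"
      by (rule summable_LIMSEQ)
    hence "(\<lambda>m. X m j - X 0 j) \<longlonglongrightarrow> (\<Sum>m. X (Suc m) j - X m j)"
      by (simp only: sum_lessThan_telescope[of "\<lambda>m. X m j"])
    hence "(\<lambda>m. (X m j - X 0 j) + X 0 j) \<longlonglongrightarrow> (\<Sum>m. X (Suc m) j - X m j) + X 0 j"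
      by (intro tendsto_add tendsto_const)
    thus ?thesis by auto
  qed
  then obtain x where x: "\<And>j. j \<in> J \<Longrightarrow> (\<lambda>m. X m j) \<longlonglongrightarrow> x j" by metis
  have lim: "(\<lambda>m. \<Sum>j\<in>J. cmod (X m j - p j)) \<longlonglongrightarrow> (\<Sum>j\<in>J. cmod (x j - p j))"
    by (intro tendsto_sum tendsto_norm tendsto_diff x tendsto_const)
  have xB: "(\<Sum>j\<in>J. cmod (x j - p j)) \<le> r"
    using LIMSEQ_le_const2[OF lim] inB by blast
  have l0: "(\<lambda>m. \<Sum>j\<in>J. cmod (X m j - x j)) \<longlonglongrightarrow> (\<Sum>j\<in>J. cmod (x j - x j))"
    by (intro tendsto_sum tendsto_norm tendsto_diff x tendsto_const)
  hence l0: "(\<lambda>m. \<Sum>j\<in>J. cmod (X m j - x j)) \<longlonglongrightarrow> 0" by simp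
  have "G x j = x j" if j: "j \<in> J" for j
  proof -
    have "(\<lambda>m. X (Suc m) j - G x j) \<longlonglongrightarrow> 0"
    proof (rule tendsto_0_le[OF l0, where K = 1])
      show "\<forall>\<^sub>F m in sequentially. norm (X (Suc m) j - G x j) \<le> norm (\<Sum>j\<in>J. cmod (X m j - x j)) * 1"
      proof (rule always_eventually, rule allI)
        fix m
        have "norm (X (Suc m) j - G x j) \<le> (\<Sum>j\<in>J. cmod (G (X m) j - G x j))"
          using member_le_sum[of j J "\<lambda>j. cmod (G (X m) j - G x j)"] j fin by (auto simp: XS)
        also have "\<dots> \<le> (1/2) * (\<Sum>j\<in>J. cmod (X m j - x j))" by (rule contr[OF inB xB])
        also have "\<dots> \<le> (\<Sum>j\<in>J. cmod (X m j - x j))" using sum_nonneg[of J "\<lambda>j. cmod (X m j - x j)"] by simp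
        finally show "norm (X (Suc m) j - G x j) \<le> norm (\<Sum>j\<in>J. cmod (X m j - x j)) * 1" by simp
      qed
    qed
    hence "(\<lambda>m. X (Suc m) j) \<longlonglongrightarrow> G x j" by (simp add: LIM_zero_iff)
    moreover have "(\<lambda>m. X (Suc m) j) \<longlonglongrightarrow> x j" using x[OF j] by (rule LIMSEQ_Suc)
    ultimately show ?thesis by (rule LIMSEQ_unique)
  qed
  with xB show ?thesis by blast
qed

lemma det_nonzero_inverse:
  fixes D :: "'a::field mat"
  assumes "D \<in> carrier_mat n n" "det D \<noteq> 0"
  obtains A where "A \<in> carrier_mat n n" "A * D = 1\<^sub>m n" "D * A = 1\<^sub>m n"
proof -
  have "D \<in> Units (ring_mat TYPE('a) n ())" by (rule det_non_zero_imp_unit[OF assms])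
  thus ?thesis using that unfolding Units_def by (auto simp: ring_mat_def)
qed

text \<open>Once \<open>J\<close> is numbered by \<open>{0..<N}\<close>, an injective square system
  has an invertible matrix, and \<open>a\<close> is its inverse. The second conjunct, injectivity of
  the inverse, lets a fixed point of the Newton map be recognised as a zero.\<close>

lemma left_inverse_coeffs:
  fixes d :: "nat \<Rightarrow> 'j \<Rightarrow> complex"
  assumes fin: "finite J" and N: "card J = N"
    and inj: "\<And>v. (\<And>e. e < N \<Longrightarrow> (\<Sum>j\<in>J. d e j * v j) = 0) \<Longrightarrow> \<forall>j\<in>J. v j = 0"
  shows "\<exists>a :: 'j \<Rightarrow> nat \<Rightarrow> complex.
    (\<forall>v. \<forall>j\<in>J. (\<Sum>e<N. a j e * (\<Sum>j'\<in>J. d e j' * v j')) = v j) \<and>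
    (\<forall>w. (\<forall>j\<in>J. (\<Sum>e<N. a j e * w e) = 0) \<longrightarrow> (\<forall>e<N. w e = 0))"
proof -
  obtain \<phi> where \<phi>: "bij_betw \<phi> {0..<N} J" using ex_bij_betw_nat_finite[OF fin] N by auto
  define \<psi> where "\<psi> = inv_into {0..<N} \<phi>"
  have \<psi>1: "\<psi> (\<phi> b) = b" if "b < N" for b
    using bij_betw_inv_into_left[OF \<phi>] that by (auto simp: \<psi>_def)
  have \<psi>2: "\<phi> (\<psi> j) = j" "\<psi> j < N" if "j \<in> J" for j
    using bij_betw_inv_into_right[OF \<phi> that] bij_betwE[OF bij_betw_inv_into[OF \<phi>]] that
    by (auto simp: \<psi>_def)
  have reidx: "(\<Sum>j\<in>J. f j) = (\<Sum>b = 0..<N. f (\<phi> b))" for f :: "'j \<Rightarrow> complex"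
    using sum.reindex_bij_betw[OF \<phi>, of f] by simp
  define D where "D = mat N N (\<lambda>(e, b). d e (\<phi> b))"
  have D: "D \<in> carrier_mat N N" by (simp add: D_def)
  have Dv: "(D *\<^sub>v vec N v) $ e = (\<Sum>b = 0..<N. d e (\<phi> b) * v b)" if "e < N" for e v
    using that by (simp add: D_def scalar_prod_def)
  have "det D \<noteq> 0"
  proof
    assume "det D = 0"
    then obtain v where v: "v \<in> carrier_vec N" "v \<noteq> 0\<^sub>v N" "D *\<^sub>v v = 0\<^sub>v N"
      using det_0_iff_vec_prod_zero[OF D] by auto
    have "vec N (\<lambda>b. v $ b) = v" using v(1) by auto
    hence "(\<Sum>b = 0..<N. d e (\<phi> b) * (v $ b)) = 0" if "e < N" for e
      using Dv[OF that, of "\<lambda>b. v $ b"] v(3) that by simp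
    hence "(\<Sum>j\<in>J. d e j * (v $ \<psi> j)) = 0" if "e < N" for e
      using that by (simp add: reidx \<psi>1)
    from inj[OF this] have "\<forall>j\<in>J. v $ \<psi> j = 0" by simp
    hence "v $ b = 0" if "b < N" for b using \<psi>1[OF that] bij_betwE[OF \<phi>] that by force
    hence "v = 0\<^sub>v N" using v(1) by auto
    thus False using v(2) by simp
  qed
  then obtain A where A: "A \<in> carrier_mat N N" "A * D = 1\<^sub>m N" "D * A = 1\<^sub>m N"
    using det_nonzero_inverse[OF D] by blast
  have Aw: "(A *\<^sub>v vec N w) $ b = (\<Sum>e<N. A $$ (b, e) * w e)" if "b < N" for b w
    using that A(1) by (simp add: scalar_prod_def lessThan_atLeast0)
  show ?thesis
  proof (intro exI[of _ "\<lambda>j e. A $$ (\<psi> j, e)"] conjI allI ballI impI)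
    fix v :: "'j \<Rightarrow> complex" and j assume j: "j \<in> J"
    let ?v = "vec N (\<lambda>b. v (\<phi> b))"
    have "A *\<^sub>v (D *\<^sub>v ?v) = ?v"
      using A D by (subst assoc_mult_mat_vec[symmetric]) auto
    moreover have "D *\<^sub>v ?v = vec N (\<lambda>e. \<Sum>j'\<in>J. d e j' * v j')"
      using D by (intro eq_vecI) (auto simp: Dv reidx simp del: index_mult_mat_vec)
    ultimately have "(A *\<^sub>v vec N (\<lambda>e. \<Sum>j'\<in>J. d e j' * v j')) $ \<psi> j = ?v $ \<psi> j" by simp
    thus "(\<Sum>e<N. A $$ (\<psi> j, e) * (\<Sum>j'\<in>J. d e j' * v j')) = v j"
      using \<psi>2[OF j] by (simp add: Aw del: index_mult_mat_vec)
  next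
    fix w e assume w: "\<forall>j\<in>J. (\<Sum>e<N. A $$ (\<psi> j, e) * w e) = 0" and e: "e < N"
    have "(\<Sum>e<N. A $$ (b, e) * w e) = 0" if "b < N" for b
      using w[rule_format, of "\<phi> b"] \<psi>1[OF that] bij_betwE[OF \<phi>] that by auto
    hence "A *\<^sub>v vec N w = 0\<^sub>v N"
      using A(1) by (intro eq_vecI) (auto simp: Aw simp del: index_mult_mat_vec)
    hence "D *\<^sub>v (A *\<^sub>v vec N w) = 0\<^sub>v N" using D by auto
    hence "vec N w = 0\<^sub>v N" using A D by (subst (asm) assoc_mult_mat_vec[symmetric]) auto
    hence "vec N w $ e = 0\<^sub>v N $ e" by simp
    thus "w e = 0" using e by simp
  qed
qed

text \<open>The functions depend on the unknowns \<open>Some j\<close> and on a parameter, the coordinate \<open>None\<close>.\<close>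
definition isolated_zero ::
  "nat \<Rightarrow> (nat \<Rightarrow> ('j option \<Rightarrow> complex) \<Rightarrow> complex) \<Rightarrow> 'j set \<Rightarrow> ('j \<Rightarrow> complex) \<Rightarrow> real \<Rightarrow> complex \<Rightarrow> ('j \<Rightarrow> complex) \<Rightarrow> bool" where
  "isolated_zero N F J q r t x \<longleftrightarrow>
    (\<Sum>j\<in>J. cmod (x j - q j)) \<le> r \<and> (\<forall>e<N. F e (case_option t x) = 0) \<and>
    (\<forall>y. (\<Sum>j\<in>J. cmod (y j - q j)) \<le> r \<longrightarrow> (\<forall>e<N. F e (case_option t y) = 0) \<longrightarrow> (\<forall>j\<in>J. y j = x j)) \<and>
    (\<forall>v. (\<forall>e<N. ((\<lambda>s. F e (case_option t (\<lambda>j. x j + s * v j))) has_field_derivative 0) (at 0))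
      \<longrightarrow> (\<forall>j\<in>J. v j = 0))"

text \<open>Solved by iterating x - A F(t, x), where A inverts the derivative in x at t = 0. Both
  arguments of the strict estimate carry the same \<open>t\<close>, so the parameter increments
  cancel and the contraction is uniform in \<open>t\<close>. The radius \<open>r\<close> is fixed
  before \<open>\<delta>\<close>: uniqueness holds in a ball that does not shrink with
  \<open>t\<close>.\<close>

lemma parametric_inverse_function:
  fixes F :: "nat \<Rightarrow> ('j option \<Rightarrow> complex) \<Rightarrow> complex" and q :: "'j \<Rightarrow> complex"
  assumes fin: "finite J" and N: "card J = N"
    and sd: "\<And>e. e < N \<Longrightarrow> strict_deriv (insert None (Some ` J)) (case_option 0 q) (F e) (d e)"
    and zero: "\<And>e. e < N \<Longrightarrow> F e (case_option 0 q) = 0"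
    and inj: "\<And>v. (\<And>e. e < N \<Longrightarrow> (\<Sum>j\<in>J. d e (Some j) * v j) = 0) \<Longrightarrow> \<forall>j\<in>J. v j = 0"
    and r0: "r0 > 0"
  shows "\<exists>r>0. r \<le> r0 \<and> (\<exists>\<delta>>0. \<forall>t. cmod t < \<delta> \<longrightarrow> (\<exists>x. isolated_zero N F J q r t x))"
proof -
  let ?I = "insert None (Some ` J)"
  have finI: "finite ?I" using fin by simp
  have sumI: "(\<Sum>i\<in>?I. f i) = f None + (\<Sum>j\<in>J. f (Some j))" for f :: "'j option \<Rightarrow> 'z::comm_monoid_add"
    using fin by (subst sum.insert) (auto simp: sum.reindex)
  have "\<exists>a :: 'j \<Rightarrow> nat \<Rightarrow> complex.
    (\<forall>v. \<forall>j\<in>J. (\<Sum>e<N. a j e * (\<Sum>j'\<in>J. d e (Some j') * v j')) = v j) \<and>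
    (\<forall>w. (\<forall>j\<in>J. (\<Sum>e<N. a j e * w e) = 0) \<longrightarrow> (\<forall>e<N. w e = 0))"
    by (rule left_inverse_coeffs[OF fin N]) (rule inj)
  then obtain a where a: "\<forall>v. \<forall>j\<in>J. (\<Sum>e<N. a j e * (\<Sum>j'\<in>J. d e (Some j') * v j')) = v j"
    "\<forall>w. (\<forall>j\<in>J. (\<Sum>e<N. a j e * w e) = 0) \<longrightarrow> (\<forall>e<N. w e = 0)" by blast
  have a1: "(\<Sum>e<N. a j e * (\<Sum>j'\<in>J. d e (Some j') * v j')) = v j" if "j \<in> J" for v j
    using a(1) that by blast
  have a2: "w e = 0" if "\<And>j. j \<in> J \<Longrightarrow> (\<Sum>e<N. a j e * w e) = 0" "e < N" for w e
    using a(2) that by simp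
  define C where "C = (\<Sum>j\<in>J. \<Sum>e<N. cmod (a j e))"
  have C: "C \<ge> 0" unfolding C_def by (intro sum_nonneg) auto
  have aC: "(\<Sum>j\<in>J. cmod (\<Sum>e<N. a j e * w e)) \<le> C * M" if "\<And>e. e < N \<Longrightarrow> cmod (w e) \<le> M" for w M
  proof -
    have "(\<Sum>j\<in>J. cmod (\<Sum>e<N. a j e * w e)) \<le> (\<Sum>j\<in>J. \<Sum>e<N. cmod (a j e) * M)"
      by (intro sum_mono order_trans[OF norm_sum])
        (auto simp: norm_mult intro!: mult_left_mono that)
    thus ?thesis by (simp add: C_def sum_distrib_right)
  qed
  \<comment> \<open>With this choice the linearisation error, after multiplication by the inverse
    matrix, is at most half the distance.\<close>
  define \<eta> where "\<eta> = 1 / (2 * (C + 1))"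
  have \<eta>: "\<eta> > 0" "C * \<eta> \<le> 1/2" using C by (auto simp: \<eta>_def field_simps)
  have "\<forall>e\<in>{..<N}. \<exists>r. approx_linear ?I (case_option 0 q) (F e) (d e) \<eta> r"
    using sd \<eta>(1) unfolding strict_deriv_def by simp
  from bchoice[OF this] obtain rr where rr: "\<forall>e\<in>{..<N}. approx_linear ?I (case_option 0 q) (F e) (d e) \<eta> (rr e)" ..
  have rr: "approx_linear ?I (case_option 0 q) (F e) (d e) \<eta> (rr e)" if "e < N" for e
    using rr that by blast
  define R where "R = Min (insert 1 (rr ` {..<N}))"
  have R: "R > 0" "\<And>e. e < N \<Longrightarrow> R \<le> rr e" using approx_linearD(1)[OF rr] by (auto simp: R_def)
  \<comment> \<open>Half of \<open>R\<close> leaves room for the points \<open>x j + s * v j\<close>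
    that are needed when the derivative at the zero \<open>x\<close> is examined.\<close>
  define r where "r = min r0 (R / 2)"
  have r: "r > 0" "r \<le> r0" "r \<le> R / 2" using R r0 by (auto simp: r_def)
  \<comment> \<open>Makes a single Newton step move the centre \<open>q\<close> by at most
    \<open>r / 2\<close>, so that the ball is mapped into itself.\<close>
  define \<epsilon> where "\<epsilon> = r / (2 * (C + 1))"
  have \<epsilon>: "\<epsilon> > 0" "C * \<epsilon> \<le> r / 2" using C r by (auto simp: \<epsilon>_def field_simps)
  have "\<forall>e\<in>{..<N}. \<exists>r>0. \<forall>x. (\<forall>i\<in>?I. cmod (x i - case_option 0 q i) < r) \<longrightarrow>
      cmod (F e x - F e (case_option 0 q)) \<le> \<epsilon>"
  proof
    fix e assume "e \<in> {..<N}"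
    hence e: "e < N" by simp
    show "\<exists>r>0. \<forall>x. (\<forall>i\<in>?I. cmod (x i - case_option 0 q i) < r) \<longrightarrow>
      cmod (F e x - F e (case_option 0 q)) \<le> \<epsilon>"
      by (rule strict_deriv_continuous[OF finI sd[OF e] \<epsilon>(1)]) blast
  qed
  from bchoice[OF this] obtain r' where r0': "\<forall>e\<in>{..<N}. 0 < r' e \<and> (\<forall>x.
     (\<forall>i\<in>?I. cmod (x i - case_option 0 q i) < r' e) \<longrightarrow> cmod (F e x - F e (case_option 0 q)) \<le> \<epsilon>)" ..
  have r': "r' e > 0"
    "\<And>x. (\<forall>i\<in>?I. cmod (x i - case_option 0 q i) < r' e) \<Longrightarrow> cmod (F e x) \<le> \<epsilon>" if "e < N" for e
    using r0' that zero[OF that] by fastforce+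
  define R' where "R' = Min (insert 1 (r' ` {..<N}))"
  have R': "R' > 0" "\<And>e. e < N \<Longrightarrow> R' \<le> r' e" using r'(1) by (auto simp: R'_def)
  define \<delta> where "\<delta> = min R R'"
  have \<delta>: "\<delta> > 0" "\<delta> \<le> R" "\<delta> \<le> R'" using R R' by (auto simp: \<delta>_def)
  show ?thesis
  proof (rule exI[of _ r], intro conjI r exI[of _ \<delta>] \<delta> allI impI)
    fix t :: complex assume t: "cmod t < \<delta>"
    define c where "c = (\<lambda>x::'j \<Rightarrow> complex. case_option t x)"
    define B where "B = {x. (\<Sum>j\<in>J. cmod (x j - q j)) \<le> r}"
    have Bc: "cmod (x j - q j) \<le> r" if "x \<in> B" "j \<in> J" for x j
      using that member_le_sum[of j J "\<lambda>j. cmod (x j - q j)"] fin by (auto simp: B_def)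
    have approx: "cmod (F e (c x) - F e (c y) - (\<Sum>j\<in>J. d e (Some j) * (x j - y j)))
        \<le> \<eta> * (\<Sum>j\<in>J. cmod (x j - y j))"
      if "e < N" "\<And>j. j \<in> J \<Longrightarrow> cmod (x j - q j) < R" "\<And>j. j \<in> J \<Longrightarrow> cmod (y j - q j) < R" for e x y
    proof -
      note xb = that(2) and yb = that(3)
      have b: "cmod (c z i - case_option 0 q i) < rr e"
        if "i \<in> ?I" "\<And>j. j \<in> J \<Longrightarrow> cmod (z j - q j) < R" for z i
        using that t \<delta>(2) R(2)[OF \<open>e < N\<close>] by (force simp: c_def)
      have "cmod (F e (c x) - F e (c y) - (\<Sum>i\<in>?I. d e i * (c x i - c y i))) \<le> \<eta> * (\<Sum>i\<in>?I. cmod (c x i - c y i))"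
        by (rule approx_linearD(2)[OF rr[OF that(1)]]) (erule b, erule xb yb)+
      thus ?thesis by (simp add: sumI c_def)
    qed
    define G where "G = (\<lambda>x j. x j - (\<Sum>e<N. a j e * F e (c x)))"
    have GG: "(\<Sum>j\<in>J. cmod (G x j - G y j)) \<le> (1/2) * (\<Sum>j\<in>J. cmod (x j - y j))"
      if "x \<in> B" "y \<in> B" for x y
    proof -
      let ?S = "\<Sum>j\<in>J. cmod (x j - y j)"
      define w where "w = (\<lambda>e. F e (c x) - F e (c y) - (\<Sum>j\<in>J. d e (Some j) * (x j - y j)))"
      have w: "cmod (w e) \<le> \<eta> * ?S" if "e < N" for e
        unfolding w_def using that Bc[OF \<open>x \<in> B\<close>] Bc[OF \<open>y \<in> B\<close>] r R(1)
        by (intro approx) force+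
      have "G x j - G y j = - (\<Sum>e<N. a j e * w e)" if "j \<in> J" for j
        using a1[OF that, of "\<lambda>j. x j - y j"]
        by (simp add: G_def w_def right_diff_distrib sum_subtractf)
      hence "(\<Sum>j\<in>J. cmod (G x j - G y j)) = (\<Sum>j\<in>J. cmod (\<Sum>e<N. a j e * w e))" by simp
      also have "\<dots> \<le> C * (\<eta> * ?S)" by (rule aC[OF w])
      also have "\<dots> = (C * \<eta>) * ?S" by simp
      also have "\<dots> \<le> (1/2) * ?S" by (rule mult_right_mono[OF \<eta>(2)]) (auto intro: sum_nonneg)
      finally show ?thesis .
    qed
    have qB: "q \<in> B" using r by (simp add: B_def)
    have Fq: "cmod (F e (c q)) \<le> \<epsilon>" if "e < N" for e
      using R'(2)[OF that] R' t \<delta>(3) by (intro r'(2) that) (auto simp: c_def)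
    have Gm: "(\<Sum>j\<in>J. cmod (G x j - q j)) \<le> r" if x: "x \<in> B" for x
    proof -
      have "(\<Sum>j\<in>J. cmod (G x j - q j)) \<le> (\<Sum>j\<in>J. cmod (G x j - G q j) + cmod (G q j - q j))"
        by (intro sum_mono order_trans[OF _ norm_triangle_ineq]) simp
      also have "\<dots> = (\<Sum>j\<in>J. cmod (G x j - G q j)) + (\<Sum>j\<in>J. cmod (\<Sum>e<N. a j e * F e (c q)))"
        by (simp add: sum.distrib G_def)
      also have "\<dots> \<le> (1/2) * r + C * \<epsilon>"
        using GG[OF x qB] x by (intro add_mono aC[OF Fq]) (auto simp: B_def)
      also have "\<dots> \<le> r" using \<epsilon>(2) by simp
      finally show ?thesis .
    qed
    have "\<exists>x. (\<Sum>j\<in>J. cmod (x j - q j)) \<le> r \<and> (\<forall>j\<in>J. G x j = x j)"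
      by (rule contraction_fixed_point[OF fin]) (use r Gm GG in \<open>auto simp: B_def\<close>)
    then obtain x where x: "x \<in> B" "\<forall>j\<in>J. G x j = x j" by (auto simp: B_def)
    have xF: "F e (c x) = 0" if "e < N" for e
      by (rule a2[OF _ that, of "\<lambda>e. F e (c x)"]) (use x(2) in \<open>simp add: G_def\<close>)
    have uniq: "\<forall>j\<in>J. y j = x j" if y: "y \<in> B" "\<forall>e<N. F e (c y) = 0" for y
    proof -
      have "(\<Sum>j\<in>J. cmod (G y j - G x j)) = (\<Sum>j\<in>J. cmod (y j - x j))"
        using y(2) xF by (simp add: G_def)
      hence "(\<Sum>j\<in>J. cmod (y j - x j)) \<le> 0" using GG[OF y(1) x(1)] by simp
      hence "(\<Sum>j\<in>J. cmod (y j - x j)) = 0" by (intro antisym sum_nonneg) auto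
      thus ?thesis using fin by (auto simp: sum_nonneg_eq_0_iff)
    qed
    \<comment> \<open>If all derivatives along \<open>v\<close> vanish at \<open>x\<close>, the
      gradient at the base point, applied to \<open>v\<close>, is at most \<open>\<eta>\<close>
      times the norm of \<open>v\<close>. The inverse matrix turns this into norm \<le> norm / 2,
      which forces \<open>v\<close> to vanish.\<close>
    have nondeg: "\<forall>j\<in>J. v j = 0"
      if v: "\<And>e. e < N \<Longrightarrow> ((\<lambda>s. F e (c (\<lambda>j. x j + s * v j))) has_field_derivative 0) (at 0)" for v
    proof -
      define S where "S = (\<Sum>j\<in>J. cmod (v j))"
      have S: "S \<ge> 0" by (auto simp: S_def intro: sum_nonneg)
      have vS: "cmod (v j) \<le> S" if "j \<in> J" for j
        using member_le_sum[of j J "\<lambda>j. cmod (v j)"] that fin by (auto simp: S_def)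
      have bound: "cmod (\<Sum>j\<in>J. d e (Some j) * v j) \<le> \<eta> * S" if e: "e < N" for e
      proof -
        let ?D = "\<Sum>j\<in>J. d e (Some j) * v j"
        let ?Q = "\<lambda>s. (F e (c (\<lambda>j. x j + s * v j)) - F e (c x)) / s"
        have "?Q \<midarrow>0\<rightarrow> 0" using v[OF e] by (simp add: DERIV_def)
        hence lim: "(\<lambda>s. cmod (?Q s - ?D)) \<midarrow>0\<rightarrow> cmod (0 - ?D)"
          by (intro tendsto_norm tendsto_diff tendsto_const)
        have "eventually (\<lambda>s. cmod (?Q s - ?D) \<le> \<eta> * S) (at 0)"
          unfolding eventually_at
        proof (intro exI[of _ "R / (2 * (S + 1))"] conjI ballI impI)
          show "0 < R / (2 * (S + 1))" using R(1) S by simp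
          fix s :: complex assume "s \<noteq> 0 \<and> dist s 0 < R / (2 * (S + 1))"
          hence s: "s \<noteq> 0" "cmod s < R / (2 * (S + 1))" by (auto simp: dist_norm)
          have sv: "cmod (x j + s * v j - q j) < R" if "j \<in> J" for j
          proof -
            have "cmod (s * v j) \<le> cmod s * (S + 1)"
              using vS[OF that] by (auto simp: norm_mult intro!: mult_left_mono)
            also have "\<dots> < R / 2" using s(2) S by (simp add: field_simps)
            finally have "cmod (s * v j) < R / 2" .
            moreover have "cmod (x j - q j) \<le> R / 2" using Bc[OF x(1) that] r by simp
            ultimately show ?thesis
              using norm_triangle_ineq[of "x j - q j" "s * v j"] by (simp add: algebra_simps)
          qed
          have "cmod (F e (c (\<lambda>j. x j + s * v j)) - F e (c x) - (\<Sum>j\<in>J. d e (Some j) * (x j + s * v j - x j)))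
             \<le> \<eta> * (\<Sum>j\<in>J. cmod (x j + s * v j - x j))"
            using sv Bc[OF x(1)] r R(1) by (intro approx e) force+
          hence "cmod (F e (c (\<lambda>j. x j + s * v j)) - F e (c x) - s * ?D) \<le> cmod s * (\<eta> * S)"
            by (simp add: norm_mult sum_distrib_left S_def mult_ac)
          hence "cmod (F e (c (\<lambda>j. x j + s * v j)) - F e (c x) - s * ?D) / cmod s \<le> \<eta> * S"
            using s by (simp add: field_simps)
          thus "cmod (?Q s - ?D) \<le> \<eta> * S"
            using s by (simp add: norm_divide[symmetric] diff_divide_distrib)
        qed
        from tendsto_upperbound[OF lim this] show ?thesis by simp
      qed
      have "S = (\<Sum>j\<in>J. cmod (\<Sum>e<N. a j e * (\<Sum>j'\<in>J. d e (Some j') * v j')))"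
        unfolding S_def by (intro sum.cong refl) (simp add: a1)
      also have "\<dots> \<le> C * (\<eta> * S)" by (rule aC[OF bound])
      also have "\<dots> = (C * \<eta>) * S" by simp
      also have "\<dots> \<le> (1/2) * S" using S by (intro mult_right_mono \<eta>)
      finally have "S = 0" using S by simp
      thus ?thesis using fin by (auto simp: S_def sum_nonneg_eq_0_iff)
    qed
    show "\<exists>x. isolated_zero N F J q r t x"
      unfolding isolated_zero_def
    proof (intro exI[of _ x] conjI allI impI)
      show "(\<Sum>j\<in>J. cmod (x j - q j)) \<le> r" using x(1) by (simp add: B_def)
    next
      fix e assume "e < N"
      thus "F e (case_option t x) = 0" using xF by (simp add: c_def)
    next
      fix y assume "(\<Sum>j\<in>J. cmod (y j - q j)) \<le> r" "\<forall>e<N. F e (case_option t y) = 0"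
      thus "\<forall>j\<in>J. y j = x j" by (intro uniq) (simp_all add: B_def c_def)
    next
      fix v assume "\<forall>e<N. ((\<lambda>s. F e (case_option t (\<lambda>j. x j + s * v j))) has_field_derivative 0) (at 0)"
      thus "\<forall>j\<in>J. v j = 0" by (intro nondeg) (simp add: c_def)
    qed
  qed
qed

subsection \<open>Bruhat order and saturated chains\<close>

lemma ksetD:
  assumes "A \<in> kset n k"
  shows "finite A" "card A = k" "A \<subseteq> {1..n}"
  using assms finite_subset[of A "{1..n}"] by (auto simp: kset_def)

lemma finite_kset: "finite (kset n k)"
  by (rule finite_subset[of _ "Pow {1..n}"]) (auto simp: kset_def)

lemma seq_strict:
  assumes "A \<in> kset n k" "i < j" "j < k"
  shows "seq A ! i < seq A ! j"
  using sorted_wrt_nth_less[OF strict_sorted_list_of_set, of i j A] assms ksetD[OF assms(1)]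
  by (auto simp: seq_def)

lemma seq_image:
  assumes "A \<in> kset n k"
  shows "A = (\<lambda>i. seq A ! i) ` {..<k}"
proof -
  have "A = set (seq A)" using ksetD(1)[OF assms] by (simp add: seq_def)
  also have "\<dots> = (\<lambda>i. seq A ! i) ` {..<length (seq A)}"
    by (auto simp: set_conv_nth image_def)
  finally show ?thesis using ksetD[OF assms] by (simp add: seq_def)
qed

lemma seq_mem:
  assumes "A \<in> kset n k" "i < k"
  shows "seq A ! i \<in> A" "1 \<le> seq A ! i" "seq A ! i \<le> n"
proof -
  show "seq A ! i \<in> A" using seq_image[OF assms(1)] assms(2) by blast
  thus "1 \<le> seq A ! i" "seq A ! i \<le> n" using ksetD(3)[OF assms(1)] by auto
qed

lemma seq_inj:
  assumes "A \<in> kset n k" "i < k" "j < k" "seq A ! i = seq A ! j"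
  shows "i = j"
  using seq_strict[OF assms(1)] assms by (metis less_irrefl linorder_neqE_nat)

lemma seq_inj_on: "A \<in> kset n k \<Longrightarrow> inj_on (\<lambda>i. seq A ! i) {..<k}"
  using seq_inj by (auto simp: inj_on_def)

lemma seq_obtain:
  assumes "A \<in> kset n k" "c \<in> A"
  obtains i where "i < k" "c = seq A ! i"
  using seq_image[OF assms(1)] assms(2) by auto

lemma seq_ge: "A \<in> kset n k \<Longrightarrow> i < k \<Longrightarrow> Suc i \<le> seq A ! i"
proof (induction i)
  case 0
  thus ?case using seq_mem(2) by fastforce
next
  case (Suc i)
  thus ?case using seq_strict[of A n k i "Suc i"] by simp
qed

lemma seq_le:
  assumes A: "A \<in> kset n k" and "i < k"
  shows "seq A ! i + (k - Suc i) \<le> n"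
proof -
  have "seq A ! i + d \<le> seq A ! (i + d)" if "i + d < k" for d
    using that
  proof (induction d)
    case (Suc d)
    thus ?case using seq_strict[OF A, of "i + d" "i + Suc d"] by simp
  qed simp
  from this[of "k - Suc i"] show ?thesis using seq_mem(3)[OF A, of "k - 1"] assms(2) by simp
qed

lemma seq_of_strict_mono:
  assumes "\<And>i j. i < j \<Longrightarrow> j < k \<Longrightarrow> f i < f j" "\<And>i. i < k \<Longrightarrow> 1 \<le> f i \<and> f i \<le> n"
  shows "f ` {..<k} \<in> kset n k" "\<And>i. i < k \<Longrightarrow> seq (f ` {..<k}) ! i = f i"
proof -
  have inj: "inj_on f {..<k}"
    using assms(1) by (auto simp: inj_on_def) (metis less_irrefl linorder_neqE_nat)
  show "f ` {..<k} \<in> kset n k"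
    using assms(2) inj by (auto simp: kset_def card_image)
  have "sorted_wrt (<) (map f [0..<k])"
    using assms(1) by (auto simp: sorted_wrt_iff_nth_less)
  hence "sorted_list_of_set (f ` {..<k}) = map f [0..<k]"
    by (intro strict_sorted_equal) (auto simp: lessThan_atLeast0)
  thus "seq (f ` {..<k}) ! i = f i" if "i < k" for i using that by (simp add: seq_def)
qed

lemma kset_eqI:
  assumes "A \<in> kset n k" "B \<in> kset n k" "\<And>i. i < k \<Longrightarrow> seq A ! i = seq B ! i"
  shows "A = B"
proof -
  have "(\<lambda>i. seq A ! i) ` {..<k} = (\<lambda>i. seq B ! i) ` {..<k}" using assms(3) by auto
  thus ?thesis using seq_image[OF assms(1)] seq_image[OF assms(2)] by simp
qed

lemma bruhat_le_iff:
  "\<alpha> \<in> kset n k \<Longrightarrow> bruhat_le \<beta> \<alpha> \<longleftrightarrow> (\<forall>j<k. seq \<beta> ! j \<le> seq \<alpha> ! j)"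
  using ksetD by (auto simp: bruhat_le_def)

lemma bruhat_refl: "bruhat_le \<alpha> \<alpha>"
  by (auto simp: bruhat_le_def)

lemma bruhat_trans:
  "\<beta> \<in> kset n k \<Longrightarrow> \<alpha> \<in> kset n k \<Longrightarrow> bruhat_le \<gamma> \<beta> \<Longrightarrow> bruhat_le \<beta> \<alpha> \<Longrightarrow> bruhat_le \<gamma> \<alpha>"
  using bruhat_le_iff order_trans by meson

text \<open>The natural subtraction in \<open>wt\<close> never truncates, since
  \<open>seq \<alpha> ! j\<close> is at least \<open>j + 1\<close> for \<open>j\<close> counted from
  0.\<close>

lemma wt_sum:
  assumes "\<alpha> \<in> kset n k"
  shows "wt \<alpha> + (\<Sum>j<k. Suc j) = (\<Sum>j<k. seq \<alpha> ! j)"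
proof -
  have "wt \<alpha> + (\<Sum>j<k. Suc j) = (\<Sum>j<k. (seq \<alpha> ! j - (j + 1)) + Suc j)"
    by (simp only: wt_def ksetD(2)[OF assms] sum.distrib)
  also have "\<dots> = (\<Sum>j<k. seq \<alpha> ! j)"
  proof (intro sum.cong refl)
    fix j assume "j \<in> {..<k}"
    thus "seq \<alpha> ! j - (j + 1) + Suc j = seq \<alpha> ! j" using seq_ge[OF assms, of j] by simp
  qed
  finally show ?thesis .
qed

lemma bruhat_wt:
  assumes "\<beta> \<in> kset n k" "\<alpha> \<in> kset n k" "bruhat_le \<beta> \<alpha>"
  shows "wt \<beta> \<le> wt \<alpha>" "wt \<beta> = wt \<alpha> \<Longrightarrow> \<beta> = \<alpha>"
proof -
  have le: "seq \<beta> ! j \<le> seq \<alpha> ! j" if "j < k" for j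
    using assms bruhat_le_iff that by blast
  have "(\<Sum>j<k. seq \<beta> ! j) \<le> (\<Sum>j<k. seq \<alpha> ! j)" using le by (intro sum_mono) auto
  thus "wt \<beta> \<le> wt \<alpha>" using wt_sum[OF assms(1)] wt_sum[OF assms(2)] by simp
  assume "wt \<beta> = wt \<alpha>"
  hence eq: "(\<Sum>j<k. seq \<beta> ! j) = (\<Sum>j<k. seq \<alpha> ! j)"
    using wt_sum[OF assms(1)] wt_sum[OF assms(2)] by simp
  show "\<beta> = \<alpha>"
  proof (rule kset_eqI[OF assms(1,2)], rule ccontr)
    fix i assume i: "i < k" "seq \<beta> ! i \<noteq> seq \<alpha> ! i"
    have "seq \<beta> ! i < seq \<alpha> ! i" using le[OF i(1)] i(2) by simp
    hence "(\<Sum>j<k. seq \<beta> ! j) < (\<Sum>j<k. seq \<alpha> ! j)"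
      using le i(1) by (intro sum_strict_mono_ex1) auto
    thus False using eq by simp
  qed
qed

lemma wt_le: assumes "\<alpha> \<in> kset n k" shows "wt \<alpha> \<le> k * (n - k)"
proof -
  have "seq \<alpha> ! j - (j + 1) \<le> n - k" if "j < k" for j
    using seq_le[OF assms that] that by linarith
  hence "wt \<alpha> \<le> of_nat (card {..<k}) * (n - k)"
    unfolding wt_def ksetD(2)[OF assms] by (intro sum_bounded_above) auto
  thus ?thesis by simp
qed

section \<open>Covering relation, chain counts and free matrix entries\<close>

text \<open>The covering relation in coordinates. The index \<open>j\<close> stays explicit because
  row \<open>j\<close> will carry the additional coordinate of the chart.\<close>

definition covers_at :: "nat \<Rightarrow> nat \<Rightarrow> nat set \<Rightarrow> nat set \<Rightarrow> bool" where
  "covers_at k j \<beta> \<alpha> \<longleftrightarrow> j < k \<and> (\<forall>i<k. i \<noteq> j \<longrightarrow> seq \<beta> ! i = seq \<alpha> ! i) \<and> seq \<alpha> ! j = Suc (seq \<beta> ! j)"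

lemma covers_at_le: "\<alpha> \<in> kset n k \<Longrightarrow> covers_at k j \<beta> \<alpha> \<Longrightarrow> bruhat_le \<beta> \<alpha>"
  by (simp add: covers_at_def bruhat_le_iff) (metis le_Suc_eq order_refl)

text \<open>At the least index \<open>j\<close> where the sequences differ, entry \<open>j\<close>
  of \<alpha> can be lowered by one: the preceding entry of \<alpha> equals that of \<delta>, which
  is less than \<open>seq \<delta> ! j\<close> and so less than
  \<open>seq \<alpha> ! j - 1\<close>.\<close>

lemma exists_covers_at:
  assumes "\<delta> \<in> kset n k" "\<alpha> \<in> kset n k" "bruhat_le \<delta> \<alpha>" "\<delta> \<noteq> \<alpha>"
  obtains \<beta> j where "\<beta> \<in> kset n k" "bruhat_le \<delta> \<beta>" "covers_at k j \<beta> \<alpha>"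
proof -
  have le: "seq \<delta> ! j \<le> seq \<alpha> ! j" if "j < k" for j
    using assms bruhat_le_iff that by blast
  have "\<exists>j. j < k \<and> seq \<delta> ! j < seq \<alpha> ! j"
    using kset_eqI[OF assms(1,2)] assms(4) le by (metis le_neq_implies_less)
  then obtain j where j: "j < k" "seq \<delta> ! j < seq \<alpha> ! j"
    and least: "\<And>i. i < j \<Longrightarrow> \<not> (i < k \<and> seq \<delta> ! i < seq \<alpha> ! i)"
    using exists_least_iff[of "\<lambda>j. j < k \<and> seq \<delta> ! j < seq \<alpha> ! j"] by blast
  have eq: "seq \<delta> ! i = seq \<alpha> ! i" if "i < j" for i
    using least[OF that] le[of i] that j(1) by force
  define f where "f = (\<lambda>i. if i = j then seq \<alpha> ! j - 1 else seq \<alpha> ! i)"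
  have f1: "f i < f i'" if "i < i'" "i' < k" for i i'
  proof -
    have "seq \<alpha> ! i < seq \<alpha> ! i'" by (rule seq_strict[OF assms(2) that])
    moreover have "seq \<alpha> ! i < seq \<alpha> ! j - 1" if "i' = j"
      using eq[of i] \<open>i < i'\<close> that seq_strict[OF assms(1), of i j] j by simp
    ultimately show ?thesis using that(1) by (auto simp: f_def)
  qed
  have f2: "1 \<le> f i \<and> f i \<le> n" if "i < k" for i
    using seq_mem[OF assms(2) that] seq_mem[OF assms(1) j(1)] j by (auto simp: f_def)
  note s = seq_of_strict_mono[of k f n, OF f1 f2]
  show ?thesis
  proof (rule that[of "f ` {..<k}" j])
    show K: "f ` {..<k} \<in> kset n k" using s(1) by simp
    have s2: "seq (f ` {..<k}) ! i = f i" if "i < k" for i using s(2) that by simp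
    show "bruhat_le \<delta> (f ` {..<k})"
      unfolding bruhat_le_iff[OF K] using s2 le j by (auto simp: f_def)
    show "covers_at k j (f ` {..<k}) \<alpha>"
      unfolding covers_at_def using s2 j by (auto simp: f_def)
  qed
qed

text \<open>Forwards, \<open>exists_covers_at\<close> produces an element between \<beta> and
  \<alpha>, which minimality identifies with \<beta>. Backwards, an intermediate element agrees with
  both sequences off \<open>j\<close> and has only two consecutive values to choose from at
  \<open>j\<close>.\<close>

lemma bruhat_cover_iff:
  "bruhat_cover n k \<beta> \<alpha> \<longleftrightarrow> \<beta> \<in> kset n k \<and> \<alpha> \<in> kset n k \<and> (\<exists>j. covers_at k j \<beta> \<alpha>)"
proof
  assume c: "bruhat_cover n k \<beta> \<alpha>"
  hence K: "\<beta> \<in> kset n k" "\<alpha> \<in> kset n k" "bruhat_le \<beta> \<alpha>" "\<beta> \<noteq> \<alpha>"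
    by (auto simp: bruhat_cover_def)
  obtain \<gamma> j where \<gamma>: "\<gamma> \<in> kset n k" "bruhat_le \<beta> \<gamma>" "covers_at k j \<gamma> \<alpha>"
    using exists_covers_at[OF K] .
  have "bruhat_le \<gamma> \<alpha>" by (rule covers_at_le[OF K(2) \<gamma>(3)])
  moreover have "\<gamma> \<noteq> \<alpha>" using \<gamma>(3) by (auto simp: covers_at_def)
  ultimately have "\<gamma> = \<beta>" using c \<gamma>(1,2) by (auto simp: bruhat_cover_def)
  thus "\<beta> \<in> kset n k \<and> \<alpha> \<in> kset n k \<and> (\<exists>j. covers_at k j \<beta> \<alpha>)" using K \<gamma>(3) by blast
next
  assume "\<beta> \<in> kset n k \<and> \<alpha> \<in> kset n k \<and> (\<exists>j. covers_at k j \<beta> \<alpha>)"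
  then obtain j where K: "\<beta> \<in> kset n k" "\<alpha> \<in> kset n k" and j: "covers_at k j \<beta> \<alpha>" by blast
  have "\<gamma> = \<beta> \<or> \<gamma> = \<alpha>" if \<gamma>: "\<gamma> \<in> kset n k" "bruhat_le \<beta> \<gamma>" "bruhat_le \<gamma> \<alpha>" for \<gamma>
  proof -
    have le: "seq \<beta> ! i \<le> seq \<gamma> ! i \<and> seq \<gamma> ! i \<le> seq \<alpha> ! i" if "i < k" for i
      using \<gamma> K that by (auto simp: bruhat_le_iff)
    have "seq \<gamma> ! j = seq \<beta> ! j \<or> seq \<gamma> ! j = seq \<alpha> ! j"
      using le[of j] j by (auto simp: covers_at_def)
    thus ?thesis
    proof
      assume e: "seq \<gamma> ! j = seq \<beta> ! j"
      have "seq \<gamma> ! i = seq \<beta> ! i" if "i < k" for i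
        using le[OF that] e j that by (cases "i = j") (auto simp: covers_at_def)
      hence "\<gamma> = \<beta>" by (rule kset_eqI[OF \<gamma>(1) K(1)])
      thus ?thesis ..
    next
      assume e: "seq \<gamma> ! j = seq \<alpha> ! j"
      have "seq \<gamma> ! i = seq \<alpha> ! i" if "i < k" for i
        using le[OF that] e j that by (cases "i = j") (auto simp: covers_at_def)
      hence "\<gamma> = \<alpha>" by (rule kset_eqI[OF \<gamma>(1) K(2)])
      thus ?thesis ..
    qed
  qed
  moreover have "\<beta> \<noteq> \<alpha>" using j by (auto simp: covers_at_def)
  ultimately show "bruhat_cover n k \<beta> \<alpha>"
    using K covers_at_le[OF K(2) j] unfolding bruhat_cover_def by blast
qed

lemma exists_bruhat_cover:
  assumes "\<delta> \<in> kset n k" "\<alpha> \<in> kset n k" "bruhat_le \<delta> \<alpha>" "\<delta> \<noteq> \<alpha>"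
  obtains \<beta> where "bruhat_cover n k \<beta> \<alpha>" "bruhat_le \<delta> \<beta>"
  using exists_covers_at[OF assms] assms(2) bruhat_cover_iff by metis

lemma wt_cover:
  assumes "bruhat_cover n k \<beta> \<alpha>"
  shows "wt \<alpha> = Suc (wt \<beta>)"
proof -
  obtain j where K: "\<beta> \<in> kset n k" "\<alpha> \<in> kset n k" and j: "covers_at k j \<beta> \<alpha>"
    using assms bruhat_cover_iff by blast
  have jk: "j \<in> {..<k}" using j by (simp add: covers_at_def)
  have "(\<Sum>i<k. seq \<alpha> ! i) = seq \<alpha> ! j + (\<Sum>i\<in>{..<k} - {j}. seq \<alpha> ! i)"
    by (rule sum.remove) (use jk in auto)
  also have "(\<Sum>i\<in>{..<k} - {j}. seq \<alpha> ! i) = (\<Sum>i\<in>{..<k} - {j}. seq \<beta> ! i)"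
    using j by (intro sum.cong) (auto simp: covers_at_def)
  also have "seq \<alpha> ! j + \<dots> = Suc (seq \<beta> ! j + \<dots>)" using j by (simp add: covers_at_def)
  also have "seq \<beta> ! j + (\<Sum>i\<in>{..<k} - {j}. seq \<beta> ! i) = (\<Sum>i<k. seq \<beta> ! i)"
    by (rule sum.remove[symmetric]) (use jk in auto)
  finally show ?thesis using wt_sum[OF K(1)] wt_sum[OF K(2)] by simp
qed

lemma hat0_kset: "k \<le> n \<Longrightarrow> hat0 k \<in> kset n k"
  by (auto simp: hat0_def kset_def)

lemma seq_hat0: "i < k \<Longrightarrow> seq (hat0 k) ! i = Suc i"
proof -
  assume i: "i < k"
  have "hat0 k = Suc ` {..<k}" by (simp add: hat0_def lessThan_atLeast0 image_Suc_atLeastLessThan atLeastLessThanSuc_atLeastAtMost)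
  thus ?thesis using seq_of_strict_mono(2)[of k Suc k i] i by simp
qed

lemma hat0_le: "\<alpha> \<in> kset n k \<Longrightarrow> bruhat_le (hat0 k) \<alpha>"
  using seq_ge by (auto simp: bruhat_le_iff seq_hat0)

lemma wt_hat0: "wt (hat0 k) = 0"
  using seq_hat0 by (auto simp: wt_def hat0_def)

lemma wt_0_iff: "\<alpha> \<in> kset n k \<Longrightarrow> k \<le> n \<Longrightarrow> wt \<alpha> = 0 \<longleftrightarrow> \<alpha> = hat0 k"
  using bruhat_wt(2)[OF hat0_kset _ hat0_le] wt_hat0 by metis

lemma sat_chains_hat0:
  "sat_chains n k (hat0 k) = {[hat0 k]}"
proof (intro equalityI subsetI)
  fix cs assume cs: "cs \<in> sat_chains n k (hat0 k)"
  hence c: "cs \<noteq> []" "last cs = hat0 k" "hd cs = hat0 k"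
    "\<And>i. Suc i < length cs \<Longrightarrow> bruhat_cover n k (cs ! i) (cs ! Suc i)"
    by (auto simp: sat_chains_def)
  have "length cs = 1"
  proof (rule ccontr)
    assume "length cs \<noteq> 1"
    hence l: "length cs \<ge> 2" using c(1) by (cases cs) (auto simp: Suc_le_eq)
    hence "bruhat_cover n k (cs ! (length cs - 2)) (cs ! Suc (length cs - 2))" by (intro c(4)) simp
    from wt_cover[OF this] have "wt (last cs) \<noteq> 0" using l c(1)
      by (simp add: last_conv_nth Suc_diff_Suc numeral_2_eq_2)
    thus False using c(2) wt_hat0 by simp
  qed
  thus "cs \<in> {[hat0 k]}" using c(3) by (cases cs) auto
qed (auto simp: sat_chains_def)

lemma sat_chains_step:
  assumes "\<alpha> \<noteq> hat0 k"
  shows "sat_chains n k \<alpha> = (\<lambda>cs. cs @ [\<alpha>]) ` (\<Union>\<beta>\<in>{\<beta>. bruhat_cover n k \<beta> \<alpha>}. sat_chains n k \<beta>)"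
proof (intro equalityI subsetI)
  fix cs assume cs: "cs \<in> sat_chains n k \<alpha>"
  hence c: "cs \<noteq> []" "last cs = \<alpha>" "hd cs = hat0 k"
    "\<And>i. Suc i < length cs \<Longrightarrow> bruhat_cover n k (cs ! i) (cs ! Suc i)"
    by (auto simp: sat_chains_def)
  define ds where "ds = butlast cs"
  have cds: "cs = ds @ [\<alpha>]" using c(1,2) by (metis append_butlast_last_id ds_def)
  have ds: "ds \<noteq> []" using c(3) assms cds by (cases ds) auto
  have "bruhat_cover n k (last ds) \<alpha>"
    using c(4)[of "length ds - 1"] ds by (simp add: cds nth_append last_conv_nth)
  moreover have "ds \<in> sat_chains n k (last ds)"
  proof -
    have "bruhat_cover n k (ds ! i) (ds ! Suc i)" if "Suc i < length ds" for i
      using c(4)[of i] that by (simp add: cds nth_append)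
    thus ?thesis using ds c(3) by (simp add: sat_chains_def cds)
  qed
  ultimately show "cs \<in> (\<lambda>cs. cs @ [\<alpha>]) ` (\<Union>\<beta>\<in>{\<beta>. bruhat_cover n k \<beta> \<alpha>}. sat_chains n k \<beta>)"
    using cds by blast
next
  fix cs assume "cs \<in> (\<lambda>cs. cs @ [\<alpha>]) ` (\<Union>\<beta>\<in>{\<beta>. bruhat_cover n k \<beta> \<alpha>}. sat_chains n k \<beta>)"
  then obtain ds \<beta> where ds: "cs = ds @ [\<alpha>]" "bruhat_cover n k \<beta> \<alpha>" "ds \<in> sat_chains n k \<beta>" by blast
  hence d: "ds \<noteq> []" "hd ds = hat0 k" "last ds = \<beta>"
    "\<And>i. Suc i < length ds \<Longrightarrow> bruhat_cover n k (ds ! i) (ds ! Suc i)"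
    by (auto simp: sat_chains_def)
  have "bruhat_cover n k (cs ! i) (cs ! Suc i)" if "Suc i < length cs" for i
  proof (cases "Suc i < length ds")
    case True
    thus ?thesis using d(4) ds(1) by (simp add: nth_append)
  next
    case False
    hence "i = length ds - 1" "i < length ds" using that ds(1) d(1) by auto
    thus ?thesis using ds(1,2) d(1,3) by (auto simp: nth_append last_conv_nth)
  qed
  thus "cs \<in> sat_chains n k \<alpha>" using ds(1) d by (auto simp: sat_chains_def)
qed

lemma finite_covers: "finite {\<beta>. bruhat_cover n k \<beta> \<alpha>}"
  by (rule finite_subset[OF _ finite_kset[of n k]]) (auto simp: bruhat_cover_def)

lemma finite_sat_chains: "finite (sat_chains n k \<alpha>)"
proof (induction "wt \<alpha>" arbitrary: \<alpha> rule: less_induct)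
  case less
  show ?case
  proof (cases "\<alpha> = hat0 k")
    case False
    have "finite (sat_chains n k \<beta>)" if "\<beta> \<in> {\<beta>. bruhat_cover n k \<beta> \<alpha>}" for \<beta>
      by (rule less) (use that wt_cover in simp)
    thus ?thesis unfolding sat_chains_step[OF False]
      by (intro finite_imageI finite_UN_I finite_covers)
  qed (simp add: sat_chains_hat0)
qed

lemma dnum_hat0: "dnum n k (hat0 k) = 1"
  by (simp add: dnum_def sat_chains_hat0)

text \<open>Deleting the last element of a chain gives the recursion. The limit points are counted
  by the same sum over covered \<beta>, so this and the value at \<open>hat0\<close> are all that is
  needed about \<open>dnum\<close>.\<close>

lemma dnum_step:
  assumes "\<alpha> \<noteq> hat0 k"
  shows "dnum n k \<alpha> = (\<Sum>\<beta>\<in>{\<beta>. bruhat_cover n k \<beta> \<alpha>}. dnum n k \<beta>)"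
proof -
  have disj: "sat_chains n k \<beta> \<inter> sat_chains n k \<gamma> = {}" if "\<beta> \<noteq> \<gamma>" for \<beta> \<gamma>
    using that unfolding sat_chains_def by blast
  have "dnum n k \<alpha> = card (\<Union>\<beta>\<in>{\<beta>. bruhat_cover n k \<beta> \<alpha>}. sat_chains n k \<beta>)"
    unfolding dnum_def sat_chains_step[OF assms] by (rule card_image) (auto simp: inj_on_def)
  also have "\<dots> = (\<Sum>\<beta>\<in>{\<beta>. bruhat_cover n k \<beta> \<alpha>}. card (sat_chains n k \<beta>))"
    by (rule card_UN_disjoint[OF finite_covers]) (use disj finite_sat_chains in blast)+
  finally show ?thesis by (simp add: dnum_def)
qed

text \<open>The free matrix entries in the chart \<^term>\<open>\<beta>\<close> of the Schubert variety of \<^term>\<open>\<alpha>\<close>,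
  for \<^term>\<open>\<beta> = \<alpha>\<close> or \<^term>\<open>\<beta>\<close> covered by \<^term>\<open>\<alpha>\<close>.\<close>
definition free_pos :: "nat \<Rightarrow> nat \<Rightarrow> nat set \<Rightarrow> nat set \<Rightarrow> (nat \<times> nat) set" where
  "free_pos n k \<beta> \<alpha> = {(i, c). i < k \<and> c < n \<and> Suc c \<notin> \<beta> \<and> Suc c \<le> seq \<alpha> ! i}"

lemma finite_free_pos: "finite (free_pos n k \<beta> \<alpha>)"
  by (rule finite_subset[of _ "{..<k} \<times> {..<n}"]) (auto simp: free_pos_def)

text \<open>The dimension of a Schubert cell: of the columns up to the pivot of row
  \<open>i\<close>, exactly \<open>i + 1\<close> are pivot columns, because they hold the elements
  of \<beta> up to \<open>seq \<beta> ! i\<close>.\<close>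

lemma card_free_pos_self:
  assumes \<beta>: "\<beta> \<in> kset n k"
  shows "card (free_pos n k \<beta> \<beta>) = wt \<beta>"
proof -
  let ?C = "\<lambda>i. {c. Suc c \<notin> \<beta> \<and> Suc c \<le> seq \<beta> ! i}"
  have fC: "finite (?C i)" for i by (rule finite_subset[of _ "{..seq \<beta> ! i}"]) auto
  have "free_pos n k \<beta> \<beta> = Sigma {..<k} ?C"
    using seq_mem[OF \<beta>] by (fastforce simp: free_pos_def)
  hence "card (free_pos n k \<beta> \<beta>) = (\<Sum>i<k. card (?C i))" using fC by simp
  also have "\<dots> = (\<Sum>i<k. seq \<beta> ! i - (i + 1))"
  proof (intro sum.cong refl)
    fix i assume "i \<in> {..<k}"
    hence i: "i < k" by simp
    let ?P = "(\<lambda>j. seq \<beta> ! j) ` {..i}"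
    have "Suc ` ?C i = {1..seq \<beta> ! i} - ?P"
    proof (intro equalityI subsetI)
      fix x assume "x \<in> Suc ` ?C i"
      then obtain c where c: "x = Suc c" "Suc c \<notin> \<beta>" "Suc c \<le> seq \<beta> ! i" by auto
      have "x \<notin> ?P"
      proof
        assume "x \<in> ?P"
        then obtain j where "j \<le> i" "x = seq \<beta> ! j" by auto
        thus False using seq_mem(1)[OF \<beta>, of j] i c by simp
      qed
      thus "x \<in> {1..seq \<beta> ! i} - ?P" using c by auto
    next
      fix x assume x: "x \<in> {1..seq \<beta> ! i} - ?P"
      have "x \<notin> \<beta>"
      proof
        assume "x \<in> \<beta>"
        then obtain j where j: "j < k" "x = seq \<beta> ! j" using seq_obtain[OF \<beta>] by blast
        hence "i < j" using x by (metis DiffD2 atMost_iff imageI not_less)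
        thus False using seq_strict[OF \<beta> _ j(1)] j(2) x by fastforce
      qed
      thus "x \<in> Suc ` ?C i" using x by (cases x) auto
    qed
    hence "card (?C i) = card ({1..seq \<beta> ! i} - ?P)" using card_image[of Suc "?C i"] by simp
    also have "\<dots> = card {1..seq \<beta> ! i} - card ?P"
    proof (rule card_Diff_subset)
      show "?P \<subseteq> {1..seq \<beta> ! i}"
      proof
        fix x assume "x \<in> ?P"
        then obtain j where j: "j \<le> i" "x = seq \<beta> ! j" by auto
        thus "x \<in> {1..seq \<beta> ! i}" using seq_strict[OF \<beta>, of j i] i seq_mem(2)[OF \<beta>, of j]
          by (cases "j = i") auto
      qed
    qed auto
    also have "card ?P = Suc i"
      by (subst card_image) (use i in \<open>auto intro: inj_on_subset[OF seq_inj_on[OF \<beta>]]\<close>)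
    finally show "card (?C i) = seq \<beta> ! i - (i + 1)" by simp
  qed
  finally show ?thesis using ksetD(2)[OF \<beta>] by (simp add: wt_def)
qed

lemma covers_at_notin:
  assumes "\<beta> \<in> kset n k" "\<alpha> \<in> kset n k" "covers_at k j \<beta> \<alpha>"
  shows "seq \<alpha> ! j \<notin> \<beta>"
proof
  assume "seq \<alpha> ! j \<in> \<beta>"
  then obtain i where i: "i < k" "seq \<alpha> ! j = seq \<beta> ! i" using seq_obtain[OF assms(1)] by blast
  have "i \<noteq> j" using i(2) assms(3) by (auto simp: covers_at_def)
  hence "seq \<beta> ! i = seq \<alpha> ! i" using i(1) assms(3) unfolding covers_at_def by blast
  hence "seq \<alpha> ! i = seq \<alpha> ! j" using i(2) by simp
  hence "i = j" using seq_inj[OF assms(2) i(1)] assms(3) by (auto simp: covers_at_def)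
  thus False using \<open>i \<noteq> j\<close> by simp
qed

text \<open>As columns are counted from 0, column \<open>seq \<beta> ! j\<close> belongs to the
  basis vector with index \<open>seq \<alpha> ! j\<close>. The vanishing of this one new entry cuts
  \<Omega>_\<beta> out of \<Omega>_\<alpha> in the chart.\<close>

lemma free_pos_cover:
  assumes "\<beta> \<in> kset n k" "\<alpha> \<in> kset n k" "covers_at k j \<beta> \<alpha>"
  shows "free_pos n k \<beta> \<alpha> = insert (j, seq \<beta> ! j) (free_pos n k \<beta> \<beta>)"
    "(j, seq \<beta> ! j) \<notin> free_pos n k \<beta> \<beta>"
proof -
  have j: "j < k" "\<And>i. i < k \<Longrightarrow> i \<noteq> j \<Longrightarrow> seq \<beta> ! i = seq \<alpha> ! i" "seq \<alpha> ! j = Suc (seq \<beta> ! j)"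
    using assms(3) by (auto simp: covers_at_def)
  have "seq \<beta> ! j < n" using seq_mem(3)[OF assms(2) j(1)] j(3) by simp
  have "x \<in> free_pos n k \<beta> \<alpha> \<longleftrightarrow> x \<in> insert (j, seq \<beta> ! j) (free_pos n k \<beta> \<beta>)" for x
  proof (cases "fst x = j")
    case True
    thus ?thesis using j(1,3) covers_at_notin[OF assms] \<open>seq \<beta> ! j < n\<close>
      by (cases x) (auto simp: free_pos_def le_Suc_eq)
  next
    case False
    thus ?thesis using j(2)[of "fst x"] by (cases x) (auto simp: free_pos_def)
  qed
  thus "free_pos n k \<beta> \<alpha> = insert (j, seq \<beta> ! j) (free_pos n k \<beta> \<beta>)" by blast
  show "(j, seq \<beta> ! j) \<notin> free_pos n k \<beta> \<beta>" by (auto simp: free_pos_def)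
qed

text \<open>Number of unknowns in the chart; it matches the \<open>wt \<beta>\<close> earlier
  conditions together with the new one.\<close>

lemma card_free_pos_cover:
  assumes "\<beta> \<in> kset n k" "\<alpha> \<in> kset n k" "covers_at k j \<beta> \<alpha>"
  shows "card (free_pos n k \<beta> \<alpha>) = Suc (wt \<beta>)"
  using free_pos_cover[OF assms] card_free_pos_self[OF assms(1)] finite_free_pos by simp

subsection \<open>Minors, charts and the torus action\<close>

lemma cols_of_carrier: "X \<in> carrier_mat r n \<Longrightarrow> \<gamma> \<in> kset n m \<Longrightarrow> cols_of X \<gamma> \<in> carrier_mat r m"
  using ksetD(2) by (auto simp: cols_of_def)

lemma cols_of_index:
  "X \<in> carrier_mat r n \<Longrightarrow> \<gamma> \<in> kset n m \<Longrightarrow> i < r \<Longrightarrow> j < m \<Longrightarrow>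
    cols_of X \<gamma> $$ (i, j) = X $$ (i, seq \<gamma> ! j - 1)"
  using ksetD(2) by (auto simp: cols_of_def)

lemma cols_of_mult:
  assumes G: "G \<in> carrier_mat r r" and X: "X \<in> carrier_mat r n" and \<gamma>: "\<gamma> \<in> kset n m"
  shows "cols_of (G * X) \<gamma> = G * cols_of X \<gamma>"
proof (rule eq_matI)
  have c: "cols_of X \<gamma> \<in> carrier_mat r m" by (rule cols_of_carrier[OF X \<gamma>])
  have GX: "G * X \<in> carrier_mat r n" using G X by simp
  fix i j assume "i < dim_row (G * cols_of X \<gamma>)" "j < dim_col (G * cols_of X \<gamma>)"
  hence i: "i < r" and j: "j < m" using G c by auto
  have s: "seq \<gamma> ! j - 1 < n" using seq_mem[OF \<gamma> j] by simp
  have "col X (seq \<gamma> ! j - 1) = col (cols_of X \<gamma>) j"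
    using X c s j by (intro eq_vecI) (auto simp: cols_of_index[OF X \<gamma>])
  thus "cols_of (G * X) \<gamma> $$ (i, j) = (G * cols_of X \<gamma>) $$ (i, j)"
    using i j s G X c by (simp add: cols_of_index[OF GX \<gamma>])
qed (use cols_of_carrier[OF X \<gamma>] cols_of_carrier[of "G * X" r n \<gamma> m] G X \<gamma> in auto)

lemma plucker_mult:
  assumes "G \<in> carrier_mat k k" "X \<in> carrier_mat k n" "\<gamma> \<in> kset n k"
  shows "plucker (G * X) \<gamma> = det G * plucker X \<gamma>"
  unfolding plucker_def cols_of_mult[OF assms]
  by (rule det_mult[OF assms(1) cols_of_carrier[OF assms(2,3)]])

lemma append_rows_index:
  assumes "X \<in> carrier_mat k n" "M \<in> carrier_mat m n" "i < k + m" "c < n"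
  shows "(X @\<^sub>r M) $$ (i, c) = (if i < k then X $$ (i, c) else M $$ (i - k, c))"
  using assms by (auto simp: append_rows_def)

lemma append_rows_square:
  assumes "k \<le> n" "X \<in> carrier_mat k n" "M \<in> carrier_mat (n - k) n"
  shows "X @\<^sub>r M \<in> carrier_mat n n"
  using carrier_append_rows[OF assms(2,3)] assms(1) by simp

text \<open>Row operations on the upper block are multiplication by the block diagonal matrix with
  blocks \<open>G\<close> and 1.\<close>

lemma det_append_mult:
  fixes X :: "complex mat"
  assumes k: "k \<le> n" and G: "G \<in> carrier_mat k k" and X: "X \<in> carrier_mat k n"
    and M: "M \<in> carrier_mat (n - k) n"
  shows "det ((G * X) @\<^sub>r M) = det G * det (X @\<^sub>r M)"
proof -
  let ?D = "four_block_mat G (0\<^sub>m k (n - k)) (0\<^sub>m (n - k) k) (1\<^sub>m (n - k))"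
  have D: "?D \<in> carrier_mat n n"
    using four_block_carrier_mat[OF G, of "1\<^sub>m (n - k)" "n - k" "n - k"] k by simp
  have XM: "X @\<^sub>r M = four_block_mat X (0\<^sub>m k 0) M (0\<^sub>m (n - k) 0)"
    using X M by (simp add: append_rows_def)
  have "?D * (X @\<^sub>r M) = four_block_mat (G * X + 0\<^sub>m k (n - k) * M) (G * 0\<^sub>m k 0 + 0\<^sub>m k (n - k) * 0\<^sub>m (n - k) 0)
      (0\<^sub>m (n - k) k * X + 1\<^sub>m (n - k) * M) (0\<^sub>m (n - k) k * 0\<^sub>m k 0 + 1\<^sub>m (n - k) * 0\<^sub>m (n - k) 0)"
    unfolding XM by (rule mult_four_block_mat[OF G _ _ _ X _ M]) auto
  also have "\<dots> = (G * X) @\<^sub>r M"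
    unfolding append_rows_def using G X M by (intro cong_four_block_mat) auto
  finally have "(G * X) @\<^sub>r M = ?D * (X @\<^sub>r M)" by simp
  hence "det ((G * X) @\<^sub>r M) = det ?D * det (X @\<^sub>r M)"
    using det_mult[OF D append_rows_square[OF k X M]] by simp
  also have "det ?D = det G * det (1\<^sub>m (n - k) :: complex mat)"
    by (rule det_four_block_mat_upper_right_zero[OF G refl]) auto
  finally show ?thesis by simp
qed

section \<open>Row spaces and normalised representatives\<close>

lemma rowspace_mult_subset:
  assumes "G \<in> carrier_mat k k" "X \<in> carrier_mat k n"
  shows "rowspace (G * X) \<subseteq> rowspace X"
proof
  fix v assume "v \<in> rowspace (G * X)"
  then obtain c where c: "c \<in> carrier_vec k" "v = transpose_mat (G * X) *\<^sub>v c"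
    using assms by (auto simp: rowspace_def)
  have "v = transpose_mat X *\<^sub>v (transpose_mat G *\<^sub>v c)"
    unfolding c(2) transpose_mult[OF assms]
    by (rule assoc_mult_mat_vec[of _ n k _ k]) (use assms c in auto)
  moreover have "transpose_mat G *\<^sub>v c \<in> carrier_vec k" using assms c by simp
  ultimately show "v \<in> rowspace X" using assms by (auto simp: rowspace_def)
qed

lemma rowspace_mult:
  fixes X :: "'a::field mat"
  assumes G: "G \<in> carrier_mat k k" "det G \<noteq> 0" and X: "X \<in> carrier_mat k n"
  shows "rowspace (G * X) = rowspace X"
proof
  obtain A where A: "A \<in> carrier_mat k k" "A * G = 1\<^sub>m k" using det_nonzero_inverse[OF G] by metis
  have "A * (G * X) = X" using A G X by (simp add: assoc_mult_mat[symmetric, of _ k k _ k _ n])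
  thus "rowspace X \<subseteq> rowspace (G * X)"
    using rowspace_mult_subset[OF A(1), of "G * X" n] G X by simp
qed (rule rowspace_mult_subset[OF G(1) X])

lemma rowspace_eq_factor:
  assumes X: "X \<in> carrier_mat k n" and Y: "Y \<in> carrier_mat k n" and eq: "rowspace X = rowspace Y"
  obtains C where "C \<in> carrier_mat k k" "Y = C * X"
proof -
  have "\<exists>c. c \<in> carrier_vec k \<and> row Y i = transpose_mat X *\<^sub>v c" if "i < k" for i
  proof -
    have "row Y i = transpose_mat Y *\<^sub>v unit_vec k i"
      using Y that by (intro eq_vecI) (auto simp: scalar_prod_right_unit)
    hence "row Y i \<in> rowspace Y" using Y by (auto simp: rowspace_def)
    thus ?thesis using eq X by (auto simp: rowspace_def)
  qed
  then obtain c where c: "\<And>i. i < k \<Longrightarrow> c i \<in> carrier_vec k"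
    "\<And>i. i < k \<Longrightarrow> row Y i = transpose_mat X *\<^sub>v c i" by metis
  define C where "C = mat k k (\<lambda>(i, j). c i $ j)"
  show ?thesis
  proof (rule that[of C])
    show C: "C \<in> carrier_mat k k" by (simp add: C_def)
    show "Y = C * X"
    proof (rule eq_matI)
      fix i j assume "i < dim_row (C * X)" "j < dim_col (C * X)"
      hence i: "i < k" and j: "j < n" using C X by auto
      have "Y $$ (i, j) = row Y i $ j" using i j Y by simp
      also have "\<dots> = col X j \<bullet> c i" using c(2)[OF i] X j by simp
      also have "\<dots> = c i \<bullet> col X j" using c(1)[OF i] X j by (intro comm_scalar_prod[of _ k]) auto
      also have "c i = row C i" using c(1)[OF i] i by (intro eq_vecI) (auto simp: C_def)
      finally show "Y $$ (i, j) = (C * X) $$ (i, j)" using i j C X by simp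
    qed (use C X Y in auto)
  qed
qed

lemma full_rankD:
  assumes "full_rank n k X"
  shows "X \<in> carrier_mat k n" "\<exists>\<gamma>\<in>kset n k. plucker X \<gamma> \<noteq> 0"
  using assms by (auto simp: full_rank_def)

lemma full_rankI: "X \<in> carrier_mat k n \<Longrightarrow> \<gamma> \<in> kset n k \<Longrightarrow> plucker X \<gamma> \<noteq> 0 \<Longrightarrow> full_rank n k X"
  by (auto simp: full_rank_def)

lemma plucker_chart: "cols_of X \<gamma> = 1\<^sub>m k \<Longrightarrow> plucker X \<gamma> = 1"
  by (simp add: plucker_def)

lemma full_rank_mult:
  assumes "full_rank n k X" "G \<in> carrier_mat k k" "det G \<noteq> 0"
  shows "full_rank n k (G * X)"
proof -
  obtain \<gamma> where \<gamma>: "\<gamma> \<in> kset n k" "plucker X \<gamma> \<noteq> 0" using full_rankD(2)[OF assms(1)] by blast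
  show ?thesis
    using full_rankD(1)[OF assms(1)] assms(2,3) \<gamma>
    by (intro full_rankI[OF _ \<gamma>(1)]) (auto simp: plucker_mult)
qed

lemma in_Omega_mult:
  assumes "X \<in> carrier_mat k n" "G \<in> carrier_mat k k" "in_Omega_alpha n k \<alpha> X"
  shows "in_Omega_alpha n k \<alpha> (G * X)"
  using assms by (auto simp: in_Omega_alpha_def plucker_mult)

lemma meets_mult:
  assumes "k \<le> n" "X \<in> carrier_mat k n" "G \<in> carrier_mat k k" "M \<in> carrier_mat (n - k) n" "meets X M"
  shows "meets (G * X) M"
  using assms by (auto simp: meets_def det_append_mult)

lemma rowspace_eq_invertible:
  assumes X: "full_rank n k X" and Y: "full_rank n k Y" and eq: "rowspace X = rowspace Y"
  obtains G where "G \<in> carrier_mat k k" "det G \<noteq> 0" "Y = G * X"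
proof -
  have c: "X \<in> carrier_mat k n" "Y \<in> carrier_mat k n" using X Y full_rankD(1) by auto
  obtain C where C: "C \<in> carrier_mat k k" "Y = C * X" using rowspace_eq_factor[OF c eq] .
  obtain \<gamma> where \<gamma>: "\<gamma> \<in> kset n k" "plucker Y \<gamma> \<noteq> 0" using full_rankD(2)[OF Y] by blast
  have "det C \<noteq> 0" using \<gamma>(2) C(2) plucker_mult[OF C(1) c(1) \<gamma>(1)] by auto
  thus ?thesis using that C by blast
qed

text \<open>The matrix relating two representatives is visible in the columns \<gamma>, where it
  must be the identity.\<close>

lemma chart_unique:
  assumes X: "X \<in> carrier_mat k n" "cols_of X \<gamma> = 1\<^sub>m k" and Y: "Y \<in> carrier_mat k n" "cols_of Y \<gamma> = 1\<^sub>m k"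
    and \<gamma>: "\<gamma> \<in> kset n k" and eq: "rowspace X = rowspace Y"
  shows "X = Y"
proof -
  obtain C where C: "C \<in> carrier_mat k k" "Y = C * X" using rowspace_eq_factor[OF X(1) Y(1) eq] .
  have "1\<^sub>m k = C * 1\<^sub>m k" using cols_of_mult[OF C(1) X(1) \<gamma>] X(2) Y(2) C(2) by simp
  hence "C = 1\<^sub>m k" using C(1) by simp
  thus ?thesis using C X(1) by simp
qed

text \<open>Cramer's formula for the inverse of \<open>cols_of X \<gamma>\<close> times
  \<open>X\<close>. Written as a quotient of determinants, it is visibly continuous wherever the
  minor \<gamma> is nonzero, which the passage to limits exploits.\<close>

definition chart_rep :: "nat \<Rightarrow> nat \<Rightarrow> nat set \<Rightarrow> complex mat \<Rightarrow> complex mat" where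
  "chart_rep n k \<gamma> X = mat k n (\<lambda>(i, c). det (replace_col (cols_of X \<gamma>) (col X c) i) / plucker X \<gamma>)"

lemma chart_rep:
  assumes X: "X \<in> carrier_mat k n" and \<gamma>: "\<gamma> \<in> kset n k" and p: "plucker X \<gamma> \<noteq> 0"
  obtains G where "G \<in> carrier_mat k k" "det G \<noteq> 0" "chart_rep n k \<gamma> X = G * X"
    "cols_of (G * X) \<gamma> = 1\<^sub>m k"
proof -
  let ?A = "cols_of X \<gamma>"
  have A: "?A \<in> carrier_mat k k" by (rule cols_of_carrier[OF X \<gamma>])
  have "det ?A \<noteq> 0" using p by (simp add: plucker_def)
  then obtain G where G: "G \<in> carrier_mat k k" "G * ?A = 1\<^sub>m k" "?A * G = 1\<^sub>m k"
    using det_nonzero_inverse[OF A] by blast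
  have "det G * det ?A = 1" using det_mult[OF G(1) A] G(2) by simp
  hence dG: "det G \<noteq> 0" by auto
  have "chart_rep n k \<gamma> X = G * X"
  proof (rule eq_matI)
    fix i c assume "i < dim_row (G * X)" "c < dim_col (G * X)"
    hence i: "i < k" and c: "c < n" using G X by auto
    have cv: "col X c \<in> carrier_vec k" using X c by auto
    have "?A *\<^sub>v (G *\<^sub>v col X c) = col X c"
      using A G cv by (simp add: assoc_mult_mat_vec[symmetric, of _ k k _ k])
    hence "det (replace_col ?A (col X c) i) = (G *\<^sub>v col X c) $ i * det ?A"
      using cramer_lemma_mat[OF A _ i, of "G *\<^sub>v col X c"] G cv by simp
    thus "chart_rep n k \<gamma> X $$ (i, c) = (G * X) $$ (i, c)"
      using i c p G X by (simp add: chart_rep_def plucker_def)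
  qed (use G X in \<open>auto simp: chart_rep_def\<close>)
  thus ?thesis using that[OF G(1) dG] cols_of_mult[OF G(1) X \<gamma>] G(2) by simp
qed

section \<open>Exchanging one column, and the support of matrices in Schubert varieties\<close>

text \<open>Sorting the chosen columns costs the sign of a permutation. That sign depends on
  \<sigma> only and not on \<open>X\<close>; its modulus is all that is used later.\<close>

lemma det_column_selection:
  assumes \<sigma>: "inj_on \<sigma> {..<k}" "\<sigma> ` {..<k} \<subseteq> {1..n}"
  obtains \<epsilon> :: complex where "cmod \<epsilon> = 1"
    "\<And>X. X \<in> carrier_mat k n \<Longrightarrow>
      plucker X (\<sigma> ` {..<k}) = \<epsilon> * det (mat k k (\<lambda>(r, j). X $$ (r, \<sigma> j - 1)))"
proof -
  define \<gamma> where "\<gamma> = \<sigma> ` {..<k}"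
  have \<gamma>: "\<gamma> \<in> kset n k" using \<sigma> by (auto simp: kset_def \<gamma>_def card_image)
  define s where "s = (\<lambda>i. seq \<gamma> ! i)"
  have s: "bij_betw s {..<k} \<gamma>"
    using seq_inj_on[OF \<gamma>] seq_image[OF \<gamma>] by (auto simp: bij_betw_def s_def)
  have \<sigma>b: "bij_betw \<sigma> {..<k} \<gamma>" using \<sigma>(1) by (simp add: bij_betw_def \<gamma>_def)
  define q where "q = (\<lambda>j. if j < k then inv_into {..<k} \<sigma> (s j) else j)"
  have "bij_betw q {..<k} {..<k} \<longleftrightarrow> bij_betw (inv_into {..<k} \<sigma> \<circ> s) {..<k} {..<k}"
    by (rule bij_betw_cong) (simp add: q_def)
  hence "bij_betw q {0..<k} {0..<k}"
    using bij_betw_trans[OF s bij_betw_inv_into[OF \<sigma>b]] by (simp add: lessThan_atLeast0)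
  hence q: "q permutes {0..<k}" by (rule bij_imp_permutes) (auto simp: q_def)
  have \<sigma>q: "\<sigma> (q j) = s j" if "j < k" for j
    using bij_betw_inv_into_right[OF \<sigma>b] bij_betwE[OF s] that by (auto simp: q_def)
  show ?thesis
  proof (rule that[of "signof q"])
    show "cmod (signof q) = 1" by (auto simp: sign_def)
    fix X :: "complex mat" assume X: "X \<in> carrier_mat k n"
    define A where "A = mat k k (\<lambda>(r, j). X $$ (r, \<sigma> j - 1))"
    have A: "A \<in> carrier_mat k k" by (simp add: A_def)
    have ql: "q j < k" if "j < k" for j using permutes_in_image[OF q, of j] that by simp
    have "plucker X \<gamma> = det (transpose_mat (cols_of X \<gamma>))"
      unfolding plucker_def by (rule det_transpose[OF cols_of_carrier[OF X \<gamma>], symmetric])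
    also have "transpose_mat (cols_of X \<gamma>) = mat k k (\<lambda>(i, j). transpose_mat A $$ (q i, j))"
      using cols_of_carrier[OF X \<gamma>] A ql
      by (intro eq_matI) (auto simp: cols_of_index[OF X \<gamma>] A_def \<sigma>q s_def)
    also have "det \<dots> = signof q * det (transpose_mat A)"
      by (rule det_permute_rows[OF _ q]) (use A in auto)
    also have "det (transpose_mat A) = det A" by (rule det_transpose[OF A])
    finally show "plucker X (\<sigma> ` {..<k}) = signof q * det (mat k k (\<lambda>(r, j). X $$ (r, \<sigma> j - 1)))"
      by (simp add: \<gamma>_def A_def)
  qed
qed

text \<open>The pivot of row \<open>i\<close> is traded for column \<open>c\<close>. Columns count
  from 0 and elements of \<gamma> from 1, hence \<open>Suc c\<close>.\<close>

definition swap :: "nat set \<Rightarrow> nat \<Rightarrow> nat \<Rightarrow> nat set" where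
  "swap \<gamma> i c = insert (Suc c) (\<gamma> - {seq \<gamma> ! i})"

lemma swap_kset:
  assumes "\<gamma> \<in> kset n k" "i < k" "c < n" "Suc c \<notin> \<gamma>"
  shows "swap \<gamma> i c \<in> kset n k"
  using ksetD[OF assms(1)] seq_mem[OF assms(1,2)] assms(2-4)
  by (auto simp: swap_def kset_def card_insert_if card_Diff_singleton)

lemma wt_set_sum:
  assumes "A \<in> kset n k" shows "wt A + (\<Sum>j<k. Suc j) = \<Sum>A"
proof -
  have "\<Sum>A = (\<Sum>j<k. seq A ! j)"
    by (subst seq_image[OF assms]) (simp add: sum.reindex[OF seq_inj_on[OF assms]])
  thus ?thesis using wt_sum[OF assms] by simp
qed

lemma wt_swap:
  assumes "\<gamma> \<in> kset n k" "i < k" "c < n" "Suc c \<notin> \<gamma>"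
  shows "wt (swap \<gamma> i c) + seq \<gamma> ! i = wt \<gamma> + Suc c"
proof -
  have "\<Sum>(swap \<gamma> i c) = Suc c + \<Sum>(\<gamma> - {seq \<gamma> ! i})"
    unfolding swap_def by (rule sum.insert) (use ksetD(1)[OF assms(1)] assms(4) in auto)
  moreover have "\<Sum>\<gamma> = seq \<gamma> ! i + \<Sum>(\<gamma> - {seq \<gamma> ! i})"
    by (rule sum.remove) (use ksetD(1)[OF assms(1)] seq_mem(1)[OF assms(1,2)] in auto)
  ultimately show ?thesis using wt_set_sum[OF assms(1)] wt_set_sum[OF swap_kset[OF assms]] by simp
qed

text \<open>In the chart \<gamma> the selected columns form the identity with column
  \<open>i\<close> replaced by column \<open>c\<close> of \<open>X\<close>, so each matrix entry is
  a Pluecker coordinate up to sign. The sign is independent of \<open>X\<close>, so the identity may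
  be differentiated along lines in the chart.\<close>

lemma plucker_swap:
  assumes "\<gamma> \<in> kset n k" "i < k" "c < n" "Suc c \<notin> \<gamma>"
  obtains \<epsilon> :: complex where "cmod \<epsilon> = 1"
    "\<And>X. X \<in> carrier_mat k n \<Longrightarrow> cols_of X \<gamma> = 1\<^sub>m k \<Longrightarrow> plucker X (swap \<gamma> i c) = \<epsilon> * X $$ (i, c)"
proof -
  define \<sigma> where "\<sigma> = (\<lambda>j. if j = i then Suc c else seq \<gamma> ! j)"
  have im: "\<sigma> ` {..<k} = swap \<gamma> i c"
  proof -
    have "\<gamma> - {seq \<gamma> ! i} = (\<lambda>j. seq \<gamma> ! j) ` ({..<k} - {i})"
      using inj_on_image_set_diff[OF seq_inj_on[OF assms(1)], of "{..<k}" "{i}"] seq_image[OF assms(1)] assms(2)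
      by simp
    moreover have "{..<k} = insert i ({..<k} - {i})" using assms(2) by auto
    ultimately show ?thesis unfolding swap_def \<sigma>_def by (auto simp: image_def)
  qed
  have inj: "inj_on \<sigma> {..<k}"
    by (rule eq_card_imp_inj_on) (use im ksetD(2)[OF swap_kset[OF assms]] in auto)
  have sub: "\<sigma> ` {..<k} \<subseteq> {1..n}" using im ksetD(3)[OF swap_kset[OF assms]] by simp
  obtain \<epsilon> :: complex where \<epsilon>: "cmod \<epsilon> = 1"
    "\<And>X. X \<in> carrier_mat k n \<Longrightarrow>
      plucker X (\<sigma> ` {..<k}) = \<epsilon> * det (mat k k (\<lambda>(r, j). X $$ (r, \<sigma> j - 1)))"
    using det_column_selection[OF inj sub] by blast
  show ?thesis
  proof (rule that[OF \<epsilon>(1)])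
    fix X :: "complex mat" assume X: "X \<in> carrier_mat k n" and n: "cols_of X \<gamma> = 1\<^sub>m k"
    have cv: "col X c \<in> carrier_vec k" using X assms(3) by auto
    have X1: "X $$ (r, seq \<gamma> ! j - 1) = 1\<^sub>m k $$ (r, j)" if "r < k" "j < k" for r j
      using cols_of_index[OF X assms(1) that] n by simp
    have X1': "X $$ (r, seq \<gamma> ! j - Suc 0) = (if r = j then 1 else 0)" if "r < k" "j < k" for r j
      using X1[OF that] that by simp
    have "mat k k (\<lambda>(r, j). X $$ (r, \<sigma> j - 1)) = replace_col (1\<^sub>m k) (1\<^sub>m k *\<^sub>v col X c) i"
      using cv X assms(3)
      by (intro eq_matI) (auto simp: replace_col_def \<sigma>_def X1')
    hence "det (mat k k (\<lambda>(r, j). X $$ (r, \<sigma> j - 1))) = col X c $ i * det (1\<^sub>m k :: complex mat)"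
      using cramer_lemma_mat[of "1\<^sub>m k" k "col X c" i] cv assms(2) by simp
    also have "\<dots> = X $$ (i, c)" using X assms(2,3) by simp
    finally show "plucker X (swap \<gamma> i c) = \<epsilon> * X $$ (i, c)" using \<epsilon>(2)[OF X] im by simp
  qed
qed

text \<open>No permutation maps the \<open>j + 1\<close> rows up to \<open>j\<close> into the
  \<open>j\<close> columns before \<open>j\<close>; hence every term of the Leibniz expansion has a
  factor from the zero block.\<close>

lemma det_zero_block:
  fixes A :: "'a::comm_ring_1 mat"
  assumes A: "A \<in> carrier_mat k k" and j: "j < k"
    and z: "\<And>i l. i \<le> j \<Longrightarrow> j \<le> l \<Longrightarrow> l < k \<Longrightarrow> A $$ (i, l) = 0"
  shows "det A = 0"
  unfolding det_def'[OF A]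
proof (rule sum.neutral, rule ballI)
  fix p assume "p \<in> {p. p permutes {0..<k}}"
  hence p: "p permutes {0..<k}" by simp
  have "\<exists>i\<le>j. j \<le> p i"
  proof (rule ccontr)
    assume "\<not> ?thesis"
    hence "p ` {..j} \<subseteq> {..<j}" by force
    hence "card {..j} \<le> card {..<j}"
      by (intro card_inj_on_le[of p]) (auto intro: inj_on_subset[OF permutes_inj[OF p]])
    thus False by simp
  qed
  then obtain i where i: "i \<le> j" "j \<le> p i" by blast
  have "p i < k" using permutes_in_image[OF p, of i] i(1) j by simp
  hence "A $$ (i, p i) = 0" using z i by blast
  hence "(\<Prod>i = 0..<k. A $$ (i, p i)) = 0"
    using i(1) j by (intro prod_zero) auto
  thus "signof p * (\<Prod>i = 0..<k. A $$ (i, p i)) = 0" by simp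
qed

lemma in_OmegaI:
  assumes X: "X \<in> carrier_mat k n" and \<alpha>: "\<alpha> \<in> kset n k"
    and z: "\<And>i c. i < k \<Longrightarrow> c < n \<Longrightarrow> seq \<alpha> ! i < Suc c \<Longrightarrow> X $$ (i, c) = 0"
  shows "in_Omega_alpha n k \<alpha> X"
  unfolding in_Omega_alpha_def
proof (intro ballI impI)
  fix \<gamma> assume \<gamma>: "\<gamma> \<in> kset n k" and "\<not> bruhat_le \<gamma> \<alpha>"
  then obtain j where j: "j < k" "seq \<alpha> ! j < seq \<gamma> ! j"
    using bruhat_le_iff[OF \<alpha>] by (meson not_le)
  show "plucker X \<gamma> = 0" unfolding plucker_def
  proof (rule det_zero_block[OF cols_of_carrier[OF X \<gamma>] j(1)])
    fix i l assume il: "i \<le> j" "j \<le> l" "l < k"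
    have "seq \<alpha> ! i \<le> seq \<alpha> ! j" using seq_strict[OF \<alpha>, of i j] il j by (cases "i = j") auto
    moreover have "seq \<gamma> ! j \<le> seq \<gamma> ! l" using seq_strict[OF \<gamma>, of j l] il by (cases "j = l") auto
    moreover have "1 \<le> seq \<gamma> ! l" "seq \<gamma> ! l \<le> n" using seq_mem[OF \<gamma> il(3)] by auto
    ultimately show "cols_of X \<gamma> $$ (i, l) = 0"
      using il j by (subst cols_of_index[OF X \<gamma>]) (auto intro!: z)
  qed
qed

text \<open>The exchange raises the weight to at least \<open>wt \<beta> + 1\<close>. If the result
  were below \<alpha>, it would have to be \<alpha> itself with
  \<open>seq \<alpha> ! i = seq \<beta> ! i\<close>; but the exchange removed that element.\<close>

lemma chart_support:
  assumes X: "X \<in> carrier_mat k n" "cols_of X \<beta> = 1\<^sub>m k" and \<beta>: "\<beta> \<in> kset n k" and \<alpha>: "\<alpha> \<in> kset n k"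
    and le: "bruhat_le \<beta> \<alpha>" "wt \<alpha> \<le> Suc (wt \<beta>)"
    and i: "i < k" "c < n" "Suc c \<notin> \<beta>" "seq \<alpha> ! i < Suc c"
  shows "\<not> bruhat_le (swap \<beta> i c) \<alpha>"
proof
  assume l: "bruhat_le (swap \<beta> i c) \<alpha>"
  note S = swap_kset[OF \<beta> i(1-3)]
  have b: "seq \<beta> ! i \<le> seq \<alpha> ! i" using le(1) i(1) bruhat_le_iff[OF \<alpha>] by blast
  note w = wt_swap[OF \<beta> i(1-3)] bruhat_wt(1)[OF S \<alpha> l]
  have e: "seq \<alpha> ! i = seq \<beta> ! i" "wt (swap \<beta> i c) = wt \<alpha>" using w b le(2) i(4) by linarith+
  have "swap \<beta> i c = \<alpha>" by (rule bruhat_wt(2)[OF S \<alpha> l e(2)])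
  moreover have "seq \<beta> ! i \<in> \<alpha>" using seq_mem(1)[OF \<alpha> i(1)] e(1) by simp
  ultimately have "seq \<beta> ! i = Suc c" unfolding swap_def by auto
  thus False using i(4) e(1) by simp
qed

lemma chart_entry:
  assumes X: "X \<in> carrier_mat k n" "cols_of X \<beta> = 1\<^sub>m k" and \<beta>: "\<beta> \<in> kset n k"
    and i: "i < k" "c < n" "Suc c \<in> \<beta>"
  shows "X $$ (i, c) = (if Suc c = seq \<beta> ! i then 1 else 0)"
proof -
  obtain l where l: "l < k" "Suc c = seq \<beta> ! l" using seq_obtain[OF \<beta> i(3)] by blast
  have "X $$ (i, seq \<beta> ! l - 1) = 1\<^sub>m k $$ (i, l)"
    using cols_of_index[OF X(1) \<beta> i(1) l(1)] X(2) by simp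
  moreover have "seq \<beta> ! l - 1 = c" using l(2) by linarith
  ultimately show ?thesis using seq_inj[OF \<beta> i(1) l(1)] i(1) l by auto
qed

text \<open>Converse of \<open>in_OmegaI\<close> within the chart: the quadratic and higher minors
  impose nothing beyond the vanishing of single entries. So \<Omega>_\<alpha> is an affine space
  there, both for \<beta> = \<alpha> and for \<beta> covered by \<alpha>.\<close>

lemma chart_zero:
  assumes X: "X \<in> carrier_mat k n" "cols_of X \<beta> = 1\<^sub>m k" and \<beta>: "\<beta> \<in> kset n k" and \<alpha>: "\<alpha> \<in> kset n k"
    and le: "bruhat_le \<beta> \<alpha>" "wt \<alpha> \<le> Suc (wt \<beta>)" and O: "in_Omega_alpha n k \<alpha> X"
    and i: "i < k" "c < n" "seq \<alpha> ! i < Suc c"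
  shows "X $$ (i, c) = 0"
proof (cases "Suc c \<in> \<beta>")
  case True
  have "seq \<beta> ! i \<le> seq \<alpha> ! i" using le(1) i(1) bruhat_le_iff[OF \<alpha>] by blast
  thus ?thesis using chart_entry[OF X \<beta> i(1,2) True] i(3) by simp
next
  case False
  obtain \<epsilon> :: complex where \<epsilon>: "cmod \<epsilon> = 1" "plucker X (swap \<beta> i c) = \<epsilon> * X $$ (i, c)"
    using plucker_swap[OF \<beta> i(1,2) False] X by metis
  have "plucker X (swap \<beta> i c) = 0"
    using O chart_support[OF X \<beta> \<alpha> le i(1,2) False i(3)] swap_kset[OF \<beta> i(1,2) False]
    unfolding in_Omega_alpha_def by blast
  thus ?thesis using \<epsilon> by auto
qed

text \<open>Take \<delta> of maximal weight among the nonvanishing minors. A nonzero entry to the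
  right of a pivot would, by exchange, give a nonvanishing minor of larger weight.\<close>

lemma exists_schubert_cell:
  assumes "full_rank n k X"
  obtains \<delta> where "\<delta> \<in> kset n k" "plucker X \<delta> \<noteq> 0" "in_Omega_alpha n k \<delta> X"
proof -
  note X = full_rankD(1)[OF assms]
  let ?S = "{\<delta> \<in> kset n k. plucker X \<delta> \<noteq> 0}"
  have S: "finite ?S" "?S \<noteq> {}" using finite_kset full_rankD(2)[OF assms] by auto
  obtain \<delta> where \<delta>: "\<delta> \<in> ?S" "\<And>\<gamma>. \<gamma> \<in> ?S \<Longrightarrow> wt \<gamma> \<le> wt \<delta>"
  proof -
    have "Max (wt ` ?S) \<in> wt ` ?S" using S by (intro Max_in) auto
    then obtain \<delta> where "\<delta> \<in> ?S" "wt \<delta> = Max (wt ` ?S)" by (metis (no_types, lifting) imageE)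
    thus ?thesis using that S(1) by auto
  qed
  hence K: "\<delta> \<in> kset n k" and p: "plucker X \<delta> \<noteq> 0" by auto
  obtain G where G: "G \<in> carrier_mat k k" "det G \<noteq> 0" "cols_of (G * X) \<delta> = 1\<^sub>m k"
    using chart_rep[OF X K p] by metis
  have GX: "G * X \<in> carrier_mat k n" using G X by simp
  have "in_Omega_alpha n k \<delta> (G * X)"
  proof (rule in_OmegaI[OF GX K])
    fix i c assume i: "i < k" "c < n" "seq \<delta> ! i < Suc c"
    show "(G * X) $$ (i, c) = 0"
    proof (cases "Suc c \<in> \<delta>")
      case True
      thus ?thesis using chart_entry[OF GX G(3) K i(1,2) True] i(3) by simp
    next
      case False
      note S = swap_kset[OF K i(1,2) False]
      obtain \<epsilon> :: complex where \<epsilon>: "cmod \<epsilon> = 1" "plucker (G * X) (swap \<delta> i c) = \<epsilon> * (G * X) $$ (i, c)"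
        using plucker_swap[OF K i(1,2) False] GX G(3) by metis
      have "\<not> wt (swap \<delta> i c) \<le> wt \<delta>" using wt_swap[OF K i(1,2) False] i(3) by linarith
      hence "plucker X (swap \<delta> i c) = 0" using \<delta>(2) S by auto
      hence "plucker (G * X) (swap \<delta> i c) = 0" using plucker_mult[OF G(1) X S] by simp
      thus ?thesis using \<epsilon> by auto
    qed
  qed
  hence "in_Omega_alpha n k \<delta> X"
    using G(2) by (auto simp: in_Omega_alpha_def plucker_mult[OF G(1) X])
  thus ?thesis using that K p by blast
qed

lemma in_Omega_mono:
  assumes "\<beta> \<in> kset n k" "\<alpha> \<in> kset n k" "bruhat_le \<beta> \<alpha>" "in_Omega_alpha n k \<beta> X"
  shows "in_Omega_alpha n k \<alpha> X"
  using assms bruhat_trans[OF assms(1,2) _ assms(3)] unfolding in_Omega_alpha_def by blast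

section \<open>The determinant condition under the torus action and its limit at parameter 0\<close>

lemma det_mat_diag: "det (mat_diag n f) = (\<Prod>i<n. f i)" for f :: "nat \<Rightarrow> 'a::comm_ring_1"
proof -
  have "det (mat_diag n f) = prod_list (diag_mat (mat_diag n f))"
    by (rule det_lower_triangular[OF _ mat_diag_dim]) (auto simp: mat_diag_def)
  also have "diag_mat (mat_diag n f) = map f [0..<n]"
    by (auto simp: diag_mat_def mat_diag_def)
  finally show ?thesis by (simp add: prod.list_conv_set_nth lessThan_atLeast0)
qed

text \<open>The coordinate plane spanned by the basis vectors indexed by \<alpha>.\<close>

definition pivot_mat :: "nat \<Rightarrow> nat \<Rightarrow> nat set \<Rightarrow> complex mat" where
  "pivot_mat n k \<alpha> = mat k n (\<lambda>(i, c). if Suc c = seq \<alpha> ! i then 1 else 0)"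

text \<open>The rows of \<^term>\<open>X\<close> rescaled by powers of the torus parameter so that only the pivot
  columns survive at parameter 0.\<close>
definition torus_scale :: "nat \<Rightarrow> nat \<Rightarrow> nat set \<Rightarrow> complex \<Rightarrow> complex mat \<Rightarrow> complex mat" where
  "torus_scale n k \<alpha> t X = mat k n (\<lambda>(i, c). X $$ (i, c) * t ^ (seq \<alpha> ! i - Suc c))"

text \<open>A kernel vector vanishes in the coordinates \<alpha>, so it is annihilated by the
  columns of \<open>B\<close> outside \<alpha>; these form an invertible matrix. This is the point
  where the nonvanishing of all Pluecker coordinates enters.\<close>

lemma det_pivot_append:
  fixes B :: "complex mat"
  assumes k: "k \<le> n" and B: "B \<in> carrier_mat (n - k) n" and \<alpha>: "\<alpha> \<in> kset n k"
    and nz: "\<And>\<gamma>. \<gamma> \<in> kset n (n - k) \<Longrightarrow> plucker B \<gamma> \<noteq> 0"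
  shows "det (pivot_mat n k \<alpha> @\<^sub>r B) \<noteq> 0"
proof
  have E: "pivot_mat n k \<alpha> \<in> carrier_mat k n" by (simp add: pivot_mat_def)
  assume "det (pivot_mat n k \<alpha> @\<^sub>r B) = 0"
  then obtain v where v: "v \<in> carrier_vec n" "v \<noteq> 0\<^sub>v n" "(pivot_mat n k \<alpha> @\<^sub>r B) *\<^sub>v v = 0\<^sub>v n"
    using det_0_iff_vec_prod_zero[OF append_rows_square[OF k E B]] by blast
  have kn: "k + (n - k) = n" using k by simp
  have "(pivot_mat n k \<alpha> *\<^sub>v v) @\<^sub>v (B *\<^sub>v v) = 0\<^sub>v n"
    using mat_mult_append[OF E B v(1)] v(3) by simp
  hence "(pivot_mat n k \<alpha> *\<^sub>v v) @\<^sub>v (B *\<^sub>v v) = 0\<^sub>v k @\<^sub>v 0\<^sub>v (n - k)"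
    using kn by auto
  hence "pivot_mat n k \<alpha> *\<^sub>v v = 0\<^sub>v k \<and> B *\<^sub>v v = 0\<^sub>v (n - k)"
    by (subst (asm) append_vec_eq[of _ k]) (use mult_mat_vec_carrier[OF E v(1)] in auto)
  hence Ev: "pivot_mat n k \<alpha> *\<^sub>v v = 0\<^sub>v k" and Bv: "B *\<^sub>v v = 0\<^sub>v (n - k)" by auto
  have z1: "v $ (seq \<alpha> ! i - 1) = 0" if i: "i < k" for i
  proof -
    note s = seq_mem[OF \<alpha> i]
    have "0 = (pivot_mat n k \<alpha> *\<^sub>v v) $ i" using Ev i by simp
    also have "\<dots> = (\<Sum>c = 0..<n. (if Suc c = seq \<alpha> ! i then 1 else 0) * v $ c)"
      using E i v(1) by (auto simp: scalar_prod_def pivot_mat_def)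
    also have "\<dots> = (\<Sum>c = 0..<n. if c = seq \<alpha> ! i - 1 then v $ c else 0)"
      using s by (intro sum.cong) auto
    also have "\<dots> = v $ (seq \<alpha> ! i - 1)" using s by (simp add: sum.delta)
    finally show ?thesis by simp
  qed
  define \<gamma> where "\<gamma> = {1..n} - \<alpha>"
  have \<gamma>: "\<gamma> \<in> kset n (n - k)"
    using ksetD[OF \<alpha>] by (auto simp: \<gamma>_def kset_def card_Diff_subset)
  note C = cols_of_carrier[OF B \<gamma>]
  define w where "w = vec (n - k) (\<lambda>j. v $ (seq \<gamma> ! j - 1))"
  have vz: "v $ c = 0" if "c < n" "Suc c \<notin> \<gamma>" for c
  proof -
    have "Suc c \<in> \<alpha>" using that by (auto simp: \<gamma>_def)
    then obtain i where "i < k" "Suc c = seq \<alpha> ! i" using seq_obtain[OF \<alpha>] by blast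
    thus ?thesis using z1[of i] by (simp flip: \<open>Suc c = seq \<alpha> ! i\<close>)
  qed
  have "cols_of B \<gamma> *\<^sub>v w = 0\<^sub>v (n - k)"
  proof (rule eq_vecI)
    fix i assume "i < dim_vec (0\<^sub>v (n - k) :: complex vec)"
    hence i: "i < n - k" by simp
    have bij: "bij_betw (\<lambda>j. seq \<gamma> ! j - 1) {0..<n - k} {c. c < n \<and> Suc c \<in> \<gamma>}"
      unfolding bij_betw_def
    proof
      show "inj_on (\<lambda>j. seq \<gamma> ! j - 1) {0..<n - k}"
      proof (rule inj_onI)
        fix x y assume xy: "x \<in> {0..<n - k}" "y \<in> {0..<n - k}" "seq \<gamma> ! x - 1 = seq \<gamma> ! y - 1"
        hence "seq \<gamma> ! x = seq \<gamma> ! y"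
          using seq_mem(2)[OF \<gamma>, of x] seq_mem(2)[OF \<gamma>, of y] by (auto simp: eq_diff_iff)
        thus "x = y" using seq_inj[OF \<gamma>] xy by simp
      qed
      show "(\<lambda>j. seq \<gamma> ! j - 1) ` {0..<n - k} = {c. c < n \<and> Suc c \<in> \<gamma>}"
      proof (intro equalityI subsetI)
        fix c assume "c \<in> (\<lambda>j. seq \<gamma> ! j - 1) ` {0..<n - k}"
        then obtain j where "j < n - k" "c = seq \<gamma> ! j - 1" by auto
        thus "c \<in> {c. c < n \<and> Suc c \<in> \<gamma>}" using seq_mem[OF \<gamma>, of j] by auto
      next
        fix c assume "c \<in> {c. c < n \<and> Suc c \<in> \<gamma>}"
        then obtain j where "j < n - k" "Suc c = seq \<gamma> ! j" using seq_obtain[OF \<gamma>] by blast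
        hence "c = seq \<gamma> ! j - 1" by (simp flip: \<open>Suc c = seq \<gamma> ! j\<close>)
        thus "c \<in> (\<lambda>j. seq \<gamma> ! j - 1) ` {0..<n - k}" using \<open>j < n - k\<close> by auto
      qed
    qed
    have "(cols_of B \<gamma> *\<^sub>v w) $ i = (\<Sum>j = 0..<n - k. B $$ (i, seq \<gamma> ! j - 1) * v $ (seq \<gamma> ! j - 1))"
      using C i by (auto simp: scalar_prod_def w_def cols_of_index[OF B \<gamma>])
    also have "\<dots> = (\<Sum>c\<in>{c. c < n \<and> Suc c \<in> \<gamma>}. B $$ (i, c) * v $ c)"
      by (rule sum.reindex_bij_betw[OF bij])
    also have "\<dots> = (\<Sum>c = 0..<n. B $$ (i, c) * v $ c)"
      by (rule sum.mono_neutral_left) (auto simp: vz)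
    also have "\<dots> = (B *\<^sub>v v) $ i" using B i v(1) by (auto simp: scalar_prod_def)
    also have "\<dots> = 0" using Bv i by simp
    finally show "(cols_of B \<gamma> *\<^sub>v w) $ i = 0\<^sub>v (n - k) $ i" using i by simp
  qed (use C in auto)
  moreover have "w \<in> carrier_vec (n - k)" by (simp add: w_def)
  moreover have "det (cols_of B \<gamma>) \<noteq> 0" using nz[OF \<gamma>] by (simp add: plucker_def)
  ultimately have w0: "w = 0\<^sub>v (n - k)" using det_0_iff_vec_prod_zero[OF C] by blast
  have "v $ c = 0" if c: "c < n" for c
  proof (cases "Suc c \<in> \<gamma>")
    case True
    then obtain j where j: "j < n - k" "Suc c = seq \<gamma> ! j" using seq_obtain[OF \<gamma>] by blast
    have "w $ j = v $ c" using j(1) by (simp add: w_def flip: j(2))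
    thus ?thesis using w0 j(1) by simp
  qed (rule vz[OF c])
  hence "v = 0\<^sub>v n" using v(1) by (intro eq_vecI) auto
  thus False using v(2) by simp
qed

text \<open>Quotient of the determinants of the two diagonal matrices used for rescaling; the row
  factors are padded by 1 for the rows of the lower block.\<close>

definition torus_factor :: "nat \<Rightarrow> nat \<Rightarrow> nat set \<Rightarrow> complex \<Rightarrow> complex" where
  "torus_factor n k \<alpha> t = (\<Prod>c<n. t ^ Suc c) / (\<Prod>i<n. if i < k then t ^ (seq \<alpha> ! i) else 1)"

lemma torus_factor_nonzero: "t \<noteq> 0 \<Longrightarrow> torus_factor n k \<alpha> t \<noteq> 0"
  by (auto simp: torus_factor_def)

text \<open>Multiply row \<open>i\<close> of \<open>X\<close> by the power
  \<open>seq \<alpha> ! i\<close> of \<open>t\<close> and divide column \<open>c\<close> by the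
  power \<open>Suc c\<close>. The lower block becomes \<open>B\<close>, and no negative exponent is
  left in the upper one because \<open>X\<close> vanishes to the right of the pivots.\<close>

lemma det_torus_scale:
  assumes k: "k \<le> n" and B: "B \<in> carrier_mat (n - k) n" and t: "t \<noteq> (0::complex)"
    and X: "X \<in> carrier_mat k n"
    and z: "\<And>i c. i < k \<Longrightarrow> c < n \<Longrightarrow> seq \<alpha> ! i < Suc c \<Longrightarrow> X $$ (i, c) = 0"
  shows "det (X @\<^sub>r tact t B) = torus_factor n k \<alpha> t * det (torus_scale n k \<alpha> t X @\<^sub>r B)"
proof -
  define D1 where "D1 = mat_diag n (\<lambda>i. if i < k then t ^ (seq \<alpha> ! i) else 1)"
  define D2 where "D2 = mat_diag n (\<lambda>c. t ^ Suc c)"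
  have D: "D1 \<in> carrier_mat n n" "D2 \<in> carrier_mat n n" by (simp_all add: D1_def D2_def)
  have nz: "det D1 \<noteq> 0" using t by (auto simp: D1_def det_mat_diag)
  have T: "tact t B \<in> carrier_mat (n - k) n" using B by (simp add: tact_def)
  have S: "torus_scale n k \<alpha> t X \<in> carrier_mat k n" by (simp add: torus_scale_def)
  note c1 = append_rows_square[OF k X T]
  note c2 = append_rows_square[OF k S B]
  have "D1 * (X @\<^sub>r tact t B) = (torus_scale n k \<alpha> t X @\<^sub>r B) * D2"
    unfolding D1_def D2_def mat_diag_mult_left[OF c1] mat_diag_mult_right[OF c2]
  proof (intro cong_mat refl)
    fix i c assume i: "i < n" and c: "c < n"
    have kn: "k + (n - k) = n" using k by simp
    have e1: "(X @\<^sub>r tact t B) $$ (i, c) = (if i < k then X $$ (i, c) else tact t B $$ (i - k, c))"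
      using append_rows_index[OF X T, of i c] i c kn by simp
    have e2: "(torus_scale n k \<alpha> t X @\<^sub>r B) $$ (i, c) = (if i < k then torus_scale n k \<alpha> t X $$ (i, c) else B $$ (i - k, c))"
      using append_rows_index[OF S B, of i c] i c kn by simp
    have e3: "torus_scale n k \<alpha> t X $$ (i, c) = X $$ (i, c) * t ^ (seq \<alpha> ! i - Suc c)" if "i < k"
      using that c by (simp add: torus_scale_def)
    show "(case (i, c) of (i, j) \<Rightarrow> (if i < k then t ^ seq \<alpha> ! i else 1) * (X @\<^sub>r tact t B) $$ (i, j)) =
      (case (i, c) of (i, j) \<Rightarrow> (torus_scale n k \<alpha> t X @\<^sub>r B) $$ (i, j) * t ^ Suc j)"
    proof (cases "i < k")
      case True
      show ?thesis
      proof (cases "seq \<alpha> ! i < Suc c")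
        \<comment> \<open>Here the exponent in \<open>torus_scale\<close> is truncated to 0, but the
          entry of \<open>X\<close> vanishes.\<close>
        case True
        thus ?thesis using z[OF \<open>i < k\<close> c] \<open>i < k\<close> c by (simp add: e1 e2 e3)
      next
        case False
        hence "t ^ (seq \<alpha> ! i) = t ^ (seq \<alpha> ! i - Suc c) * t ^ Suc c"
          by (simp flip: power_add del: power_Suc)
        thus ?thesis using \<open>i < k\<close> c by (simp add: e1 e2 e3 del: power_Suc)
      qed
    next
      case False
      have "tact t B $$ (i - k, c) = B $$ (i - k, c) * t ^ Suc c"
        using False i c B by (simp add: tact_def)
      thus ?thesis using False by (simp add: e1 e2 del: power_Suc)
    qed
  qed
  hence "det D1 * det (X @\<^sub>r tact t B) = det (torus_scale n k \<alpha> t X @\<^sub>r B) * det D2"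
    using det_mult[OF D(1) c1] det_mult[OF c2 D(2)] by simp
  moreover have "torus_factor n k \<alpha> t = det D2 / det D1"
    unfolding torus_factor_def D1_def D2_def det_mat_diag ..
  hence "det D2 = det D1 * torus_factor n k \<alpha> t" using nz by simp
  ultimately have "det D1 * det (X @\<^sub>r tact t B) =
      det D1 * (torus_factor n k \<alpha> t * det (torus_scale n k \<alpha> t X @\<^sub>r B))"
    by (simp only: mult_ac)
  thus ?thesis using nz by simp
qed

text \<open>For such \<open>X\<close> the columns \<alpha> form a lower triangular matrix, so the
  product is the Pluecker coordinate p_\<alpha>(X). This is the lowest-order term in
  \<open>t\<close> of the condition.\<close>

lemma det_torus_scale_0:
  assumes k: "k \<le> n" and B: "B \<in> carrier_mat (n - k) n" and \<alpha>: "\<alpha> \<in> kset n k"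
    and X: "X \<in> carrier_mat k n"
    and z: "\<And>i c. i < k \<Longrightarrow> c < n \<Longrightarrow> seq \<alpha> ! i < Suc c \<Longrightarrow> X $$ (i, c) = 0"
  shows "det (torus_scale n k \<alpha> 0 X @\<^sub>r B) =
    (\<Prod>i<k. X $$ (i, seq \<alpha> ! i - 1)) * det (pivot_mat n k \<alpha> @\<^sub>r B)"
proof -
  define D where "D = mat_diag n (\<lambda>i. if i < k then X $$ (i, seq \<alpha> ! i - 1) else 1)"
  have E: "pivot_mat n k \<alpha> \<in> carrier_mat k n" by (simp add: pivot_mat_def)
  have S: "torus_scale n k \<alpha> 0 X \<in> carrier_mat k n" by (simp add: torus_scale_def)
  note c1 = append_rows_square[OF k E B]
  note c2 = append_rows_square[OF k S B]
  have kn: "k + (n - k) = n" using k by simp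
  have "torus_scale n k \<alpha> 0 X @\<^sub>r B = D * (pivot_mat n k \<alpha> @\<^sub>r B)"
    unfolding D_def mat_diag_mult_left[OF c1]
  proof (rule eq_matI, goal_cases)
    case (1 i c)
    hence i: "i < n" and c: "c < n" by auto
    show ?case
    proof (cases "i < k")
      case True
      \<comment> \<open>Left of the pivot the power of 0 is 0; at the pivot the exponent is 0 and
        the power 1; to the right the truncated exponent also gives 1, and hypothesis
        \<open>z\<close> removes the entry.\<close>
      consider "seq \<alpha> ! i < Suc c" | "seq \<alpha> ! i = Suc c" | "Suc c < seq \<alpha> ! i" by linarith
      thus ?thesis
        using True i c kn z[OF True c] append_rows_index[OF E B, of i c] append_rows_index[OF S B, of i c]
        by cases (simp_all add: torus_scale_def pivot_mat_def)
    next
      case False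
      thus ?thesis
        using i c kn append_rows_index[OF E B, of i c] append_rows_index[OF S B, of i c] by simp
    qed
  qed (use c2 in auto)
  hence "det (torus_scale n k \<alpha> 0 X @\<^sub>r B) = det D * det (pivot_mat n k \<alpha> @\<^sub>r B)"
    using det_mult[OF _ c1, of D] by (simp add: D_def)
  also have "det D = (\<Prod>i<k + (n - k). if i < k then X $$ (i, seq \<alpha> ! i - 1) else 1)"
    unfolding D_def det_mat_diag kn ..
  also have "\<dots> = (\<Prod>i<k. X $$ (i, seq \<alpha> ! i - 1))"
    by (rule prod.mono_neutral_cong_right) auto
  finally show ?thesis .
qed

subsection \<open>Tangent vectors, limits and complex conjugation\<close>

definition entry_smooth :: "nat \<Rightarrow> nat \<Rightarrow> (complex mat \<Rightarrow> complex) \<Rightarrow> bool" where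
  "entry_smooth k n \<phi> \<longleftrightarrow> (\<forall>p. sdiff ({..<k} \<times> {..<n}) p (\<lambda>x. \<phi> (mat k n x)))"

lemma entry_smooth_plucker:
  assumes \<gamma>: "\<gamma> \<in> kset n k"
  shows "entry_smooth k n (\<lambda>X. plucker X \<gamma>)"
  unfolding entry_smooth_def plucker_def
proof (intro allI sdiff_det)
  fix p :: "nat \<times> nat \<Rightarrow> complex" and x :: "nat \<times> nat \<Rightarrow> complex" and i j
  show "cols_of (mat k n x) \<gamma> \<in> carrier_mat k k" by (rule cols_of_carrier[OF mat_carrier \<gamma>])
  assume i: "i < k" and j: "j < k"
  have s: "seq \<gamma> ! j - 1 < n" using seq_mem[OF \<gamma> j] by simp
  have "(\<lambda>x :: nat \<times> nat \<Rightarrow> complex. cols_of (mat k n x) \<gamma> $$ (i, j)) = (\<lambda>x. x (i, seq \<gamma> ! j - 1))"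
    using i s by (simp add: cols_of_index[OF mat_carrier \<gamma> i j])
  moreover have "sdiff ({..<k} \<times> {..<n}) p (\<lambda>x. x (i, seq \<gamma> ! j - 1))"
    using i s by (intro sdiff_coord) auto
  ultimately show "sdiff ({..<k} \<times> {..<n}) p (\<lambda>x. cols_of (mat k n x) \<gamma> $$ (i, j))"
    by (simp only:)
qed auto

lemma sdiff_det_append:
  assumes k: "k \<le> n" and M: "M \<in> carrier_mat (n - k) n" and I: "finite I" and X: "\<And>x. X x \<in> carrier_mat k n"
    and e: "\<And>i c. i < k \<Longrightarrow> c < n \<Longrightarrow> sdiff I p (\<lambda>x. X x $$ (i, c))"
  shows "sdiff I p (\<lambda>x. det (X x @\<^sub>r M))"
proof (rule sdiff_det[OF I])
  show "X x @\<^sub>r M \<in> carrier_mat n n" for x by (rule append_rows_square[OF k X M])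
  fix i c assume ic: "i < n" "c < n"
  have "(\<lambda>x. (X x @\<^sub>r M) $$ (i, c)) = (if i < k then (\<lambda>x. X x $$ (i, c)) else (\<lambda>x. M $$ (i - k, c)))"
    using append_rows_index[OF X M, of i c] ic k by auto
  thus "sdiff I p (\<lambda>x. (X x @\<^sub>r M) $$ (i, c))" using e ic by (simp add: sdiff_const)
qed

lemma entry_smooth_append:
  assumes k: "k \<le> n" and M: "M \<in> carrier_mat (n - k) n"
  shows "entry_smooth k n (\<lambda>X. det (X @\<^sub>r M))"
  unfolding entry_smooth_def by (intro allI sdiff_det_append[OF k M]) (auto intro!: sdiff_coord)

text \<open>Derivatives along single lines are not linear in the direction by themselves; the
  gradient supplies linearity.\<close>

lemma entry_smooth_deriv_diff:
  assumes sm: "entry_smooth k n \<phi>"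
    and c: "X \<in> carrier_mat k n" "V \<in> carrier_mat k n" "W \<in> carrier_mat k n"
    and V: "((\<lambda>s. \<phi> (X + s \<cdot>\<^sub>m V)) has_field_derivative a) (at 0)"
    and W: "((\<lambda>s. \<phi> (X + s \<cdot>\<^sub>m W)) has_field_derivative b) (at 0)"
  shows "((\<lambda>s. \<phi> (X + s \<cdot>\<^sub>m (V - W))) has_field_derivative (a - b)) (at 0)"
proof -
  let ?I = "{..<k} \<times> {..<n}"
  obtain d where d: "strict_deriv ?I (\<lambda>ic. X $$ ic) (\<lambda>x. \<phi> (mat k n x)) d"
    using sm unfolding entry_smooth_def sdiff_def by blast
  have D: "((\<lambda>s. \<phi> (X + s \<cdot>\<^sub>m U)) has_field_derivative (\<Sum>ic\<in>?I. d ic * U $$ ic)) (at 0)"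
    if "U \<in> carrier_mat k n" for U
  proof -
    have "mat k n (\<lambda>ic. X $$ ic + s * U $$ ic) = X + s \<cdot>\<^sub>m U" for s
      using that c(1) by (intro eq_matI) auto
    thus ?thesis using strict_deriv_has_field_derivative[OF _ d, of "\<lambda>ic. U $$ ic"] by simp
  qed
  have "a = (\<Sum>ic\<in>?I. d ic * V $$ ic)" by (rule DERIV_unique[OF V D[OF c(2)]])
  moreover have "b = (\<Sum>ic\<in>?I. d ic * W $$ ic)" by (rule DERIV_unique[OF W D[OF c(3)]])
  moreover have "(\<Sum>ic\<in>?I. d ic * (V - W) $$ ic) = (\<Sum>ic\<in>?I. d ic * V $$ ic - d ic * W $$ ic)"
    using c by (intro sum.cong) (auto simp: right_diff_distrib)
  ultimately have "(\<Sum>ic\<in>?I. d ic * (V - W) $$ ic) = a - b" by (simp add: sum_subtractf)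
  thus ?thesis using D[of "V - W"] c by (metis minus_carrier_mat)
qed

definition relative_invariant :: "nat \<Rightarrow> nat \<Rightarrow> (complex mat \<Rightarrow> complex) \<Rightarrow> bool" where
  "relative_invariant k n \<phi> \<longleftrightarrow>
    (\<forall>G\<in>carrier_mat k k. \<forall>X\<in>carrier_mat k n. \<phi> (G * X) = det G * \<phi> X)"

lemma relative_invariant_plucker: "\<gamma> \<in> kset n k \<Longrightarrow> relative_invariant k n (\<lambda>X. plucker X \<gamma>)"
  by (simp add: relative_invariant_def plucker_mult)

lemma relative_invariant_append:
  "k \<le> n \<Longrightarrow> M \<in> carrier_mat (n - k) n \<Longrightarrow> relative_invariant k n (\<lambda>X. det (X @\<^sub>r M))"
  by (simp add: relative_invariant_def det_append_mult)

text \<open>Along \<open>X + s \<cdot>\<^sub>m (C * X)\<close> the function is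
  \<open>\<phi> X\<close> times a determinant, and so stays zero.\<close>

lemma deriv_along_orbit:
  assumes "relative_invariant k n \<phi>" "\<phi> X = 0" "X \<in> carrier_mat k n" "C \<in> carrier_mat k k"
  shows "((\<lambda>s. \<phi> (X + s \<cdot>\<^sub>m (C * X))) has_field_derivative 0) (at 0)"
proof -
  have "X + s \<cdot>\<^sub>m (C * X) = (1\<^sub>m k + s \<cdot>\<^sub>m C) * X" for s
    using assms(3,4) by (simp add: add_mult_distrib_mat[of _ k k _ _ n] mult_smult_assoc_mat[of _ k k _ n])
  hence "\<phi> (X + s \<cdot>\<^sub>m (C * X)) = 0" for s
    using assms unfolding relative_invariant_def by simp
  thus ?thesis by simp
qed

text \<open>Minors and determinants with an appended block are gathered as functions because
  smoothness and invariance under row operations are all that the tangent arguments need from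
  them.\<close>

definition conditions :: "nat \<Rightarrow> nat \<Rightarrow> nat set \<Rightarrow> complex mat list \<Rightarrow> (complex mat \<Rightarrow> complex) set" where
  "conditions n k \<alpha> Ms = {(\<lambda>X. plucker X \<beta>) | \<beta>. \<beta> \<in> kset n k \<and> \<not> bruhat_le \<beta> \<alpha>} \<union>
    {(\<lambda>X. det (X @\<^sub>r M)) | M. M \<in> set Ms}"

definition tangent :: "nat \<Rightarrow> nat \<Rightarrow> nat set \<Rightarrow> complex mat list \<Rightarrow> complex mat \<Rightarrow> complex mat \<Rightarrow> bool" where
  "tangent n k \<alpha> Ms X V \<longleftrightarrow> (\<forall>\<phi>\<in>conditions n k \<alpha> Ms.
     ((\<lambda>s. \<phi> (X + s \<cdot>\<^sub>m V)) has_field_derivative 0) (at 0))"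

text \<open>Transversality without a choice of chart: every tangent direction of the intersection points
  along the orbit of the group of row operations.\<close>
definition nondegenerate :: "nat \<Rightarrow> nat \<Rightarrow> nat set \<Rightarrow> complex mat list \<Rightarrow> complex mat \<Rightarrow> bool" where
  "nondegenerate n k \<alpha> Ms X \<longleftrightarrow>
    (\<forall>V\<in>carrier_mat k n. tangent n k \<alpha> Ms X V \<longrightarrow> (\<exists>C\<in>carrier_mat k k. V = C * X))"

definition solution :: "nat \<Rightarrow> nat \<Rightarrow> nat set \<Rightarrow> complex mat list \<Rightarrow> complex mat \<Rightarrow> bool" where
  "solution n k \<alpha> Ms X \<longleftrightarrow> full_rank n k X \<and> in_Omega_alpha n k \<alpha> X \<and> (\<forall>M\<in>set Ms. meets X M)"

lemma tangent_iff:
  "tangent n k \<alpha> Ms X V \<longleftrightarrow>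
    (\<forall>\<beta>\<in>kset n k. \<not> bruhat_le \<beta> \<alpha> \<longrightarrow> ((\<lambda>s. plucker (X + s \<cdot>\<^sub>m V) \<beta>) has_field_derivative 0) (at 0)) \<and>
    (\<forall>M\<in>set Ms. ((\<lambda>s. det ((X + s \<cdot>\<^sub>m V) @\<^sub>r M)) has_field_derivative 0) (at 0))"
  unfolding tangent_def conditions_def by (auto simp: Ball_def)

lemma conditions_props:
  assumes "k \<le> n" "\<forall>M\<in>set Ms. M \<in> carrier_mat (n - k) n" "\<phi> \<in> conditions n k \<alpha> Ms"
  shows "entry_smooth k n \<phi>" "relative_invariant k n \<phi>"
  using assms by (auto simp: conditions_def entry_smooth_plucker entry_smooth_append
      relative_invariant_plucker relative_invariant_append)

lemma solution_conditions:
  assumes "solution n k \<alpha> Ms X" "\<phi> \<in> conditions n k \<alpha> Ms"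
  shows "\<phi> X = 0"
  using assms by (auto simp: solution_def conditions_def in_Omega_alpha_def meets_def)

lemma isect_eq: "isect n k \<alpha> Ms = rowspace ` {X. solution n k \<alpha> Ms X}"
  by (auto simp: isect_def solution_def Gr_def)

lemma solutionD: "solution n k \<alpha> Ms X \<Longrightarrow> X \<in> carrier_mat k n"
  by (auto simp: solution_def full_rank_def)

lemma solution_mult:
  assumes "k \<le> n" "\<forall>M\<in>set Ms. M \<in> carrier_mat (n - k) n" "solution n k \<alpha> Ms X"
    "G \<in> carrier_mat k k" "det G \<noteq> 0"
  shows "solution n k \<alpha> Ms (G * X)"
  using assms solutionD[OF assms(3)] full_rank_mult[of n k X G] in_Omega_mult[of X k n G] meets_mult[of k n X G]
  by (auto simp: solution_def)

lemma DERIV_linear_eq_0: "((\<lambda>s. s * c) has_field_derivative 0) (at 0) \<Longrightarrow> c = 0" for c :: complex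
  using DERIV_unique[OF DERIV_cmult_right[OF DERIV_ident]] by fastforce

text \<open>First-order counterpart of \<open>chart_zero\<close>: the exchanged minor is linear
  along the line \<open>X + s \<cdot>\<^sub>m V\<close>, with slope the entry of \<open>V\<close> up
  to sign. Tangent vectors thus live on the free positions.\<close>

lemma tangent_support:
  assumes X: "X \<in> carrier_mat k n" "cols_of X \<beta> = 1\<^sub>m k" and \<beta>: "\<beta> \<in> kset n k" and \<alpha>: "\<alpha> \<in> kset n k"
    and le: "bruhat_le \<beta> \<alpha>" "wt \<alpha> \<le> Suc (wt \<beta>)"
    and V: "V \<in> carrier_mat k n" "cols_of V \<beta> = 0\<^sub>m k k" "tangent n k \<alpha> Ms X V"
    and ic: "i < k" "c < n" and c: "Suc c \<in> \<beta> \<or> seq \<alpha> ! i < Suc c \<and> X $$ (i, c) = 0"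
  shows "V $$ (i, c) = 0"
proof -
  have V0: "V $$ (i, seq \<beta> ! l - 1) = 0" if "i < k" "l < k" for i l
    using cols_of_index[OF V(1) \<beta> that] V(2) that by simp
  show ?thesis
  proof (cases "Suc c \<in> \<beta>")
    case True
    then obtain l where l: "l < k" "Suc c = seq \<beta> ! l" using seq_obtain[OF \<beta>] by blast
    hence "seq \<beta> ! l - 1 = c" by linarith
    thus ?thesis using V0[OF ic(1) l(1)] by simp
  next
    case False
    have XVc: "X + s \<cdot>\<^sub>m V \<in> carrier_mat k n" for s using V(1) by simp
    have XV\<beta>: "cols_of (X + s \<cdot>\<^sub>m V) \<beta> = 1\<^sub>m k" for s
    proof (rule eq_matI)
      fix i l assume "i < dim_row (1\<^sub>m k :: complex mat)" "l < dim_col (1\<^sub>m k :: complex mat)"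
      hence il: "i < k" "l < k" by auto
      have s: "seq \<beta> ! l - 1 < n" using seq_mem[OF \<beta> il(2)] by simp
      have "X $$ (i, seq \<beta> ! l - 1) = 1\<^sub>m k $$ (i, l)" using cols_of_index[OF X(1) \<beta> il] X(2) by simp
      thus "cols_of (X + s \<cdot>\<^sub>m V) \<beta> $$ (i, l) = 1\<^sub>m k $$ (i, l)"
        unfolding cols_of_index[OF XVc \<beta> il] using il s V(1) X(1) V0[OF il] by simp
    qed (use cols_of_carrier[OF XVc \<beta>] in auto)
    have c: "seq \<alpha> ! i < Suc c" "X $$ (i, c) = 0" using c False by auto
    obtain \<epsilon> :: complex where \<epsilon>: "cmod \<epsilon> = 1"
      "\<And>X. X \<in> carrier_mat k n \<Longrightarrow> cols_of X \<beta> = 1\<^sub>m k \<Longrightarrow> plucker X (swap \<beta> i c) = \<epsilon> * X $$ (i, c)"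
      using plucker_swap[OF \<beta> ic False] by metis
    have "plucker (X + s \<cdot>\<^sub>m V) (swap \<beta> i c) = s * (\<epsilon> * V $$ (i, c))" for s
      using \<epsilon>(2)[OF XVc XV\<beta>, of s] c(2) ic V(1) X(1) by simp
    moreover have "((\<lambda>s. plucker (X + s \<cdot>\<^sub>m V) (swap \<beta> i c)) has_field_derivative 0) (at 0)"
      using V(3) swap_kset[OF \<beta> ic False] chart_support[OF X \<beta> \<alpha> le ic False c(1)]
      unfolding tangent_iff by blast
    ultimately have "\<epsilon> * V $$ (i, c) = 0" by (intro DERIV_linear_eq_0) simp
    thus ?thesis using \<epsilon>(1) by auto
  qed
qed

lemma nondegenerate_mult:
  assumes k: "k \<le> n" and Ms: "\<forall>M\<in>set Ms. M \<in> carrier_mat (n - k) n"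
    and X: "X \<in> carrier_mat k n" and nd: "nondegenerate n k \<alpha> Ms X"
    and G: "G \<in> carrier_mat k k" "det G \<noteq> 0"
  shows "nondegenerate n k \<alpha> Ms (G * X)"
  unfolding nondegenerate_def
proof (intro ballI impI)
  fix V :: "complex mat" assume V: "V \<in> carrier_mat k n" and t: "tangent n k \<alpha> Ms (G * X) V"
  obtain A where A: "A \<in> carrier_mat k k" "A * G = 1\<^sub>m k" "G * A = 1\<^sub>m k"
    using det_nonzero_inverse[OF G] by blast
  have "X + s \<cdot>\<^sub>m (A * V) = A * (G * X + s \<cdot>\<^sub>m V)" for s
  proof -
    have "A * (G * X + s \<cdot>\<^sub>m V) = A * (G * X) + A * (s \<cdot>\<^sub>m V)"
      using A G X V by (intro mult_add_distrib_mat[of _ k k _ n]) auto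
    also have "A * (G * X) = X" using A G X by (simp add: assoc_mult_mat[symmetric, of _ k k _ k _ n])
    also have "A * (s \<cdot>\<^sub>m V) = s \<cdot>\<^sub>m (A * V)" using A V by (simp add: mult_smult_distrib)
    finally show ?thesis by simp
  qed
  hence e: "\<phi> (X + s \<cdot>\<^sub>m (A * V)) = det A * \<phi> (G * X + s \<cdot>\<^sub>m V)" if "\<phi> \<in> conditions n k \<alpha> Ms" for \<phi> s
    using conditions_props(2)[OF k Ms that] A G X V by (simp add: relative_invariant_def)
  have "tangent n k \<alpha> Ms X (A * V)"
    unfolding tangent_def
  proof
    fix \<phi> assume \<phi>: "\<phi> \<in> conditions n k \<alpha> Ms"
    have "((\<lambda>s. \<phi> (G * X + s \<cdot>\<^sub>m V)) has_field_derivative 0) (at 0)"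
      using t \<phi> by (simp add: tangent_def)
    from DERIV_cmult[OF this, of "det A"]
    show "((\<lambda>s. \<phi> (X + s \<cdot>\<^sub>m (A * V))) has_field_derivative 0) (at 0)"
      by (simp add: e[OF \<phi>])
  qed
  then obtain C where C: "C \<in> carrier_mat k k" "A * V = C * X"
    using nd A V unfolding nondegenerate_def by (meson mult_carrier_mat)
  have "V = G * (A * V)" using A G V by (simp add: assoc_mult_mat[symmetric, of _ k k _ k _ n])
  also have "\<dots> = G * (C * X)" unfolding C(2) ..
  also have "X = A * (G * X)" using A G X by (simp add: assoc_mult_mat[symmetric, of _ k k _ k _ n])
  also have "G * (C * (A * (G * X))) = (G * C) * (A * (G * X))"
    by (rule assoc_mult_mat[symmetric, OF G(1) C(1)]) (use A G X in auto)
  also have "\<dots> = (G * C * A) * (G * X)"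
    by (rule assoc_mult_mat[symmetric, OF _ A(1)]) (use C G X in auto)
  finally have "V = (G * C * A) * (G * X)" .
  thus "\<exists>C\<in>carrier_mat k k. V = C * (G * X)"
    using C A G by (intro bexI[of _ "G * C * A"]) auto
qed

lemma nondegenerate_chartD:
  assumes X: "X \<in> carrier_mat k n" "cols_of X \<gamma> = 1\<^sub>m k" and \<gamma>: "\<gamma> \<in> kset n k"
    and nd: "nondegenerate n k \<alpha> Ms X"
    and V: "V \<in> carrier_mat k n" "cols_of V \<gamma> = 0\<^sub>m k k" "tangent n k \<alpha> Ms X V"
  shows "V = 0\<^sub>m k n"
proof -
  obtain C where C: "C \<in> carrier_mat k k" "V = C * X"
    using nd V unfolding nondegenerate_def by blast
  have "0\<^sub>m k k = C * 1\<^sub>m k" using cols_of_mult[OF C(1) X(1) \<gamma>] V(2) X(2) C(2) by simp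
  hence "C = 0\<^sub>m k k" using C(1) by simp
  thus ?thesis using C(2) X(1) by simp
qed

text \<open>Subtracting \<open>cols_of V \<gamma> * X\<close> from a tangent vector removes its
  columns \<gamma>. The difference is still tangent, since orbit directions are tangent at a
  solution and derivatives are linear in the direction.\<close>

lemma nondegenerate_chartI:
  assumes k: "k \<le> n" and Ms: "\<forall>M\<in>set Ms. M \<in> carrier_mat (n - k) n"
    and X: "solution n k \<alpha> Ms X" "cols_of X \<gamma> = 1\<^sub>m k" and \<gamma>: "\<gamma> \<in> kset n k"
    and nd: "\<And>V. V \<in> carrier_mat k n \<Longrightarrow> cols_of V \<gamma> = 0\<^sub>m k k \<Longrightarrow> tangent n k \<alpha> Ms X V \<Longrightarrow> V = 0\<^sub>m k n"
  shows "nondegenerate n k \<alpha> Ms X"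
  unfolding nondegenerate_def
proof (intro ballI impI)
  fix V :: "complex mat" assume V: "V \<in> carrier_mat k n" and t: "tangent n k \<alpha> Ms X V"
  note Xc = solutionD[OF X(1)]
  define C where "C = cols_of V \<gamma>"
  have C: "C \<in> carrier_mat k k" unfolding C_def by (rule cols_of_carrier[OF V \<gamma>])
  have CX: "C * X \<in> carrier_mat k n" using C Xc by simp
  have W: "V - C * X \<in> carrier_mat k n" using CX by (rule minus_carrier_mat)
  have "cols_of (V - C * X) \<gamma> = cols_of V \<gamma> - cols_of (C * X) \<gamma>"
  proof (rule eq_matI)
    note c = cols_of_carrier[OF V \<gamma>] cols_of_carrier[OF CX \<gamma>]
    fix i j assume "i < dim_row (cols_of V \<gamma> - cols_of (C * X) \<gamma>)" "j < dim_col (cols_of V \<gamma> - cols_of (C * X) \<gamma>)"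
    hence ij: "i < k" "j < k" using c by auto
    have "seq \<gamma> ! j - 1 < n" using seq_mem[OF \<gamma> ij(2)] by simp
    thus "cols_of (V - C * X) \<gamma> $$ (i, j) = (cols_of V \<gamma> - cols_of (C * X) \<gamma>) $$ (i, j)"
      using ij c V CX by (simp add: cols_of_index[OF W \<gamma>] cols_of_index[OF V \<gamma>] cols_of_index[OF CX \<gamma>] del: index_mult_mat)
  qed (use cols_of_carrier[OF W \<gamma>] cols_of_carrier[OF V \<gamma>] cols_of_carrier[OF CX \<gamma>] in auto)
  also have "\<dots> = 0\<^sub>m k k" using cols_of_mult[OF C Xc \<gamma>] X(2) C by (simp add: C_def)
  finally have W0: "cols_of (V - C * X) \<gamma> = 0\<^sub>m k k" .
  have "tangent n k \<alpha> Ms X (V - C * X)"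
    unfolding tangent_def
  proof
    fix \<phi> assume \<phi>: "\<phi> \<in> conditions n k \<alpha> Ms"
    note p = conditions_props[OF k Ms \<phi>]
    have "((\<lambda>s. \<phi> (X + s \<cdot>\<^sub>m V)) has_field_derivative 0) (at 0)"
      using t \<phi> by (simp add: tangent_def)
    from entry_smooth_deriv_diff[OF p(1) Xc V CX this deriv_along_orbit[OF p(2) solution_conditions[OF X(1) \<phi>] Xc C]]
    show "((\<lambda>s. \<phi> (X + s \<cdot>\<^sub>m (V - C * X))) has_field_derivative 0) (at 0)" by simp
  qed
  from nd[OF W W0 this] have Z: "V - C * X = 0\<^sub>m k n" .
  have "V = C * X"
  proof (rule eq_matI)
    fix i j assume ij: "i < dim_row (C * X)" "j < dim_col (C * X)"
    hence "(V - C * X) $$ (i, j) = 0" using Z CX C Xc by simp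
    thus "V $$ (i, j) = (C * X) $$ (i, j)" using ij V CX by (simp del: index_mult_mat(1))
  qed (use V C Xc in auto)
  thus "\<exists>C\<in>carrier_mat k k. V = C * X" using C by blast
qed

text \<open>Nondegeneracy survives row operations, so any chart containing the point can witness
  transversality.\<close>

lemma transverse_atI:
  assumes k: "k \<le> n" and Ms: "\<forall>M\<in>set Ms. M \<in> carrier_mat (n - k) n"
    and X: "full_rank n k X" and nd: "nondegenerate n k \<alpha> Ms X"
  shows "transverse_at n k \<alpha> Ms (rowspace X)"
proof -
  note Xc = full_rankD(1)[OF X]
  obtain \<gamma> where \<gamma>: "\<gamma> \<in> kset n k" "plucker X \<gamma> \<noteq> 0" using full_rankD(2)[OF X] by blast
  obtain G where G: "G \<in> carrier_mat k k" "det G \<noteq> 0" "cols_of (G * X) \<gamma> = 1\<^sub>m k"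
    using chart_rep[OF Xc \<gamma>] by metis
  have GX: "G * X \<in> carrier_mat k n" using G Xc by simp
  note nd' = nondegenerate_mult[OF k Ms Xc nd G(1,2)]
  show ?thesis
    unfolding transverse_at_def
  proof (intro bexI[OF _ \<gamma>(1)] exI[of _ "G * X"] conjI ballI impI)
    show "rowspace (G * X) = rowspace X" by (rule rowspace_mult[OF G(1,2) Xc])
    fix V :: "complex mat" assume V: "V \<in> carrier_mat k n"
    assume a: "cols_of V \<gamma> = 0\<^sub>m k k \<and>
      (\<forall>\<beta>\<in>kset n k. \<not> bruhat_le \<beta> \<alpha> \<longrightarrow> ((\<lambda>s. plucker (G * X + s \<cdot>\<^sub>m V) \<beta>) has_field_derivative 0) (at 0)) \<and>
      (\<forall>M\<in>set Ms. ((\<lambda>s. det ((G * X + s \<cdot>\<^sub>m V) @\<^sub>r M)) has_field_derivative 0) (at 0))"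
    hence "tangent n k \<alpha> Ms (G * X) V" unfolding tangent_iff by blast
    thus "V = 0\<^sub>m k n" using nondegenerate_chartD[OF GX G(3) \<gamma>(1) nd' V] a by blast
  qed (use GX G in auto)
qed

section \<open>Subsequences and convergence of matrices\<close>

text \<open>Coordinates are treated one at a time, each refinement keeping the earlier limits; real
  and imaginary parts converge along monotone subsequences.\<close>

lemma finite_bounded_subsequence:
  fixes x :: "nat \<Rightarrow> 'i \<Rightarrow> complex"
  assumes "finite I" "\<And>m i. i \<in> I \<Longrightarrow> cmod (x m i) \<le> C"
  shows "\<exists>r l. strict_mono (r :: nat \<Rightarrow> nat) \<and> (\<forall>i\<in>I. (\<lambda>m. x (r m) i) \<longlonglongrightarrow> l i)"
  using assms
proof (induction I rule: finite_induct)
  case empty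
  show ?case by (rule exI[of _ id]) (auto simp: strict_mono_def)
next
  case (insert a I)
  have real: "\<exists>s l. strict_mono (s :: nat \<Rightarrow> nat) \<and> (\<lambda>m. y (s m)) \<longlonglongrightarrow> l" if y: "\<And>m. \<bar>y m\<bar> \<le> C" for y :: "nat \<Rightarrow> real"
  proof -
    obtain s where s: "strict_mono s" "monoseq (\<lambda>m. y (s m))" using seq_monosub[of y] by blast
    have "Bseq (\<lambda>m. y (s m))" by (rule BseqI'[of _ C]) (use y in simp)
    hence "convergent (\<lambda>m. y (s m))" using s(2) by (rule Bseq_monoseq_convergent)
    thus ?thesis using s(1) unfolding convergent_def by blast
  qed
  obtain r l where r: "strict_mono (r :: nat \<Rightarrow> nat)" "\<And>i. i \<in> I \<Longrightarrow> (\<lambda>m. x (r m) i) \<longlonglongrightarrow> l i"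
    using insert by blast
  have "\<bar>Re (x (r m) a)\<bar> \<le> C" for m using abs_Re_le_cmod order_trans insert.prems by blast
  then obtain s1 l1 where s1: "strict_mono (s1 :: nat \<Rightarrow> nat)" "(\<lambda>m. Re (x (r (s1 m)) a)) \<longlonglongrightarrow> l1"
    using real[of "\<lambda>m. Re (x (r m) a)"] by blast
  have "\<bar>Im (x (r (s1 m)) a)\<bar> \<le> C" for m using abs_Im_le_cmod order_trans insert.prems by blast
  then obtain s2 l2 where s2: "strict_mono (s2 :: nat \<Rightarrow> nat)" "(\<lambda>m. Im (x (r (s1 (s2 m))) a)) \<longlonglongrightarrow> l2"
    using real[of "\<lambda>m. Im (x (r (s1 m)) a)"] by blast
  define q where "q = (\<lambda>m. s1 (s2 m))"
  have q: "strict_mono q" using strict_mono_o[OF s1(1) s2(1)] by (simp add: q_def o_def)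
  have "(\<lambda>m. Re (x (r (q m)) a)) \<longlonglongrightarrow> l1"
    using LIMSEQ_subseq_LIMSEQ[OF s1(2) s2(1)] by (simp add: q_def o_def)
  moreover have "(\<lambda>m. Im (x (r (q m)) a)) \<longlonglongrightarrow> l2" using s2(2) by (simp add: q_def)
  ultimately have la: "(\<lambda>m. x (r (q m)) a) \<longlonglongrightarrow> Complex l1 l2"
    by (intro tendsto_complex_iff[THEN iffD2]) auto
  have li: "(\<lambda>m. x (r (q m)) i) \<longlonglongrightarrow> l i" if "i \<in> I" for i
    using LIMSEQ_subseq_LIMSEQ[OF r(2)[OF that] q] by (simp add: o_def)
  show ?case
    using la li insert.hyps(2) strict_mono_o[OF r(1) q, unfolded o_def]
    by (intro exI[of _ "r \<circ> q"] exI[of _ "l(a := Complex l1 l2)"]) auto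
qed

definition mat_tendsto :: "nat \<Rightarrow> nat \<Rightarrow> (nat \<Rightarrow> complex mat) \<Rightarrow> complex mat \<Rightarrow> bool" where
  "mat_tendsto r c X L \<longleftrightarrow> (\<forall>m. X m \<in> carrier_mat r c) \<and> L \<in> carrier_mat r c \<and>
     (\<forall>i<r. \<forall>j<c. (\<lambda>m. X m $$ (i, j)) \<longlonglongrightarrow> L $$ (i, j))"

definition near :: "nat \<Rightarrow> nat \<Rightarrow> real \<Rightarrow> complex mat \<Rightarrow> complex mat \<Rightarrow> bool" where
  "near r c e X Y \<longleftrightarrow> (\<forall>i<r. \<forall>j<c. cmod (X $$ (i, j) - Y $$ (i, j)) \<le> e)"

lemma mat_tendsto_det:
  assumes "mat_tendsto n n A L"
  shows "(\<lambda>m. det (A m)) \<longlonglongrightarrow> det L"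
proof -
  have c: "A m \<in> carrier_mat n n" "L \<in> carrier_mat n n" for m using assms by (auto simp: mat_tendsto_def)
  have "(\<lambda>m. \<Sum>p\<in>{p. p permutes {0..<n}}. signof p * (\<Prod>i = 0..<n. A m $$ (i, p i)))
      \<longlonglongrightarrow> (\<Sum>p\<in>{p. p permutes {0..<n}}. signof p * (\<Prod>i = 0..<n. L $$ (i, p i)))"
    using assms by (intro tendsto_sum tendsto_mult tendsto_const tendsto_prod)
      (auto simp: mat_tendsto_def permutes_in_image)
  thus ?thesis by (simp add: det_def'[OF c(1)] det_def'[OF c(2)])
qed

lemma mat_tendsto_cols:
  assumes X: "mat_tendsto k n X L" and \<gamma>: "\<gamma> \<in> kset n k"
  shows "mat_tendsto k k (\<lambda>m. cols_of (X m) \<gamma>) (cols_of L \<gamma>)"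
proof -
  have c: "X m \<in> carrier_mat k n" "L \<in> carrier_mat k n" for m using X by (auto simp: mat_tendsto_def)
  have "(\<lambda>m. cols_of (X m) \<gamma> $$ (i, j)) \<longlonglongrightarrow> cols_of L \<gamma> $$ (i, j)" if "i < k" "j < k" for i j
  proof -
    have "seq \<gamma> ! j - 1 < n" using seq_mem[OF \<gamma> that(2)] by simp
    thus ?thesis
      using X that unfolding cols_of_index[OF c(1) \<gamma> that] cols_of_index[OF c(2) \<gamma> that] mat_tendsto_def by blast
  qed
  thus ?thesis using cols_of_carrier[OF c(1) \<gamma>] cols_of_carrier[OF c(2) \<gamma>] by (auto simp: mat_tendsto_def)
qed

lemma mat_tendsto_plucker:
  "mat_tendsto k n X L \<Longrightarrow> \<gamma> \<in> kset n k \<Longrightarrow> (\<lambda>m. plucker (X m) \<gamma>) \<longlonglongrightarrow> plucker L \<gamma>"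
  unfolding plucker_def by (rule mat_tendsto_det[OF mat_tendsto_cols])

lemma mat_tendsto_append:
  assumes k: "k \<le> n" and X: "mat_tendsto k n X L" and M: "M \<in> carrier_mat (n - k) n"
  shows "(\<lambda>m. det (X m @\<^sub>r M)) \<longlonglongrightarrow> det (L @\<^sub>r M)"
proof (rule mat_tendsto_det)
  have c: "X m \<in> carrier_mat k n" "L \<in> carrier_mat k n" for m using X by (auto simp: mat_tendsto_def)
  have "(\<lambda>m. (X m @\<^sub>r M) $$ (i, j)) \<longlonglongrightarrow> (L @\<^sub>r M) $$ (i, j)" if "i < n" "j < n" for i j
    using X that k append_rows_index[OF c(1) M, of i j] append_rows_index[OF c(2) M, of i j]
    by (cases "i < k") (auto simp: mat_tendsto_def)
  thus "mat_tendsto n n (\<lambda>m. X m @\<^sub>r M) (L @\<^sub>r M)"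
    using append_rows_square[OF k c(1) M] append_rows_square[OF k c(2) M] by (auto simp: mat_tendsto_def)
qed

lemma replace_col_carrier:
  assumes "A \<in> carrier_mat r c" shows "replace_col A b i \<in> carrier_mat r c"
  unfolding replace_col_def carrier_matD[OF assms] by (rule mat_carrier)

lemma mat_tendsto_chart_rep:
  assumes X: "mat_tendsto k n X L" and \<gamma>: "\<gamma> \<in> kset n k" and p: "plucker L \<gamma> \<noteq> 0"
  shows "mat_tendsto k n (\<lambda>m. chart_rep n k \<gamma> (X m)) (chart_rep n k \<gamma> L)"
  unfolding mat_tendsto_def
proof (intro conjI allI impI)
  have c: "X m \<in> carrier_mat k n" "L \<in> carrier_mat k n" for m using X by (auto simp: mat_tendsto_def)
  note C = mat_tendsto_cols[OF X \<gamma>]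
  fix i j assume ij: "i < k" "j < n"
  have "mat_tendsto k k (\<lambda>m. replace_col (cols_of (X m) \<gamma>) (col (X m) j) i) (replace_col (cols_of L \<gamma>) (col L j) i)"
    unfolding mat_tendsto_def
  proof (intro conjI allI impI)
    fix r s assume rs: "r < k" "s < k"
    show "(\<lambda>m. replace_col (cols_of (X m) \<gamma>) (col (X m) j) i $$ (r, s))
        \<longlonglongrightarrow> replace_col (cols_of L \<gamma>) (col L j) i $$ (r, s)"
    proof (cases "s = i")
      case True
      hence "replace_col (cols_of Y \<gamma>) (col Y j) i $$ (r, s) = Y $$ (r, j)" if "Y \<in> carrier_mat k n" for Y :: "complex mat"
        using cols_of_carrier[OF that \<gamma>] rs ij that by (auto simp: replace_col_def)
      thus ?thesis using X rs ij c by (simp add: mat_tendsto_def)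
    next
      case False
      hence "replace_col (cols_of Y \<gamma>) (col Y j) i $$ (r, s) = cols_of Y \<gamma> $$ (r, s)" if "Y \<in> carrier_mat k n" for Y :: "complex mat"
        using cols_of_carrier[OF that \<gamma>] rs ij that by (auto simp: replace_col_def)
      thus ?thesis using C rs c by (simp add: mat_tendsto_def)
    qed
  qed (rule replace_col_carrier cols_of_carrier c \<gamma>)+
  from tendsto_divide[OF mat_tendsto_det[OF this] mat_tendsto_plucker[OF X \<gamma>] p]
  show "(\<lambda>m. chart_rep n k \<gamma> (X m) $$ (i, j)) \<longlonglongrightarrow> chart_rep n k \<gamma> L $$ (i, j)"
    using ij by (simp add: chart_rep_def)
qed (auto simp: chart_rep_def)

section \<open>Complex conjugation of solutions\<close>

lemma cols_of_map:
  assumes that: "X \<in> carrier_mat k n" "\<gamma> \<in> kset n m"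
  shows "cols_of (map_mat f X) \<gamma> = map_mat f (cols_of X \<gamma>)"
proof (rule eq_matI)
  have fX: "map_mat f X \<in> carrier_mat k n" using that by simp
  note c = cols_of_carrier[OF that]
  fix i j assume "i < dim_row (map_mat f (cols_of X \<gamma>))" "j < dim_col (map_mat f (cols_of X \<gamma>))"
  hence ij: "i < k" "j < m" using c by auto
  have "seq \<gamma> ! j - 1 < n" using seq_mem[OF that(2) ij(2)] by simp
  thus "cols_of (map_mat f X) \<gamma> $$ (i, j) = map_mat f (cols_of X \<gamma>) $$ (i, j)"
    using ij c that(1) by (simp add: cols_of_index[OF fX that(2)] cols_of_index[OF that])
qed (use cols_of_carrier[OF that] cols_of_carrier[of "map_mat f X" k n \<gamma> m] that in auto)

lemma plucker_map:
  assumes "comm_ring_hom f" "X \<in> carrier_mat k n" "\<gamma> \<in> kset n k"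
  shows "plucker (map_mat f X) \<gamma> = f (plucker X \<gamma>)"
  unfolding plucker_def cols_of_map[OF assms(2,3)] by (rule comm_ring_hom.hom_det[OF assms(1)])

lemma cnj_hom: "comm_ring_hom cnj"
  by unfold_locales auto

lemma of_real_complex_hom: "comm_ring_hom complex_of_real"
  by unfold_locales auto

lemma solution_cnj:
  assumes k: "k \<le> n" and Ms: "\<forall>M\<in>set Ms. M \<in> carrier_mat (n - k) n \<and> map_mat cnj M = M"
    and X: "solution n k \<alpha> Ms X"
  shows "solution n k \<alpha> Ms (map_mat cnj X)"
proof -
  note Xc = solutionD[OF X]
  have c: "map_mat cnj X \<in> carrier_mat k n" using Xc by simp
  have "meets (map_mat cnj X) M" if "M \<in> set Ms" for M
  proof -
    have M: "M \<in> carrier_mat (n - k) n" "map_mat cnj M = M" using Ms that by auto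
    have "map_mat cnj X @\<^sub>r M = map_mat cnj (X @\<^sub>r M)"
    proof (rule eq_matI)
      note d = append_rows_square[OF k Xc M(1)]
      fix i j assume "i < dim_row (map_mat cnj (X @\<^sub>r M))" "j < dim_col (map_mat cnj (X @\<^sub>r M))"
      hence ij: "i < n" "j < n" using d by auto
      have "cnj (M $$ (i - k, j)) = M $$ (i - k, j)" if "\<not> i < k"
      proof -
        have "map_mat cnj M $$ (i - k, j) = cnj (M $$ (i - k, j))" using that ij M(1) k by simp
        thus ?thesis unfolding M(2) by simp
      qed
      thus "(map_mat cnj X @\<^sub>r M) $$ (i, j) = map_mat cnj (X @\<^sub>r M) $$ (i, j)"
        using ij k d Xc append_rows_index[OF c M(1), of i j] append_rows_index[OF Xc M(1), of i j] by simp
    qed (use append_rows_square[OF k c M(1)] append_rows_square[OF k Xc M(1)] in auto)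
    hence "det (map_mat cnj X @\<^sub>r M) = cnj (det (X @\<^sub>r M))"
      by (simp add: comm_ring_hom.hom_det[OF cnj_hom])
    thus ?thesis using X that by (simp add: solution_def meets_def)
  qed
  thus ?thesis using X c Xc unfolding solution_def full_rank_def in_Omega_alpha_def
    by (auto simp: plucker_map[OF cnj_hom Xc])
qed

subsection \<open>Deforming a point as the torus parameter leaves 0\<close>

text \<open>Turns a claim for all small parameters into a contradiction along a null sequence, to
  which subsequence arguments apply.\<close>

lemma eventually_at_right_0_by_sequences:
  fixes P :: "real \<Rightarrow> bool"
  assumes "\<And>\<tau> :: nat \<Rightarrow> real. (\<And>m. \<tau> m > 0) \<Longrightarrow> \<tau> \<longlonglongrightarrow> 0 \<Longrightarrow> (\<And>m. \<not> P (\<tau> m)) \<Longrightarrow> False"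
  shows "eventually P (at_right 0)"
proof (rule ccontr)
  assume "\<not> eventually P (at_right 0)"
  hence "\<forall>b>0. \<exists>t>0. t < b \<and> \<not> P t" by (auto simp: eventually_at_right_field)
  hence "\<exists>t. t > 0 \<and> t < inverse (real (Suc m)) \<and> \<not> P t" for m by simp
  then obtain \<tau> where \<tau>: "\<And>m. \<tau> m > 0" "\<And>m. \<tau> m < inverse (real (Suc m))" "\<And>m. \<not> P (\<tau> m)"
    by metis
  have "\<tau> \<longlonglongrightarrow> 0"
    by (rule tendsto_sandwich[OF _ _ tendsto_const LIMSEQ_inverse_real_of_nat])
      (use \<tau>(1,2) in \<open>auto intro!: always_eventually less_imp_le simp del: of_nat_Suc\<close>)
  thus False using assms[of \<tau>] \<tau> by blast
qed

text \<open>Parametrises \<Omega>_\<alpha> in the chart \<beta>. Arguments outside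
  \<open>free_pos\<close> are ignored, so the entries of a full matrix can be passed as
  coordinates.\<close>

definition schubert_chart :: "nat \<Rightarrow> nat \<Rightarrow> nat set \<Rightarrow> nat set \<Rightarrow> (nat \<times> nat \<Rightarrow> complex) \<Rightarrow> complex mat" where
  "schubert_chart n k \<beta> \<alpha> x = mat k n (\<lambda>(i, c).
     if Suc c \<in> \<beta> then (if Suc c = seq \<beta> ! i then 1 else 0)
     else if (i, c) \<in> free_pos n k \<beta> \<alpha> then x (i, c) else 0)"

lemma schubert_chart_carrier: "schubert_chart n k \<beta> \<alpha> x \<in> carrier_mat k n"
  by (simp add: schubert_chart_def)

lemma schubert_chart_index:
  "i < k \<Longrightarrow> c < n \<Longrightarrow> schubert_chart n k \<beta> \<alpha> x $$ (i, c) =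
     (if Suc c \<in> \<beta> then (if Suc c = seq \<beta> ! i then 1 else 0)
     else if (i, c) \<in> free_pos n k \<beta> \<alpha> then x (i, c) else 0)"
  by (simp add: schubert_chart_def)

lemma schubert_chart_cols:
  assumes \<beta>: "\<beta> \<in> kset n k"
  shows "cols_of (schubert_chart n k \<beta> \<alpha> x) \<beta> = 1\<^sub>m k"
proof (rule eq_matI)
  note c = cols_of_carrier[OF schubert_chart_carrier \<beta>]
  fix i j assume "i < dim_row (1\<^sub>m k :: complex mat)" "j < dim_col (1\<^sub>m k :: complex mat)"
  hence ij: "i < k" "j < k" by auto
  note s = seq_mem[OF \<beta> ij(2)]
  have "Suc (seq \<beta> ! j - 1) = seq \<beta> ! j" using s(2) by simp
  moreover have "seq \<beta> ! j - 1 < n" using s by simp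
  ultimately show "cols_of (schubert_chart n k \<beta> \<alpha> x) \<beta> $$ (i, j) = 1\<^sub>m k $$ (i, j)"
    unfolding cols_of_index[OF schubert_chart_carrier \<beta> ij]
    using ij s(1) seq_inj[OF \<beta> ij] by (subst schubert_chart_index) auto
qed (use cols_of_carrier[OF schubert_chart_carrier[of n k \<beta> \<alpha> x] \<beta>] in auto)

lemma schubert_chart_support:
  assumes le: "\<And>i. i < k \<Longrightarrow> seq \<beta> ! i \<le> seq \<alpha> ! i" and i: "i < k" "c < n" "seq \<alpha> ! i < Suc c"
  shows "schubert_chart n k \<beta> \<alpha> x $$ (i, c) = 0"
  using le[OF i(1)] i by (subst schubert_chart_index) (auto simp: free_pos_def)

lemma schubert_chart_surj:
  assumes X: "X \<in> carrier_mat k n" "cols_of X \<beta> = 1\<^sub>m k" and \<beta>: "\<beta> \<in> kset n k" and \<alpha>: "\<alpha> \<in> kset n k"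
    and le: "bruhat_le \<beta> \<alpha>" "wt \<alpha> \<le> Suc (wt \<beta>)" and O: "in_Omega_alpha n k \<alpha> X"
  shows "schubert_chart n k \<beta> \<alpha> (\<lambda>ic. X $$ ic) = X"
proof (rule eq_matI)
  fix i c assume "i < dim_row X" "c < dim_col X"
  hence ic: "i < k" "c < n" using X by auto
  show "schubert_chart n k \<beta> \<alpha> (\<lambda>ic. X $$ ic) $$ (i, c) = X $$ (i, c)"
  proof (cases "Suc c \<in> \<beta> \<or> (i, c) \<in> free_pos n k \<beta> \<alpha>")
    case True
    thus ?thesis using chart_entry[OF X \<beta> ic] by (auto simp: schubert_chart_index[OF ic])
  next
    case False
    hence "seq \<alpha> ! i < Suc c" using ic by (auto simp: free_pos_def)
    thus ?thesis using False chart_zero[OF X \<beta> \<alpha> le O ic] by (simp add: schubert_chart_index[OF ic])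
  qed
qed (use X in \<open>auto simp: schubert_chart_def\<close>)

text \<open>Lines in coordinates are lines of matrices, so derivatives in the unknowns are
  derivatives along tangent vectors.\<close>

lemma schubert_chart_line:
  assumes "V = mat k n (\<lambda>ic. if ic \<in> free_pos n k \<beta> \<alpha> then v ic else 0)"
  shows "schubert_chart n k \<beta> \<alpha> (\<lambda>ic. x ic + s * v ic) = schubert_chart n k \<beta> \<alpha> x + s \<cdot>\<^sub>m V"
  unfolding assms
  by (rule eq_matI) (auto simp: schubert_chart_def free_pos_def)

lemma sdiff_schubert_chart_entry:
  assumes "i < k" "c < n"
  shows "sdiff (insert None (Some ` free_pos n k \<beta> \<alpha>)) p
    (\<lambda>y. schubert_chart n k \<beta> \<alpha> (\<lambda>j. y (Some j)) $$ (i, c))"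
  using assms finite_free_pos[of n k \<beta> \<alpha>]
  by (cases "Suc c \<in> \<beta>"; cases "(i, c) \<in> free_pos n k \<beta> \<alpha>"; cases "Suc c = seq \<beta> ! i")
    (auto simp: schubert_chart_index intro!: sdiff_const sdiff_coord)

section \<open>Degeneration for a fixed subspace\<close>

locale transverse_subspace =
  fixes n k :: nat and B :: "real mat"
  assumes k0: "0 < k" and kn: "k < n"
    and B: "B \<in> carrier_mat (n - k) n"
    and nz: "\<forall>\<gamma> \<in> kset n (n - k). plucker B \<gamma> \<noteq> 0"
begin

lemma kn': "k \<le> n"
  using kn by simp

definition M :: "real \<Rightarrow> complex mat" where
  "M t = map_mat complex_of_real (tact t B)"

definition BC :: "complex mat" where
  "BC = map_mat complex_of_real B"

lemma BC: "BC \<in> carrier_mat (n - k) n"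
  using B by (simp add: BC_def)

lemma M_eq: "M t = tact (complex_of_real t) BC"
  unfolding M_def BC_def tact_def by (rule eq_matI) auto

lemma M_carrier: "M t \<in> carrier_mat (n - k) n"
  using B by (simp add: M_def tact_def)

lemma M_cnj: "map_mat cnj (M t) = M t"
  unfolding M_def by (rule eq_matI) auto

lemma det_pivot: "\<alpha> \<in> kset n k \<Longrightarrow> det (pivot_mat n k \<alpha> @\<^sub>r BC) \<noteq> 0"
  by (rule det_pivot_append[OF kn' BC])
    (use nz plucker_map[OF of_real_complex_hom B] in \<open>auto simp: BC_def\<close>)

lemma meets_torus_scale:
  assumes "t \<noteq> 0" "X \<in> carrier_mat k n"
    "\<And>i c. i < k \<Longrightarrow> c < n \<Longrightarrow> seq \<alpha> ! i < Suc c \<Longrightarrow> X $$ (i, c) = 0"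
  shows "meets X (M t) \<longleftrightarrow> det (torus_scale n k \<alpha> (complex_of_real t) X @\<^sub>r BC) = 0"
  using det_torus_scale[OF kn' BC, of "complex_of_real t", OF _ assms(2,3)] assms(1)
    torus_factor_nonzero[of "complex_of_real t"] by (simp add: meets_def M_eq)

text \<open>For positive parameters the condition may be replaced by its rescaled form, which is
  continuous at parameter 0. There it reads p_\<alpha> = 0 up to a nonzero factor, so a limit of
  solutions leaves the open cell of \<alpha>.\<close>

lemma torus_limit:
  assumes \<alpha>: "\<alpha> \<in> kset n k" and \<tau>: "\<And>m. \<tau> m > 0" "\<tau> \<longlonglongrightarrow> 0" and Y: "mat_tendsto k n Y L"
    and supp: "\<And>m i c. i < k \<Longrightarrow> c < n \<Longrightarrow> seq \<alpha> ! i < Suc c \<Longrightarrow> Y m $$ (i, c) = 0"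
    and meet: "\<And>m. meets (Y m) (M (\<tau> m))"
  shows "(\<Prod>i<k. L $$ (i, seq \<alpha> ! i - 1)) = 0"
proof -
  let ?S = "\<lambda>m. torus_scale n k \<alpha> (complex_of_real (\<tau> m)) (Y m)"
  have c: "Y m \<in> carrier_mat k n" "L \<in> carrier_mat k n" for m using Y by (auto simp: mat_tendsto_def)
  have zero: "det (?S m @\<^sub>r BC) = 0" for m
    using meets_torus_scale[of "\<tau> m" "Y m" \<alpha>, OF _ c(1) supp] \<tau>(1)[of m] meet[of m] by simp
  have tau: "(\<lambda>m. complex_of_real (\<tau> m)) \<longlonglongrightarrow> 0"
    using tendsto_of_real[OF \<tau>(2)] by simp
  have "mat_tendsto k n ?S (torus_scale n k \<alpha> 0 L)"
    unfolding mat_tendsto_def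
  proof (intro conjI allI impI)
    fix i j assume "i < k" "j < n"
    thus "(\<lambda>m. ?S m $$ (i, j)) \<longlonglongrightarrow> torus_scale n k \<alpha> 0 L $$ (i, j)"
      using Y by (auto simp: torus_scale_def mat_tendsto_def intro!: tendsto_mult tendsto_power tau)
  qed (auto simp: torus_scale_def)
  from mat_tendsto_append[OF kn' this BC] have "det (torus_scale n k \<alpha> 0 L @\<^sub>r BC) = 0"
    unfolding zero by (simp add: LIMSEQ_const_iff)
  moreover have "L $$ (i, c) = 0" if "i < k" "c < n" "seq \<alpha> ! i < Suc c" for i c
  proof -
    have "(\<lambda>m. Y m $$ (i, c)) \<longlonglongrightarrow> L $$ (i, c)" using Y that by (auto simp: mat_tendsto_def)
    thus ?thesis using supp[OF that] by (simp add: LIMSEQ_const_iff)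
  qed
  ultimately show ?thesis using det_torus_scale_0[OF kn' BC \<alpha> c(2)] det_pivot[OF \<alpha>] by auto
qed

text \<open>Apply \<open>torus_limit\<close> to a constant sequence, normalised in the cell that
  contains the point: all pivots are 1 there, so their product cannot vanish.\<close>

lemma eventually_not_meets:
  assumes X: "full_rank n k X"
  shows "\<forall>\<^sub>F t in at_right 0. \<not> meets X (M t)"
proof (rule eventually_at_right_0_by_sequences)
  fix \<tau> :: "nat \<Rightarrow> real" assume \<tau>: "\<And>m. \<tau> m > 0" "\<tau> \<longlonglongrightarrow> 0" and m: "\<And>m. \<not> \<not> meets X (M (\<tau> m))"
  obtain \<delta> where \<delta>: "\<delta> \<in> kset n k" "plucker X \<delta> \<noteq> 0" "in_Omega_alpha n k \<delta> X"
    using exists_schubert_cell[OF X] .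
  note Xc = full_rankD(1)[OF X]
  obtain G where G: "G \<in> carrier_mat k k" "det G \<noteq> 0" "cols_of (G * X) \<delta> = 1\<^sub>m k"
    using chart_rep[OF Xc \<delta>(1,2)] by metis
  have GX: "G * X \<in> carrier_mat k n" using G Xc by simp
  have O: "in_Omega_alpha n k \<delta> (G * X)" by (rule in_Omega_mult[OF Xc G(1) \<delta>(3)])
  have "(\<Prod>i<k. (G * X) $$ (i, seq \<delta> ! i - 1)) = 0"
  proof (rule torus_limit[OF \<delta>(1) \<tau>])
    show "mat_tendsto k n (\<lambda>m. G * X) (G * X)" unfolding mat_tendsto_def using GX by auto
    show "meets (G * X) (M (\<tau> m))" for m using meets_mult[OF kn' Xc G(1) M_carrier] m by blast
    show "(G * X) $$ (i, c) = 0" if "i < k" "c < n" "seq \<delta> ! i < Suc c" for i c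
      by (rule chart_zero[OF GX G(3) \<delta>(1) \<delta>(1) bruhat_refl _ O that]) simp
  qed
  then obtain i where i: "i < k" "(G * X) $$ (i, seq \<delta> ! i - 1) = 0" by auto
  have "(G * X) $$ (i, seq \<delta> ! i - 1) = 1\<^sub>m k $$ (i, i)"
    using cols_of_index[OF GX \<delta>(1) i(1) i(1)] G(3) by simp
  thus False using i by simp
qed

lemma solution_append:
  "solution n k \<alpha> (Ms @ [N]) X \<longleftrightarrow> solution n k \<alpha> Ms X \<and> meets X N"
  by (auto simp: solution_def)

lemma solution_limit:
  assumes X: "mat_tendsto k n X L" and L: "full_rank n k L"
    and Ms: "\<forall>N\<in>set Ms. N \<in> carrier_mat (n - k) n" and s: "\<And>m. solution n k \<alpha> Ms (X m)"
  shows "solution n k \<alpha> Ms L"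
proof -
  have "plucker L \<beta> = 0" if "\<beta> \<in> kset n k" "\<not> bruhat_le \<beta> \<alpha>" for \<beta>
  proof -
    have "plucker (X m) \<beta> = 0" for m using s[of m] that by (auto simp: solution_def in_Omega_alpha_def)
    thus ?thesis using mat_tendsto_plucker[OF X that(1)] by (simp add: LIMSEQ_const_iff)
  qed
  moreover have "meets L N" if "N \<in> set Ms" for N
  proof -
    have "det (X m @\<^sub>r N) = 0" for m using s[of m] that by (auto simp: solution_def meets_def)
    thus ?thesis using mat_tendsto_append[OF kn' X, of N] Ms that by (simp add: LIMSEQ_const_iff meets_def)
  qed
  ultimately show ?thesis using L by (auto simp: solution_def in_Omega_alpha_def)
qed

text \<open>Two radii of opposite use: \<open>e\<close> is prescribed and says how close the new
  solution is, while \<open>\<rho>\<close> is found later and says how far uniqueness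
  reaches.\<close>

definition deformation :: "nat set \<Rightarrow> complex mat list \<Rightarrow> nat set \<times> complex mat \<Rightarrow> real \<Rightarrow> real \<Rightarrow> complex mat \<Rightarrow> bool" where
  "deformation \<alpha> Ms p e \<rho> X \<longleftrightarrow> solution n k \<alpha> Ms X \<and> cols_of X (fst p) = 1\<^sub>m k \<and>
    nondegenerate n k \<alpha> Ms X \<and> map_mat cnj X = X \<and> near k n e X (snd p) \<and>
    (\<forall>Y. solution n k \<alpha> Ms Y \<longrightarrow> cols_of Y (fst p) = 1\<^sub>m k \<longrightarrow> near k n \<rho> Y (snd p) \<longrightarrow> Y = X)"

text \<open>Inverse functions in the chart \<beta>, with the free entries of \<Omega>_\<alpha> as
  unknowns and \<open>t\<close> as parameter. At parameter 0 the solution is \<open>X0\<close>, and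
  the derivative there is injective because \<open>X0\<close> is nondegenerate on
  \<Omega>_\<beta>.\<close>

lemma local_solution:
  assumes \<beta>: "\<beta> \<in> kset n k" and \<alpha>: "\<alpha> \<in> kset n k" and cov: "covers_at k j \<beta> \<alpha>"
    and len: "length Ms = wt \<beta>"
    and Ms: "\<forall>N\<in>set Ms. N \<in> carrier_mat (n - k) n \<and> map_mat cnj N = N"
    and X0: "solution n k \<beta> Ms X0" "cols_of X0 \<beta> = 1\<^sub>m k" "nondegenerate n k \<beta> Ms X0" "map_mat cnj X0 = X0"
    and r0: "r0 > 0"
  shows "\<exists>\<rho>>0. \<forall>\<^sub>F t in at_right 0. \<exists>X. deformation \<alpha> (Ms @ [M t]) (\<beta>, X0) r0 \<rho> X"
proof -
  let ?J = "free_pos n k \<beta> \<alpha>" and ?I = "insert None (Some ` free_pos n k \<beta> \<alpha>)"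
  let ?ch = "schubert_chart n k \<beta> \<alpha>"
  define N where "N = Suc (wt \<beta>)"
  have finJ: "finite ?J" by (rule finite_free_pos)
  have cardJ: "card ?J = N" unfolding N_def by (rule card_free_pos_cover[OF \<beta> \<alpha> cov])
  have le: "bruhat_le \<beta> \<alpha>" by (rule covers_at_le[OF \<alpha> cov])
  have le': "seq \<beta> ! i \<le> seq \<alpha> ! i" if "i < k" for i using le that bruhat_le_iff[OF \<alpha>] by blast
  have wa: "wt \<alpha> \<le> Suc (wt \<beta>)"
    using wt_cover[of n k \<beta> \<alpha>] bruhat_cover_iff \<beta> \<alpha> cov by (metis order_refl)
  have jk: "j < k" and \<alpha>j: "seq \<alpha> ! j = Suc (seq \<beta> ! j)"
    and \<alpha>i: "\<And>i. i < k \<Longrightarrow> i \<noteq> j \<Longrightarrow> seq \<alpha> ! i = seq \<beta> ! i"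
    using cov by (auto simp: covers_at_def)
  have bn: "seq \<beta> ! j < n" using seq_mem(3)[OF \<alpha> jk] \<alpha>j by simp
  note X0c = solutionD[OF X0(1)]
  have X0\<beta>: "in_Omega_alpha n k \<beta> X0" using X0(1) by (simp add: solution_def)
  have X0\<alpha>: "in_Omega_alpha n k \<alpha> X0" by (rule in_Omega_mono[OF \<beta> \<alpha> le X0\<beta>])
  define q where "q = (\<lambda>ic. X0 $$ ic)"
  have chq: "?ch q = X0" unfolding q_def by (rule schubert_chart_surj[OF X0c X0(2) \<beta> \<alpha> le wa X0\<alpha>])
  \<comment> \<open>Indices below \<open>length Ms = wt \<beta>\<close> are the earlier conditions;
    index \<open>wt \<beta>\<close> is the new one in rescaled form, with the parameter in
    coordinate \<open>None\<close>, so that it makes sense at parameter 0.\<close>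
  define F where "F = (\<lambda>e (y :: (nat \<times> nat) option \<Rightarrow> complex).
    if e < length Ms then det (?ch (\<lambda>j. y (Some j)) @\<^sub>r Ms ! e)
    else det (torus_scale n k \<alpha> (y None) (?ch (\<lambda>j. y (Some j))) @\<^sub>r BC))"
  have F1: "F e (case_option t x) = det (?ch x @\<^sub>r Ms ! e)" if "e < length Ms" for e t x
    using that by (simp add: F_def)
  have F2: "F (wt \<beta>) (case_option t x) = det (torus_scale n k \<alpha> t (?ch x) @\<^sub>r BC)" for t x
    by (simp add: F_def len)
  have Mse: "Ms ! e \<in> carrier_mat (n - k) n" if "e < length Ms" for e using Ms that by auto
  have N_cases: "(\<forall>e<N. P e) \<longleftrightarrow> (\<forall>e<length Ms. P e) \<and> P (wt \<beta>)" for P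
    by (auto simp: N_def len less_Suc_eq)
  have chc: "?ch x \<in> carrier_mat k n" for x by (rule schubert_chart_carrier)
  have chs: "?ch x $$ (i, c) = 0" if "i < k" "c < n" "seq \<alpha> ! i < Suc c" for x i c
    by (rule schubert_chart_support[OF le' that])
  note ch\<beta> = schubert_chart_cols[OF \<beta>, of \<alpha>]
  have sdF: "\<exists>d. strict_deriv ?I (case_option 0 q) (F e) d" for e
  proof (cases "e < length Ms")
    case True
    have "sdiff ?I (case_option 0 q) (\<lambda>y. det (?ch (\<lambda>j. y (Some j)) @\<^sub>r Ms ! e))"
      using finJ by (intro sdiff_det_append[OF kn' Mse[OF True] _ chc] sdiff_schubert_chart_entry) auto
    thus ?thesis using True by (simp add: sdiff_def F_def)
  next
    case False
    have "sdiff ?I (case_option 0 q) (\<lambda>y. det (torus_scale n k \<alpha> (y None) (?ch (\<lambda>j. y (Some j))) @\<^sub>r BC))"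
    proof (rule sdiff_det_append[OF kn' BC])
      fix i c assume ic: "i < k" "c < n"
      have "sdiff ?I (case_option 0 q) (\<lambda>y. ?ch (\<lambda>j. y (Some j)) $$ (i, c) * y None ^ (seq \<alpha> ! i - Suc c))"
        using finJ by (intro sdiff_mult sdiff_power sdiff_coord sdiff_schubert_chart_entry ic) auto
      thus "sdiff ?I (case_option 0 q) (\<lambda>y. torus_scale n k \<alpha> (y None) (?ch (\<lambda>j. y (Some j))) $$ (i, c))"
        using ic by (simp add: torus_scale_def)
    qed (use finJ in \<open>auto simp: torus_scale_def\<close>)
    thus ?thesis using False by (simp add: sdiff_def F_def)
  qed
  then obtain d where d: "\<And>e. strict_deriv ?I (case_option 0 q) (F e) (d e)" by metis
  \<comment> \<open>In every row other than \<open>j\<close> the pivots of \<alpha> and \<beta>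
    coincide, so the entry is 1. Only the new coordinate in row \<open>j\<close> remains of the
    product.\<close>
  have torus0: "det (torus_scale n k \<alpha> 0 (?ch x) @\<^sub>r BC) = x (j, seq \<beta> ! j) * det (pivot_mat n k \<alpha> @\<^sub>r BC)" for x
  proof -
    have "(\<Prod>i<k. ?ch x $$ (i, seq \<alpha> ! i - 1)) = ?ch x $$ (j, seq \<alpha> ! j - 1) * (\<Prod>i\<in>{..<k} - {j}. ?ch x $$ (i, seq \<alpha> ! i - 1))"
      by (rule prod.remove) (use jk in auto)
    also have "(\<Prod>i\<in>{..<k} - {j}. ?ch x $$ (i, seq \<alpha> ! i - 1)) = 1"
    proof (rule prod.neutral, rule ballI)
      fix i assume "i \<in> {..<k} - {j}"
      hence i: "i < k" "i \<noteq> j" by auto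
      have "?ch x $$ (i, seq \<beta> ! i - 1) = 1\<^sub>m k $$ (i, i)"
        using cols_of_index[OF chc \<beta> i(1) i(1), of x] ch\<beta>[of x] by simp
      thus "?ch x $$ (i, seq \<alpha> ! i - 1) = 1" using i \<alpha>i[OF i] by simp
    qed
    also have "?ch x $$ (j, seq \<alpha> ! j - 1) = x (j, seq \<beta> ! j)"
      using covers_at_notin[OF \<beta> \<alpha> cov] free_pos_cover(1)[OF \<beta> \<alpha> cov] \<alpha>j
      by (simp add: schubert_chart_index[OF jk bn])
    finally show ?thesis using det_torus_scale_0[OF kn' BC \<alpha> chc chs] by simp
  qed
  have X0j: "X0 $$ (j, seq \<beta> ! j) = 0"
    by (rule chart_zero[OF X0c X0(2) \<beta> \<beta> bruhat_refl _ X0\<beta> jk bn]) auto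
  have zero: "F e (case_option 0 q) = 0" if "e < N" for e
  proof -
    have "\<forall>e<N. F e (case_option 0 q) = 0"
      unfolding N_cases F2 torus0 using X0(1) X0j[folded q_def]
      by (auto simp: F1 chq solution_def meets_def)
    thus ?thesis using that by blast
  qed
  have inj: "\<forall>ic\<in>?J. v ic = 0" if v: "\<And>e. e < N \<Longrightarrow> (\<Sum>ic\<in>?J. d e (Some ic) * v ic) = 0" for v
  proof -
    have deriv: "((\<lambda>s. F e (case_option 0 (\<lambda>ic. q ic + s * v ic))) has_field_derivative 0) (at 0)" if e: "e < N" for e
    proof -
      have "(\<Sum>i\<in>?I. d e i * case_option 0 v i) = 0"
        using finJ v[OF e] by (subst sum.insert) (auto simp: sum.reindex)
      moreover have "(\<lambda>i. case_option 0 q i + s * case_option 0 v i) = case_option 0 (\<lambda>ic. q ic + s * v ic)" for s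
        by (auto simp: fun_eq_iff split: option.split)
      ultimately show ?thesis
        using strict_deriv_has_field_derivative[OF _ d[of e], of "case_option 0 v"] finJ by simp
    qed
    \<comment> \<open>At parameter 0 the last equation is linear in the new coordinate, so it kills
      that component of \<open>v\<close>. What is left is a direction inside \<Omega>_\<beta>, to
      which nondegeneracy of \<open>X0\<close> applies.\<close>
    have "((\<lambda>s. s * (v (j, seq \<beta> ! j) * det (pivot_mat n k \<alpha> @\<^sub>r BC))) has_field_derivative 0) (at 0)"
      using deriv[of "wt \<beta>"] X0j by (simp add: N_def F2 torus0 q_def mult_ac)
    from DERIV_linear_eq_0[OF this] have vj: "v (j, seq \<beta> ! j) = 0" using det_pivot[OF \<alpha>] by simp
    define V where "V = mat k n (\<lambda>ic. if ic \<in> ?J then v ic else 0)"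
    have Vc: "V \<in> carrier_mat k n" by (simp add: V_def)
    have line: "X0 + s \<cdot>\<^sub>m V = ?ch (\<lambda>ic. q ic + s * v ic)" for s
      using schubert_chart_line[OF V_def] chq by simp
    have X0V: "X0 + s \<cdot>\<^sub>m V \<in> carrier_mat k n" for s using X0c Vc by simp
    have "in_Omega_alpha n k \<beta> (X0 + s \<cdot>\<^sub>m V)" for s
    proof (rule in_OmegaI[OF X0V \<beta>])
      fix i c assume ic: "i < k" "c < n" "seq \<beta> ! i < Suc c"
      have "X0 $$ (i, c) = 0" by (rule chart_zero[OF X0c X0(2) \<beta> \<beta> bruhat_refl _ X0\<beta> ic]) simp
      moreover have "V $$ (i, c) = 0"
      proof (cases "i = j \<and> c = seq \<beta> ! j")
        case True
        thus ?thesis using ic vj by (auto simp: V_def)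
      next
        case False
        hence "(i, c) \<notin> ?J" using ic(3) unfolding free_pos_cover(1)[OF \<beta> \<alpha> cov] by (auto simp: free_pos_def)
        thus ?thesis using ic by (simp add: V_def)
      qed
      ultimately show "(X0 + s \<cdot>\<^sub>m V) $$ (i, c) = 0" using X0c Vc ic by simp
    qed
    hence pl: "plucker (X0 + s \<cdot>\<^sub>m V) \<gamma> = 0" if "\<gamma> \<in> kset n k" "\<not> bruhat_le \<gamma> \<beta>" for s \<gamma>
      using that by (auto simp: in_Omega_alpha_def)
    have "((\<lambda>s. det ((X0 + s \<cdot>\<^sub>m V) @\<^sub>r Ms ! e)) has_field_derivative 0) (at 0)" if "e < length Ms" for e
      using deriv[of e] that by (simp add: N_def len F1 line)
    hence "((\<lambda>s. det ((X0 + s \<cdot>\<^sub>m V) @\<^sub>r L)) has_field_derivative 0) (at 0)" if "L \<in> set Ms" for L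
      using that by (metis in_set_conv_nth)
    hence "tangent n k \<beta> Ms X0 V"
      unfolding tangent_iff using pl by simp
    moreover have "cols_of V \<beta> = 0\<^sub>m k k"
    proof (rule eq_matI)
      fix i l assume "i < dim_row (0\<^sub>m k k :: complex mat)" "l < dim_col (0\<^sub>m k k :: complex mat)"
      hence il: "i < k" "l < k" by auto
      have "Suc (seq \<beta> ! l - 1) \<in> \<beta>" using seq_mem[OF \<beta> il(2)] by simp
      moreover have "seq \<beta> ! l - 1 < n" using seq_mem[OF \<beta> il(2)] by simp
      ultimately show "cols_of V \<beta> $$ (i, l) = 0\<^sub>m k k $$ (i, l)"
        unfolding cols_of_index[OF Vc \<beta> il] using il by (auto simp: V_def free_pos_def)
    qed (use cols_of_carrier[OF Vc \<beta>] in auto)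
    ultimately have V0: "V = 0\<^sub>m k n" using nondegenerate_chartD[OF X0c X0(2) \<beta> X0(3) Vc] by blast
    show ?thesis
    proof
      fix ic assume ic: "ic \<in> ?J"
      then obtain i c where [simp]: "ic = (i, c)" and "i < k" "c < n" by (auto simp: free_pos_def)
      hence "V $$ ic = v ic" using ic by (simp add: V_def)
      thus "v ic = 0" using V0 \<open>i < k\<close> \<open>c < n\<close> by simp
    qed
  qed
  have "\<exists>r>0. r \<le> r0 \<and> (\<exists>\<delta>>0. \<forall>t. cmod t < \<delta> \<longrightarrow> (\<exists>x. isolated_zero N F ?J q r t x))"
  proof (rule parametric_inverse_function[OF finJ cardJ, where d = d])
    show "strict_deriv ?I (case_option 0 q) (F e) (d e)" for e by (rule d)
    show "F e (case_option 0 q) = 0" if "e < N" for e by (rule zero[OF that])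
    show "\<forall>ic\<in>?J. v ic = 0" if "\<And>e. e < N \<Longrightarrow> (\<Sum>ic\<in>?J. d e (Some ic) * v ic) = 0" for v
      by (rule inj[OF that])
  qed (rule r0)
  then obtain r \<delta> where r: "r > 0" "r \<le> r0" and \<delta>: "\<delta> > 0"
    and sol: "\<And>t. cmod t < \<delta> \<Longrightarrow> \<exists>x. isolated_zero N F ?J q r t x"
    by blast
  \<comment> \<open>\<open>near\<close> bounds single entries, whereas uniqueness holds in a ball
    for the sum over the \<open>N\<close> free entries.\<close>
  define \<rho> where "\<rho> = r / (real N + 1)"
  have \<rho>: "\<rho> > 0" "real N * \<rho> \<le> r" using r(1) by (auto simp: \<rho>_def field_simps)
  show ?thesis
  proof (rule exI[of _ \<rho>], intro conjI \<rho>)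
    have "\<forall>\<^sub>F t :: real in at_right 0. 0 < t \<and> t < \<delta>"
      using \<delta> by (auto simp: eventually_at_right_field)
    thus "\<forall>\<^sub>F t in at_right 0. \<exists>X. deformation \<alpha> (Ms @ [M t]) (\<beta>, X0) r0 \<rho> X"
    proof (rule eventually_mono)
      fix t :: real assume t: "0 < t \<and> t < \<delta>"
      hence "cmod (complex_of_real t) < \<delta>" by simp
      from sol[OF this] obtain x where x: "isolated_zero N F ?J q r (complex_of_real t) x" ..
      have
        x1: "(\<Sum>j\<in>?J. cmod (x j - q j)) \<le> r" "\<forall>e<N. F e (case_option (complex_of_real t) x) = 0"
        and x2: "\<And>y. (\<Sum>j\<in>?J. cmod (y j - q j)) \<le> r \<Longrightarrow> \<forall>e<N. F e (case_option (complex_of_real t) y) = 0 \<Longrightarrow>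
           \<forall>j\<in>?J. y j = x j"
        and x3: "\<And>v. \<forall>e<N. ((\<lambda>s. F e (case_option (complex_of_real t) (\<lambda>j. x j + s * v j))) has_field_derivative 0) (at 0) \<Longrightarrow>
           \<forall>j\<in>?J. v j = 0" using x unfolding isolated_zero_def by blast+
      let ?Ms = "Ms @ [M t]"
      have Ms': "\<forall>N\<in>set ?Ms. N \<in> carrier_mat (n - k) n \<and> map_mat cnj N = N"
        using Ms M_carrier M_cnj by auto
      have Ms'': "\<forall>N\<in>set ?Ms. N \<in> carrier_mat (n - k) n" using Ms' by blast
      have F_iff: "(\<forall>e<N. F e (case_option (complex_of_real t) y) = 0) \<longleftrightarrow> (\<forall>L\<in>set ?Ms. meets (?ch y) L)" for y
        unfolding N_cases F2
        using meets_torus_scale[of t "?ch y" \<alpha>, OF _ chc chs] t by (auto simp: F1 meets_def all_set_conv_all_nth)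
      have sol_iff: "solution n k \<alpha> ?Ms (?ch y) \<longleftrightarrow> (\<forall>e<N. F e (case_option (complex_of_real t) y) = 0)" for y
        unfolding F_iff solution_def
        using in_OmegaI[OF chc[of y] \<alpha> chs] full_rankI[OF chc[of y] \<beta>] plucker_chart[OF ch\<beta>[of y]] by auto
      define X where "X = ?ch x"
      have Xsol: "solution n k \<alpha> ?Ms X" using sol_iff x1(2) by (simp add: X_def)
      have X\<beta>: "cols_of X \<beta> = 1\<^sub>m k" by (simp add: X_def ch\<beta>)
      note Xc = solutionD[OF Xsol]
      have uniq: "Y = X" if Y: "solution n k \<alpha> ?Ms Y" "cols_of Y \<beta> = 1\<^sub>m k"
        "(\<Sum>ic\<in>?J. cmod (Y $$ ic - q ic)) \<le> r" for Y
      proof -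
        have chY: "?ch (\<lambda>ic. Y $$ ic) = Y"
          by (rule schubert_chart_surj[OF solutionD[OF Y(1)] Y(2) \<beta> \<alpha> le wa]) (use Y(1) in \<open>simp add: solution_def\<close>)
        have "\<forall>ic\<in>?J. Y $$ ic = x ic"
          by (rule x2[OF Y(3)]) (use sol_iff[of "\<lambda>ic. Y $$ ic"] chY Y(1) in simp)
        hence "?ch (\<lambda>ic. Y $$ ic) = ?ch x" by (auto simp: schubert_chart_def fun_eq_iff intro!: cong_mat)
        thus ?thesis using chY by (simp add: X_def)
      qed
      have diff: "cmod (X $$ (i, c) - X0 $$ (i, c)) = (if (i, c) \<in> ?J then cmod (x (i, c) - q (i, c)) else 0)"
        if "i < k" "c < n" for i c
        using that by (simp add: X_def chq[symmetric] schubert_chart_index) (auto simp: free_pos_def)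
      have "cmod (X $$ (i, c) - X0 $$ (i, c)) \<le> r0" if "i < k" "c < n" for i c
      proof (cases "(i, c) \<in> ?J")
        case True
        thus ?thesis using diff[OF that] member_le_sum[of "(i, c)" ?J "\<lambda>ic. cmod (x ic - q ic)"] finJ x1(1) r(2)
          by fastforce
      qed (use diff[OF that] r0 in simp)
      hence close: "near k n r0 X X0" by (simp add: near_def)
      \<comment> \<open>The conjugate solves the same real system in the same chart and is equally
        far from the real matrix \<open>X0\<close>, so uniqueness identifies it with
        \<open>X\<close>.\<close>
      have real: "map_mat cnj X = X"
      proof (rule uniq)
        show "solution n k \<alpha> ?Ms (map_mat cnj X)" by (rule solution_cnj[OF kn' Ms' Xsol])
        show "cols_of (map_mat cnj X) \<beta> = 1\<^sub>m k"
          unfolding cols_of_map[OF Xc \<beta>] X\<beta> by (rule eq_matI) auto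
        have "cmod (map_mat cnj X $$ ic - q ic) = cmod (x ic - q ic)" if "ic \<in> ?J" for ic
        proof -
          obtain i c where ic: "ic = (i, c)" "i < k" "c < n" using \<open>ic \<in> ?J\<close> by (auto simp: free_pos_def)
          have "map_mat cnj X $$ ic = cnj (X $$ ic)" using ic Xc by simp
          moreover have "map_mat cnj X0 $$ ic = cnj (X0 $$ ic)" using ic X0c by simp
          hence "q ic = cnj (X0 $$ ic)" unfolding q_def X0(4) .
          ultimately have "map_mat cnj X $$ ic - q ic = cnj (X $$ ic - X0 $$ ic)" by simp
          hence "cmod (map_mat cnj X $$ ic - q ic) = cmod (X $$ ic - X0 $$ ic)" by (simp only: complex_mod_cnj)
          thus ?thesis using diff[OF ic(2,3)] that ic(1) by simp
        qed
        thus "(\<Sum>ic\<in>?J. cmod (map_mat cnj X $$ ic - q ic)) \<le> r" using x1(1) by simp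
      qed
      have "nondegenerate n k \<alpha> ?Ms X"
      proof (rule nondegenerate_chartI[OF kn' Ms'' Xsol X\<beta> \<beta>])
        fix V assume V: "V \<in> carrier_mat k n" "cols_of V \<beta> = 0\<^sub>m k k" "tangent n k \<alpha> ?Ms X V"
        have Voff: "V $$ (i, c) = 0" if ic: "i < k" "c < n" "(i, c) \<notin> ?J" for i c
        proof (rule tangent_support[OF Xc X\<beta> \<beta> \<alpha> le wa V ic(1,2)])
          show "Suc c \<in> \<beta> \<or> seq \<alpha> ! i < Suc c \<and> X $$ (i, c) = 0"
            using ic chs[OF ic(1,2), of x] by (auto simp: free_pos_def X_def)
        qed
        define v where "v = (\<lambda>ic. V $$ ic)"
        have Vv: "V = mat k n (\<lambda>ic. if ic \<in> ?J then v ic else 0)"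
          using V(1) Voff by (intro eq_matI) (auto simp: v_def)
        have line: "?ch (\<lambda>ic. x ic + s * v ic) = X + s \<cdot>\<^sub>m V" for s
          unfolding X_def by (rule schubert_chart_line[OF Vv])
        define w where "w = torus_factor n k \<alpha> (complex_of_real t)"
        have w: "w \<noteq> 0" using t by (auto simp: w_def intro!: torus_factor_nonzero)
        \<comment> \<open>For fixed nonzero \<open>t\<close> the rescaled condition is a constant
          nonzero multiple of the original one, so both have the same tangent directions.\<close>
        have Dw: "det (torus_scale n k \<alpha> (complex_of_real t) (?ch y) @\<^sub>r BC) = inverse w * det (?ch y @\<^sub>r M t)" for y
          using det_torus_scale[OF kn' BC _ chc[of y] chs, of "complex_of_real t"] t w by (simp add: M_eq w_def)
        have Fw: "F (wt \<beta>) (case_option (complex_of_real t) (\<lambda>ic. x ic + s * v ic)) =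
            inverse w * det ((X + s \<cdot>\<^sub>m V) @\<^sub>r M t)" for s
          unfolding F2 line[symmetric] by (rule Dw)
        have tM: "((\<lambda>s. det ((X + s \<cdot>\<^sub>m V) @\<^sub>r L)) has_field_derivative 0) (at 0)" if "L \<in> set ?Ms" for L
          using V(3) that unfolding tangent_iff by blast
        have "\<forall>ic\<in>?J. v ic = 0"
        proof (rule x3, subst N_cases, intro conjI allI impI)
          fix e assume e: "e < length Ms"
          thus "((\<lambda>s. F e (case_option (complex_of_real t) (\<lambda>j. x j + s * v j))) has_field_derivative 0) (at 0)"
            using tM[of "Ms ! e"] by (simp add: F1 line)
        next
          show "((\<lambda>s. F (wt \<beta>) (case_option (complex_of_real t) (\<lambda>j. x j + s * v j))) has_field_derivative 0) (at 0)"
            unfolding Fw using DERIV_cmult[OF tM[of "M t"], of "inverse w"] by simp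
        qed
        thus "V = 0\<^sub>m k n" unfolding Vv by (intro eq_matI) auto
      qed
      moreover have "Y = X" if "solution n k \<alpha> ?Ms Y" "cols_of Y \<beta> = 1\<^sub>m k"
        "near k n \<rho> Y X0" for Y
      proof (rule uniq[OF that(1,2)])
        have "(\<Sum>ic\<in>?J. cmod (Y $$ ic - q ic)) \<le> of_nat (card ?J) * \<rho>"
          by (rule sum_bounded_above) (use that(3) in \<open>auto simp: q_def free_pos_def near_def\<close>)
        thus "(\<Sum>ic\<in>?J. cmod (Y $$ ic - q ic)) \<le> r" using \<rho>(2) cardJ by simp
      qed
      ultimately show "\<exists>X. deformation \<alpha> ?Ms (\<beta>, X0) r0 \<rho> X"
        unfolding deformation_def fst_conv snd_conv using Xsol X\<beta> real close by blast
    qed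
  qed
qed

end

subsection \<open>Compactness, counting and the choice of parameters\<close>

lemma mat_tendstoI:
  assumes "\<And>m. X m \<in> carrier_mat k n" "L \<in> carrier_mat k n"
    "\<And>m. near k n (inverse (real (Suc m))) (X m) L"
  shows "mat_tendsto k n X L"
  unfolding mat_tendsto_def
proof (intro conjI allI impI assms(1,2))
  fix i c assume ic: "i < k" "c < n"
  have "(\<lambda>m. X m $$ (i, c) - L $$ (i, c)) \<longlonglongrightarrow> 0"
    by (rule tendsto_0_le[OF LIMSEQ_inverse_real_of_nat, where K = 1])
      (use assms(3) ic in \<open>auto simp: near_def simp del: of_nat_Suc intro!: always_eventually\<close>)
  thus "(\<lambda>m. X m $$ (i, c)) \<longlonglongrightarrow> L $$ (i, c)" by (simp add: LIM_zero_iff)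
qed

lemma mat_tendsto_mult:
  assumes A: "mat_tendsto r k A A'" and X: "mat_tendsto k n X X'"
  shows "mat_tendsto r n (\<lambda>m. A m * X m) (A' * X')"
proof -
  have c: "A m \<in> carrier_mat r k" "A' \<in> carrier_mat r k" "X m \<in> carrier_mat k n" "X' \<in> carrier_mat k n" for m
    using A X by (auto simp: mat_tendsto_def)
  have e: "(P * Q) $$ (i, j) = (\<Sum>l = 0..<k. P $$ (i, l) * Q $$ (l, j))"
    if "P \<in> carrier_mat r k" "Q \<in> carrier_mat k n" "i < r" "j < n" for P Q :: "complex mat" and i j
    using that by (simp add: scalar_prod_def)
  have "(\<lambda>m. (A m * X m) $$ (i, j)) \<longlonglongrightarrow> (A' * X') $$ (i, j)" if "i < r" "j < n" for i j
    unfolding e[OF c(1,3) that] e[OF c(2,4) that]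
    using A X that by (intro tendsto_sum tendsto_mult) (auto simp: mat_tendsto_def)
  thus ?thesis using c unfolding mat_tendsto_def by (metis mult_carrier_mat)
qed

lemma mat_tendsto_unique:
  assumes "mat_tendsto k n X L" "mat_tendsto k n X L'" shows "L = L'"
  using assms unfolding mat_tendsto_def by (intro eq_matI) (auto, meson LIMSEQ_unique)

lemma mat_tendsto_subseq:
  "mat_tendsto k n X L \<Longrightarrow> strict_mono s \<Longrightarrow> mat_tendsto k n (\<lambda>m. X (s m)) L"
  using LIMSEQ_subseq_LIMSEQ[unfolded o_def] unfolding mat_tendsto_def by blast

text \<open>Compares matrices normalised in possibly different charts through their row spaces. It
  will keep deformations of distinct limit points distinct.\<close>

definition separated :: "nat \<Rightarrow> nat \<Rightarrow> real \<Rightarrow> nat set \<times> complex mat \<Rightarrow> nat set \<times> complex mat \<Rightarrow> bool" where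
  "separated k n e p p' \<longleftrightarrow> (\<forall>X\<in>carrier_mat k n. \<forall>Y\<in>carrier_mat k n. cols_of X (fst p) = 1\<^sub>m k \<longrightarrow>
    near k n e X (snd p) \<longrightarrow> near k n e Y (snd p') \<longrightarrow> rowspace X \<noteq> rowspace Y)"

lemma separated_mono:
  assumes "separated k n e' p p'" "e \<le> e'" shows "separated k n e p p'"
proof -
  have "near k n e' X Y" if "near k n e X Y" for X Y
    using that assms(2) unfolding near_def by (meson order_trans)
  thus ?thesis using assms(1) unfolding separated_def by blast
qed

text \<open>Otherwise sequences with equal row spaces converge to \<open>X0\<close> and
  \<open>Y0\<close>. The matrices relating them are \<open>cols_of (Y m) \<beta>\<close>, which
  converge too, so \<open>Y0\<close> is a multiple of \<open>X0\<close>; the chart of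
  \<open>Y0\<close> makes the factor invertible.\<close>

lemma rowspace_separation:
  fixes X0 Y0 :: "complex mat"
  assumes X0: "X0 \<in> carrier_mat k n" "cols_of X0 \<beta> = 1\<^sub>m k" and Y0: "Y0 \<in> carrier_mat k n" "cols_of Y0 \<gamma> = 1\<^sub>m k"
    and K: "\<beta> \<in> kset n k" "\<gamma> \<in> kset n k" and ne: "rowspace X0 \<noteq> rowspace Y0"
  shows "\<exists>e>0. separated k n e (\<beta>, X0) (\<gamma>, Y0)"
proof (rule ccontr)
  assume neg: "\<not> ?thesis"
  have "\<exists>X Y. X \<in> carrier_mat k n \<and> Y \<in> carrier_mat k n \<and> cols_of X \<beta> = 1\<^sub>m k \<and>
    near k n (inverse (real (Suc m))) X X0 \<and>
    near k n (inverse (real (Suc m))) Y Y0 \<and> rowspace X = rowspace Y" for m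
  proof -
    have "inverse (real (Suc m)) > 0" by simp
    thus ?thesis using neg unfolding separated_def fst_conv snd_conv by blast
  qed
  then obtain X Y where XY: "\<And>m. X m \<in> carrier_mat k n" "\<And>m. Y m \<in> carrier_mat k n"
    "\<And>m. cols_of (X m) \<beta> = 1\<^sub>m k"
    "\<And>m. near k n (inverse (real (Suc m))) (X m) X0"
    "\<And>m. near k n (inverse (real (Suc m))) (Y m) Y0"
    "\<And>m. rowspace (X m) = rowspace (Y m)" by metis
  have X: "mat_tendsto k n X X0" using XY by (intro mat_tendstoI X0) blast+
  have Y: "mat_tendsto k n Y Y0" using XY by (intro mat_tendstoI Y0) blast+
  have eq: "Y m = cols_of (Y m) \<beta> * X m" for m
  proof -
    obtain C where C: "C \<in> carrier_mat k k" "Y m = C * X m" using rowspace_eq_factor[OF XY(1,2,6)] .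
    have "cols_of (Y m) \<beta> = C * 1\<^sub>m k" using cols_of_mult[OF C(1) XY(1) K(1)] C(2) XY(3) by simp
    thus ?thesis using C by simp
  qed
  define G where "G = cols_of Y0 \<beta>"
  have G: "G \<in> carrier_mat k k" unfolding G_def by (rule cols_of_carrier[OF Y0(1) K(1)])
  have "mat_tendsto k n (\<lambda>m. cols_of (Y m) \<beta> * X m) (G * X0)"
    unfolding G_def by (rule mat_tendsto_mult[OF mat_tendsto_cols[OF Y K(1)] X])
  hence "mat_tendsto k n Y (G * X0)" by (simp add: eq[symmetric])
  hence e: "Y0 = G * X0" by (rule mat_tendsto_unique[OF Y])
  have "det G * plucker X0 \<gamma> = 1" using plucker_mult[OF G X0(1) K(2)] plucker_chart[OF Y0(2)] e by simp
  hence "det G \<noteq> 0" by auto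
  thus False using rowspace_mult[OF G _ X0(1)] e ne by simp
qed

text \<open>Normalise at the minor of largest modulus. The other entries are, up to sign, quotients
  of a minor by this one. Hence finitely many charts with bounded entries exhaust the Grassmannian,
  which is its compactness.\<close>

lemma exists_bounded_chart:
  assumes X: "full_rank n k X"
  obtains \<gamma> G where "\<gamma> \<in> kset n k" "G \<in> carrier_mat k k" "det G \<noteq> 0" "cols_of (G * X) \<gamma> = 1\<^sub>m k"
    "\<And>i c. i < k \<Longrightarrow> c < n \<Longrightarrow> cmod ((G * X) $$ (i, c)) \<le> 1"
proof -
  note Xc = full_rankD(1)[OF X]
  let ?m = "\<lambda>\<gamma>. cmod (plucker X \<gamma>)"
  have S: "finite (kset n k)" "kset n k \<noteq> {}" using finite_kset full_rankD(2)[OF X] by auto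
  have "Max (?m ` kset n k) \<in> ?m ` kset n k" using S by (intro Max_in) auto
  then obtain \<gamma> where \<gamma>: "\<gamma> \<in> kset n k" "?m \<gamma> = Max (?m ` kset n k)" by (metis (no_types, lifting) imageE)
  have max: "?m \<gamma>' \<le> ?m \<gamma>" if "\<gamma>' \<in> kset n k" for \<gamma>' using \<gamma>(2) S(1) that by simp
  obtain \<gamma>0 where "\<gamma>0 \<in> kset n k" "plucker X \<gamma>0 \<noteq> 0" using full_rankD(2)[OF X] by blast
  hence p: "plucker X \<gamma> \<noteq> 0" using max[of \<gamma>0] by auto
  obtain G where G: "G \<in> carrier_mat k k" "det G \<noteq> 0" "cols_of (G * X) \<gamma> = 1\<^sub>m k"
    using chart_rep[OF Xc \<gamma>(1) p] by metis
  have GX: "G * X \<in> carrier_mat k n" using G Xc by simp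
  have one: "cmod (det G) * ?m \<gamma> = 1"
    using plucker_mult[OF G(1) Xc \<gamma>(1)] plucker_chart[OF G(3)] by (metis norm_mult norm_one)
  show ?thesis
  proof (rule that[OF \<gamma>(1) G])
    fix i c assume ic: "i < k" "c < n"
    show "cmod ((G * X) $$ (i, c)) \<le> 1"
    proof (cases "Suc c \<in> \<gamma>")
      case True
      thus ?thesis using chart_entry[OF GX G(3) \<gamma>(1) ic True] by simp
    next
      case False
      note S = swap_kset[OF \<gamma>(1) ic False]
      obtain \<epsilon> :: complex where \<epsilon>: "cmod \<epsilon> = 1" "plucker (G * X) (swap \<gamma> i c) = \<epsilon> * (G * X) $$ (i, c)"
        using plucker_swap[OF \<gamma>(1) ic False] GX G(3) by metis
      have "cmod ((G * X) $$ (i, c)) = cmod (plucker (G * X) (swap \<gamma> i c))"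
        using \<epsilon> by (metis mult_1 norm_mult)
      also have "\<dots> = cmod (det G) * ?m (swap \<gamma> i c)" using plucker_mult[OF G(1) Xc S] by (simp add: norm_mult)
      also have "\<dots> \<le> cmod (det G) * ?m \<gamma>" by (intro mult_left_mono max S) auto
      finally show ?thesis using one by simp
    qed
  qed
qed

lemma real_point_if_cnj:
  assumes "X \<in> carrier_mat k n" "map_mat cnj X = X"
  shows "real_point n k (rowspace X)"
proof -
  have "map_mat complex_of_real (map_mat Re X) = X"
  proof (rule eq_matI)
    fix i j assume ij: "i < dim_row X" "j < dim_col X"
    have "map_mat cnj X $$ (i, j) = cnj (X $$ (i, j))" using ij by simp
    hence "cnj (X $$ (i, j)) = X $$ (i, j)" unfolding assms(2) by simp
    hence "X $$ (i, j) \<in> \<real>" by (simp add: Reals_cnj_iff)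
    thus "map_mat complex_of_real (map_mat Re X) $$ (i, j) = X $$ (i, j)" using ij by (simp add: of_real_Re)
  qed auto
  moreover have "map_mat Re X \<in> carrier_mat k n" using assms(1) by simp
  ultimately show ?thesis unfolding real_point_def by metis
qed

text \<open>A real row space is fixed by conjugation, and so is its unique representative in a
  chart.\<close>

lemma cnj_if_real_point:
  assumes X: "X \<in> carrier_mat k n" "cols_of X \<beta> = 1\<^sub>m k" and \<beta>: "\<beta> \<in> kset n k"
    and r: "real_point n k (rowspace X)"
  shows "map_mat cnj X = X"
proof -
  obtain Y :: "real mat" where Y: "Y \<in> carrier_mat k n" "rowspace X = rowspace (map_mat complex_of_real Y)"
    using r unfolding real_point_def by blast
  define Z where "Z = map_mat complex_of_real Y"
  have Z: "Z \<in> carrier_mat k n" "rowspace Z = rowspace X" using Y by (auto simp: Z_def)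
  have cZ: "map_mat cnj Z = Z" unfolding Z_def by (rule eq_matI) auto
  obtain C where C: "C \<in> carrier_mat k k" "X = C * Z" using rowspace_eq_factor[OF Z(1) X(1) Z(2)] .
  have "det C * plucker Z \<beta> = 1" using plucker_mult[OF C(1) Z(1) \<beta>] plucker_chart[OF X(2)] C(2) by simp
  hence dC: "det C \<noteq> 0" by auto
  have C': "map_mat cnj C \<in> carrier_mat k k" "det (map_mat cnj C) \<noteq> 0"
    using C(1) dC by (auto simp: comm_ring_hom.hom_det[OF cnj_hom])
  interpret cnj: comm_ring_hom cnj by (rule cnj_hom)
  have e: "map_mat cnj X = map_mat cnj C * Z"
    using cnj.mat_hom_mult[OF C(1) Z(1)] C(2) cZ by simp
  have "rowspace (map_mat cnj X) = rowspace X"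
    unfolding e using rowspace_mult[OF C' Z(1)] Z(2) by simp
  moreover have "cols_of (map_mat cnj X) \<beta> = 1\<^sub>m k"
    unfolding cols_of_map[OF X(1) \<beta>] X(2) by (rule eq_matI) auto
  moreover have "map_mat cnj X \<in> carrier_mat k n" using X(1) by simp
  ultimately show ?thesis using chart_unique[OF _ _ X \<beta>] by blast
qed

section \<open>The induction on the number of conditions\<close>

context transverse_subspace
begin

definition good :: "nat set \<Rightarrow> complex mat list \<Rightarrow> bool" where
  "good \<alpha> Ms \<longleftrightarrow> finite (isect n k \<alpha> Ms) \<and> card (isect n k \<alpha> Ms) = dnum n k \<alpha> \<and>
    (\<forall>X. solution n k \<alpha> Ms X \<longrightarrow> nondegenerate n k \<alpha> Ms X \<and> real_point n k (rowspace X))"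

text \<open>Emptiness whenever the expected dimension \<open>wt \<delta> - length Ms\<close>, taken
  as an integer, is negative. This is the part of the induction hypothesis that keeps limits inside
  usable charts.\<close>

definition dimensionally_proper :: "complex mat list \<Rightarrow> bool" where
  "dimensionally_proper Ms \<longleftrightarrow> (\<forall>\<delta>\<in>kset n k. wt \<delta> < length Ms \<longrightarrow> (\<forall>X. \<not> solution n k \<delta> Ms X))"

text \<open>The cell \<delta> that contains the solution satisfies \<delta> \<le> \<alpha> and, by
  properness, cannot have smaller weight; hence \<delta> = \<alpha>.\<close>

lemma solution_cell:
  assumes E: "dimensionally_proper Ms" and X: "solution n k \<alpha> Ms X" and \<alpha>: "\<alpha> \<in> kset n k" "wt \<alpha> = length Ms"
  shows "plucker X \<alpha> \<noteq> 0"
proof -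
  have fr: "full_rank n k X" and O: "in_Omega_alpha n k \<alpha> X" using X by (auto simp: solution_def)
  obtain \<delta> where \<delta>: "\<delta> \<in> kset n k" "plucker X \<delta> \<noteq> 0" "in_Omega_alpha n k \<delta> X"
    using exists_schubert_cell[OF fr] .
  have le: "bruhat_le \<delta> \<alpha>" using O \<delta>(1,2) by (auto simp: in_Omega_alpha_def)
  have "solution n k \<delta> Ms X" using X \<delta>(3) by (simp add: solution_def)
  hence "\<not> wt \<delta> < length Ms" using E \<delta>(1) by (auto simp: dimensionally_proper_def)
  hence "wt \<delta> = wt \<alpha>" using bruhat_wt(1)[OF \<delta>(1) \<alpha>(1) le] \<alpha>(2) by simp
  hence "\<delta> = \<alpha>" by (rule bruhat_wt(2)[OF \<delta>(1) \<alpha>(1) le])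
  thus ?thesis using \<delta>(2) by simp
qed

text \<open>Pairs, because the chart in which a point is to be deformed is part of the data.\<close>

definition limit_points :: "nat set \<Rightarrow> complex mat list \<Rightarrow> (nat set \<times> complex mat) set" where
  "limit_points \<alpha> Ms = (SIGMA \<beta>:{\<beta>. bruhat_cover n k \<beta> \<alpha>}. {X. solution n k \<beta> Ms X \<and> cols_of X \<beta> = 1\<^sub>m k})"

lemma chart_solutions_bij:
  assumes Ms: "\<forall>N\<in>set Ms. N \<in> carrier_mat (n - k) n" and E: "dimensionally_proper Ms"
    and \<beta>: "\<beta> \<in> kset n k" "wt \<beta> = length Ms"
  shows "bij_betw rowspace {X. solution n k \<beta> Ms X \<and> cols_of X \<beta> = 1\<^sub>m k} (isect n k \<beta> Ms)"
  unfolding bij_betw_def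
proof
  show "inj_on rowspace {X. solution n k \<beta> Ms X \<and> cols_of X \<beta> = 1\<^sub>m k}"
  proof (rule inj_onI)
    fix X Y assume a: "X \<in> {X. solution n k \<beta> Ms X \<and> cols_of X \<beta> = 1\<^sub>m k}"
      "Y \<in> {X. solution n k \<beta> Ms X \<and> cols_of X \<beta> = 1\<^sub>m k}" "rowspace X = rowspace Y"
    have "X \<in> carrier_mat k n" "cols_of X \<beta> = 1\<^sub>m k" "Y \<in> carrier_mat k n" "cols_of Y \<beta> = 1\<^sub>m k"
      using a(1,2) solutionD by blast+
    thus "X = Y" by (rule chart_unique[OF _ _ _ _ \<beta>(1) a(3)])
  qed
  show "rowspace ` {X. solution n k \<beta> Ms X \<and> cols_of X \<beta> = 1\<^sub>m k} = isect n k \<beta> Ms"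
  proof (intro equalityI subsetI)
    fix K assume "K \<in> isect n k \<beta> Ms"
    then obtain X where X: "solution n k \<beta> Ms X" "K = rowspace X" by (auto simp: isect_eq)
    obtain G where G: "G \<in> carrier_mat k k" "det G \<noteq> 0" "cols_of (G * X) \<beta> = 1\<^sub>m k"
      using chart_rep[OF solutionD[OF X(1)] \<beta>(1) solution_cell[OF E X(1) \<beta>]] by metis
    thus "K \<in> rowspace ` {X. solution n k \<beta> Ms X \<and> cols_of X \<beta> = 1\<^sub>m k}"
      using solution_mult[OF kn' Ms X(1) G(1,2)] rowspace_mult[OF G(1,2) solutionD[OF X(1)]] X(2)
      by (intro image_eqI[of _ _ "G * X"]) auto
  qed (auto simp: isect_eq)
qed

lemma limit_points_card:
  assumes Ms: "\<forall>N\<in>set Ms. N \<in> carrier_mat (n - k) n" and E: "dimensionally_proper Ms"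
    and \<alpha>: "\<alpha> \<in> kset n k" "wt \<alpha> = Suc (length Ms)"
    and g: "\<And>\<beta>. bruhat_cover n k \<beta> \<alpha> \<Longrightarrow> good \<beta> Ms"
  shows "finite (limit_points \<alpha> Ms)" "card (limit_points \<alpha> Ms) = dnum n k \<alpha>"
proof -
  let ?S = "\<lambda>\<beta>. {X. solution n k \<beta> Ms X \<and> cols_of X \<beta> = 1\<^sub>m k}"
  have b: "finite (?S \<beta>) \<and> card (?S \<beta>) = dnum n k \<beta>" if "bruhat_cover n k \<beta> \<alpha>" for \<beta>
  proof -
    have "\<beta> \<in> kset n k" using that by (simp add: bruhat_cover_def)
    moreover have "wt \<beta> = length Ms" using wt_cover[OF that] \<alpha>(2) by simp
    ultimately have bij: "bij_betw rowspace (?S \<beta>) (isect n k \<beta> Ms)" by (rule chart_solutions_bij[OF Ms E])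
    show ?thesis using bij_betw_finite[OF bij] bij_betw_same_card[OF bij] g[OF that] by (simp add: good_def)
  qed
  show "finite (limit_points \<alpha> Ms)"
    unfolding limit_points_def by (rule finite_SigmaI[OF finite_covers]) (use b in simp)
  have "\<alpha> \<noteq> hat0 k" using \<alpha>(2) wt_hat0 by auto
  have "card (limit_points \<alpha> Ms) = (\<Sum>\<beta>\<in>{\<beta>. bruhat_cover n k \<beta> \<alpha>}. card (?S \<beta>))"
    unfolding limit_points_def by (rule card_SigmaI[OF finite_covers]) (use b in simp)
  also have "\<dots> = dnum n k \<alpha>" unfolding dnum_step[OF \<open>\<alpha> \<noteq> hat0 k\<close>] by (rule sum.cong) (use b in auto)
  finally show "card (limit_points \<alpha> Ms) = dnum n k \<alpha>" .
qed

text \<open>A common row space lies on \<Omega>_\<beta> and has p_\<gamma> \<noteq> 0, which forces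
  \<gamma> \<le> \<beta>; equal weights give \<gamma> = \<beta>, where the representative is
  unique.\<close>

lemma limit_points_rowspace:
  assumes E: "dimensionally_proper Ms" and \<alpha>: "wt \<alpha> = Suc (length Ms)"
    and p: "(\<beta>, X) \<in> limit_points \<alpha> Ms" and p': "(\<gamma>, Y) \<in> limit_points \<alpha> Ms" and ne: "(\<beta>, X) \<noteq> (\<gamma>, Y)"
  shows "rowspace X \<noteq> rowspace Y"
proof
  assume eq: "rowspace X = rowspace Y"
  have X: "bruhat_cover n k \<beta> \<alpha>" "solution n k \<beta> Ms X" "cols_of X \<beta> = 1\<^sub>m k"
    and Y: "bruhat_cover n k \<gamma> \<alpha>" "solution n k \<gamma> Ms Y" "cols_of Y \<gamma> = 1\<^sub>m k"
    using p p' by (auto simp: limit_points_def)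
  have K: "\<beta> \<in> kset n k" "\<gamma> \<in> kset n k" using X Y by (auto simp: bruhat_cover_def)
  have w: "wt \<beta> = length Ms" "wt \<gamma> = length Ms" using wt_cover[OF X(1)] wt_cover[OF Y(1)] \<alpha> by auto
  obtain G where G: "G \<in> carrier_mat k k" "Y = G * X"
    using rowspace_eq_factor[OF solutionD[OF X(2)] solutionD[OF Y(2)] eq] .
  have "in_Omega_alpha n k \<beta> Y"
    unfolding G(2) by (rule in_Omega_mult[OF solutionD[OF X(2)] G(1)]) (use X(2) in \<open>simp add: solution_def\<close>)
  hence "bruhat_le \<gamma> \<beta>"
    using K(2) solution_cell[OF E Y(2) K(2) w(2)] by (auto simp: in_Omega_alpha_def)
  hence "\<gamma> = \<beta>" using bruhat_wt(2)[OF K(2,1)] w by simp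
  thus False using ne chart_unique[OF solutionD[OF X(2)] X(3) solutionD[OF Y(2)] _ K(1) eq] Y(3) by simp
qed

text \<open>The compactness step. Solutions staying away from all limit points along a null sequence
  of parameters would have a limit, and that limit would itself represent a limit point. The radii
  \<open>\<rho>\<close> are arbitrary because they come from the uniqueness part of the
  deformation.\<close>

lemma solutions_near_limit_points:
  assumes Ms: "\<forall>N\<in>set Ms. N \<in> carrier_mat (n - k) n" and E: "dimensionally_proper Ms"
    and \<alpha>: "\<alpha> \<in> kset n k" "wt \<alpha> = Suc (length Ms)"
    and \<rho>: "\<forall>p\<in>limit_points \<alpha> Ms. \<rho> p > 0"
  shows "\<forall>\<^sub>F t in at_right 0. \<forall>X. solution n k \<alpha> (Ms @ [M t]) X \<longrightarrow>
    (\<exists>(\<beta>, X0)\<in>limit_points \<alpha> Ms. \<exists>Y. rowspace Y = rowspace X \<and> solution n k \<alpha> (Ms @ [M t]) Y \<and>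
      cols_of Y \<beta> = 1\<^sub>m k \<and> near k n (\<rho> (\<beta>, X0)) Y X0)"
proof -
  define Q where "Q = (\<lambda>t X. \<exists>(\<beta>, X0)\<in>limit_points \<alpha> Ms. \<exists>Y. rowspace Y = rowspace X \<and>
      solution n k \<alpha> (Ms @ [M t]) Y \<and> cols_of Y \<beta> = 1\<^sub>m k \<and>
      near k n (\<rho> (\<beta>, X0)) Y X0)"
  have Ms': "\<forall>N\<in>set (Ms @ [M t]). N \<in> carrier_mat (n - k) n" for t using Ms M_carrier by auto
  have "\<forall>\<^sub>F t in at_right 0. \<forall>\<gamma>\<in>kset n k. \<forall>X. solution n k \<alpha> (Ms @ [M t]) X \<longrightarrow> cols_of X \<gamma> = 1\<^sub>m k \<longrightarrow>
     (\<forall>i<k. \<forall>c<n. cmod (X $$ (i, c)) \<le> 1) \<longrightarrow> Q t X"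
  \<comment> \<open>Bounded representatives in finitely many charts cover everything, so one chart
    \<gamma> can be fixed.\<close>
  proof (rule eventually_ball_finite[OF finite_kset], rule ballI, rule eventually_at_right_0_by_sequences)
    fix \<gamma> and \<tau> :: "nat \<Rightarrow> real"
    assume \<gamma>: "\<gamma> \<in> kset n k" and \<tau>: "\<And>m. \<tau> m > 0" "\<tau> \<longlonglongrightarrow> 0"
      and neg: "\<And>m. \<not> (\<forall>X. solution n k \<alpha> (Ms @ [M (\<tau> m)]) X \<longrightarrow> cols_of X \<gamma> = 1\<^sub>m k \<longrightarrow>
        (\<forall>i<k. \<forall>c<n. cmod (X $$ (i, c)) \<le> 1) \<longrightarrow> Q (\<tau> m) X)"
    then obtain X where X: "\<And>m. solution n k \<alpha> (Ms @ [M (\<tau> m)]) (X m)" "\<And>m. cols_of (X m) \<gamma> = 1\<^sub>m k"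
      "\<And>m. \<forall>i<k. \<forall>c<n. cmod (X m $$ (i, c)) \<le> 1" "\<And>m. \<not> Q (\<tau> m) (X m)"
      by metis
    have "\<exists>r l. strict_mono (r :: nat \<Rightarrow> nat) \<and> (\<forall>ic\<in>{..<k} \<times> {..<n}. (\<lambda>m. X (r m) $$ ic) \<longlonglongrightarrow> l ic)"
      by (rule finite_bounded_subsequence) (use X(3) in auto)
    then obtain r l where r: "strict_mono (r :: nat \<Rightarrow> nat)"
      and l: "\<And>i c. i < k \<Longrightarrow> c < n \<Longrightarrow> (\<lambda>m. X (r m) $$ (i, c)) \<longlonglongrightarrow> l (i, c)" by auto
    define L where "L = mat k n l"
    have lim: "mat_tendsto k n (\<lambda>m. X (r m)) L"
      using solutionD[OF X(1)] l by (auto simp: mat_tendsto_def L_def)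
    have Lc: "L \<in> carrier_mat k n" by (simp add: L_def)
    have "(\<lambda>m. plucker (X (r m)) \<gamma>) \<longlonglongrightarrow> plucker L \<gamma>" by (rule mat_tendsto_plucker[OF lim \<gamma>])
    hence "plucker L \<gamma> = 1" by (simp add: plucker_chart[OF X(2)] LIMSEQ_const_iff)
    hence fr: "full_rank n k L" by (intro full_rankI[OF Lc \<gamma>]) simp
    have Lsol: "solution n k \<alpha> Ms L"
      by (rule solution_limit[OF lim fr Ms]) (use X(1) solution_append in blast)
    hence LO: "in_Omega_alpha n k \<alpha> L" by (simp add: solution_def)
    have nz: "\<exists>m0. \<forall>m\<ge>m0. plucker (X (r m)) \<delta> \<noteq> 0" if "\<delta> \<in> kset n k" "plucker L \<delta> \<noteq> 0" for \<delta>
      using tendsto_imp_eventually_ne[OF mat_tendsto_plucker[OF lim that(1)] that(2)]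
      by (simp add: eventually_sequentially)
    show False
    proof (cases "plucker L \<alpha> = 0")
      \<comment> \<open>A limit in the open cell of \<alpha> has all pivots 1 in its chart, while
        \<open>torus_limit\<close> makes their product vanish.\<close>
      case False
      obtain m0 where m0: "\<And>m. m \<ge> m0 \<Longrightarrow> plucker (X (r m)) \<alpha> \<noteq> 0" using nz[OF \<alpha>(1) False] by blast
      \<comment> \<open>The shift by \<open>m0\<close> discards the members of the sequence that lie
        outside the chart \<alpha>.\<close>
      define s where "s = (\<lambda>m. r (m + m0))"
      have s: "strict_mono s" using r by (auto simp: s_def strict_mono_def)
      have m0': "plucker (X (s m)) \<alpha> \<noteq> 0" for m using m0 by (simp add: s_def)
      have "mat_tendsto k n (\<lambda>m. X (s m)) L"
        using mat_tendsto_subseq[OF lim, of "\<lambda>m. m + m0"] by (simp add: s_def strict_mono_def)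
      from mat_tendsto_chart_rep[OF this \<alpha>(1) False]
      have W: "mat_tendsto k n (\<lambda>m. chart_rep n k \<alpha> (X (s m))) (chart_rep n k \<alpha> L)" .
      have zero: "(\<Prod>i<k. chart_rep n k \<alpha> L $$ (i, seq \<alpha> ! i - 1)) = 0"
      proof (rule torus_limit[OF \<alpha>(1) _ _ W])
        show "\<tau> (s m) > 0" for m by (rule \<tau>(1))
        show "(\<lambda>m. \<tau> (s m)) \<longlonglongrightarrow> 0" using LIMSEQ_subseq_LIMSEQ[OF \<tau>(2) s] by (simp add: o_def)
        fix m
        obtain G where G: "G \<in> carrier_mat k k" "det G \<noteq> 0" "chart_rep n k \<alpha> (X (s m)) = G * X (s m)"
          "cols_of (G * X (s m)) \<alpha> = 1\<^sub>m k"
          using chart_rep[OF solutionD[OF X(1)] \<alpha>(1) m0'] by metis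
        have sol: "solution n k \<alpha> (Ms @ [M (\<tau> (s m))]) (G * X (s m))"
          by (rule solution_mult[OF kn' Ms' X(1) G(1,2)])
        thus "meets (chart_rep n k \<alpha> (X (s m))) (M (\<tau> (s m)))" unfolding G(3) solution_append by blast
        have O: "in_Omega_alpha n k \<alpha> (G * X (s m))" using sol by (simp add: solution_def)
        fix i c assume "i < k" "c < n" "seq \<alpha> ! i < Suc c"
        thus "chart_rep n k \<alpha> (X (s m)) $$ (i, c) = 0" unfolding G(3)
          by (intro chart_zero[OF solutionD[OF sol] G(4) \<alpha>(1) \<alpha>(1) bruhat_refl _ O]) simp
      qed
      obtain G where G: "G \<in> carrier_mat k k" "chart_rep n k \<alpha> L = G * L" "cols_of (G * L) \<alpha> = 1\<^sub>m k"
        using chart_rep[OF Lc \<alpha>(1) False] by metis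
      have "(G * L) $$ (i, seq \<alpha> ! i - 1) = 1" if "i < k" for i
        using cols_of_index[of "G * L" k n \<alpha> k i i] G Lc \<alpha>(1) that by simp
      thus False using zero unfolding G(2) by simp
    next
      \<comment> \<open>Now the limit lies on \<Omega>_\<beta> for some covered \<beta>, and
        properness puts it in the open cell, so the chart \<beta> contains it and almost all members
        of the sequence.\<close>
      case True
      obtain \<delta> where \<delta>: "\<delta> \<in> kset n k" "plucker L \<delta> \<noteq> 0" "in_Omega_alpha n k \<delta> L"
        using exists_schubert_cell[OF fr] .
      have "bruhat_le \<delta> \<alpha>" using LO \<delta>(1,2) by (auto simp: in_Omega_alpha_def)
      moreover have "\<delta> \<noteq> \<alpha>" using True \<delta>(2) by auto
      ultimately obtain \<beta> where cov: "bruhat_cover n k \<beta> \<alpha>" and le: "bruhat_le \<delta> \<beta>"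
        using exists_bruhat_cover[OF \<delta>(1) \<alpha>(1)] by blast
      have \<beta>: "\<beta> \<in> kset n k" using cov by (simp add: bruhat_cover_def)
      have w: "wt \<beta> = length Ms" using wt_cover[OF cov] \<alpha>(2) by simp
      have sol\<beta>: "solution n k \<beta> Ms L"
        using Lsol in_Omega_mono[OF \<delta>(1) \<beta> le \<delta>(3)] by (simp add: solution_def)
      have p\<beta>: "plucker L \<beta> \<noteq> 0" by (rule solution_cell[OF E sol\<beta> \<beta> w])
      define X0 where "X0 = chart_rep n k \<beta> L"
      have Z: "(\<beta>, X0) \<in> limit_points \<alpha> Ms"
      proof -
        obtain G where G: "G \<in> carrier_mat k k" "det G \<noteq> 0" "chart_rep n k \<beta> L = G * L" "cols_of (G * L) \<beta> = 1\<^sub>m k"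
          using chart_rep[OF Lc \<beta> p\<beta>] by metis
        thus ?thesis using cov solution_mult[OF kn' Ms sol\<beta> G(1,2)] by (simp add: limit_points_def X0_def)
      qed
      have W: "mat_tendsto k n (\<lambda>m. chart_rep n k \<beta> (X (r m))) X0"
        unfolding X0_def by (rule mat_tendsto_chart_rep[OF lim \<beta> p\<beta>])
      have "\<forall>\<^sub>F m in sequentially. \<forall>ic\<in>{..<k} \<times> {..<n}. cmod (chart_rep n k \<beta> (X (r m)) $$ ic - X0 $$ ic) \<le> \<rho> (\<beta>, X0)"
      proof (rule eventually_ball_finite, simp, rule ballI)
        fix ic assume "ic \<in> {..<k} \<times> {..<n}"
        hence "(\<lambda>m. chart_rep n k \<beta> (X (r m)) $$ ic) \<longlonglongrightarrow> X0 $$ ic" using W by (auto simp: mat_tendsto_def)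
        from tendstoD[OF this bspec[OF \<rho> Z]]
        show "\<forall>\<^sub>F m in sequentially. cmod (chart_rep n k \<beta> (X (r m)) $$ ic - X0 $$ ic) \<le> \<rho> (\<beta>, X0)"
          by eventually_elim (simp add: dist_norm)
      qed
      then obtain m1 where m1: "\<And>m. m \<ge> m1 \<Longrightarrow> \<forall>ic\<in>{..<k} \<times> {..<n}. cmod (chart_rep n k \<beta> (X (r m)) $$ ic - X0 $$ ic) \<le> \<rho> (\<beta>, X0)"
        unfolding eventually_sequentially by blast
      obtain m0 where m0: "\<And>m. m \<ge> m0 \<Longrightarrow> plucker (X (r m)) \<beta> \<noteq> 0" using nz[OF \<beta> p\<beta>] by blast
      define m where "m = max m0 m1"
      obtain G where G: "G \<in> carrier_mat k k" "det G \<noteq> 0" "chart_rep n k \<beta> (X (r m)) = G * X (r m)"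
        "cols_of (G * X (r m)) \<beta> = 1\<^sub>m k"
        using chart_rep[OF solutionD[OF X(1)] \<beta> m0[of m]] by (metis m_def max.cobounded1)
      have "Q (\<tau> (r m)) (X (r m))"
        unfolding Q_def
      proof (intro bexI[OF _ Z] case_prodI exI[of _ "G * X (r m)"] conjI allI impI)
        show "rowspace (G * X (r m)) = rowspace (X (r m))" by (rule rowspace_mult[OF G(1,2) solutionD[OF X(1)]])
        show "solution n k \<alpha> (Ms @ [M (\<tau> (r m))]) (G * X (r m))" by (rule solution_mult[OF kn' Ms' X(1) G(1,2)])
        show "near k n (\<rho> (\<beta>, X0)) (G * X (r m)) X0"
          unfolding near_def G(3)[symmetric] using m1[of m] by (simp add: m_def)
      qed (rule G(4))
      thus False using X(4) by blast
    qed
  qed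
  thus ?thesis
  proof (rule eventually_mono)
    fix t assume a: "\<forall>\<gamma>\<in>kset n k. \<forall>X. solution n k \<alpha> (Ms @ [M t]) X \<longrightarrow> cols_of X \<gamma> = 1\<^sub>m k \<longrightarrow>
     (\<forall>i<k. \<forall>c<n. cmod (X $$ (i, c)) \<le> 1) \<longrightarrow> Q t X"
    have "Q t X" if X: "solution n k \<alpha> (Ms @ [M t]) X" for X
    proof -
      have "full_rank n k X" using X by (simp add: solution_def)
      then obtain \<gamma> G where G: "\<gamma> \<in> kset n k" "G \<in> carrier_mat k k" "det G \<noteq> 0" "cols_of (G * X) \<gamma> = 1\<^sub>m k"
        "\<And>i c. i < k \<Longrightarrow> c < n \<Longrightarrow> cmod ((G * X) $$ (i, c)) \<le> 1"
        by (rule exists_bounded_chart) blast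
      have "Q t (G * X)" using a G solution_mult[OF kn' Ms' X G(2,3)] by blast
      thus ?thesis unfolding Q_def using rowspace_mult[OF G(2,3) solutionD[OF X]] by simp
    qed
    thus "\<forall>X. solution n k \<alpha> (Ms @ [M t]) X \<longrightarrow>
    (\<exists>(\<beta>, X0)\<in>limit_points \<alpha> Ms. \<exists>Y. rowspace Y = rowspace X \<and> solution n k \<alpha> (Ms @ [M t]) Y \<and>
      cols_of Y \<beta> = 1\<^sub>m k \<and> near k n (\<rho> (\<beta>, X0)) Y X0)"
      unfolding Q_def by blast
  qed
qed

lemma limit_points_separated:
  assumes E: "dimensionally_proper Ms" and \<alpha>: "wt \<alpha> = Suc (length Ms)" and fin: "finite (limit_points \<alpha> Ms)"
  shows "\<exists>e>0. \<forall>p\<in>limit_points \<alpha> Ms. \<forall>p'\<in>limit_points \<alpha> Ms. p \<noteq> p' \<longrightarrow> separated k n e p p'"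
proof -
  let ?Z = "limit_points \<alpha> Ms"
  let ?W = "{(p, p'). p \<in> ?Z \<and> p' \<in> ?Z \<and> p \<noteq> p'}"
  have "\<exists>e>0. separated k n e (fst w) (snd w)" if "w \<in> ?W" for w
  proof -
    obtain \<beta> X0 \<gamma> Y0 where w: "w = ((\<beta>, X0), (\<gamma>, Y0))" by (metis prod.exhaust)
    have m: "(\<beta>, X0) \<in> ?Z" "(\<gamma>, Y0) \<in> ?Z" "(\<beta>, X0) \<noteq> (\<gamma>, Y0)" using that w by auto
    have "X0 \<in> carrier_mat k n" "cols_of X0 \<beta> = 1\<^sub>m k" "Y0 \<in> carrier_mat k n" "cols_of Y0 \<gamma> = 1\<^sub>m k"
      "\<beta> \<in> kset n k" "\<gamma> \<in> kset n k"
      using m(1,2) solutionD by (auto simp: limit_points_def bruhat_cover_def)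
    from rowspace_separation[OF this limit_points_rowspace[OF E \<alpha> m]] show ?thesis
      by (simp add: w)
  qed
  hence "\<forall>w\<in>?W. \<exists>e. 0 < e \<and> separated k n e (fst w) (snd w)" by blast
  from bchoice[OF this] obtain f where f: "\<forall>w\<in>?W. 0 < f w \<and> separated k n (f w) (fst w) (snd w)" ..
  have finW: "finite ?W" by (rule finite_subset[of _ "?Z \<times> ?Z"]) (use fin in auto)
  \<comment> \<open>The inserted 1 covers the case of at most one limit point, where there are no
    pairs.\<close>
  define e where "e = Min (insert 1 (f ` ?W))"
  have e: "e > 0" using f finW by (auto simp: e_def)
  have "separated k n e p p'" if "p \<in> ?Z" "p' \<in> ?Z" "p \<noteq> p'" for p p'
  proof -
    have w: "(p, p') \<in> ?W" using that by simp
    have "e \<le> f (p, p')" unfolding e_def by (rule Min_le) (use finW w in auto)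
    moreover have "separated k n (f (p, p')) p p'" using bspec[OF f w] by simp
    ultimately show ?thesis by (rule separated_mono[rotated])
  qed
  thus ?thesis using e by blast
qed

text \<open>Deformation gives an injection of limit points into solutions, by separation, and
  compactness together with local uniqueness makes it onto. Reality and nondegeneracy come with the
  deformed matrices and pass to every representative.\<close>

lemma eventually_good:
  assumes Ms: "\<forall>N\<in>set Ms. N \<in> carrier_mat (n - k) n \<and> map_mat cnj N = N" and E: "dimensionally_proper Ms"
    and \<alpha>: "\<alpha> \<in> kset n k" "wt \<alpha> = Suc (length Ms)"
    and g: "\<And>\<beta>. bruhat_cover n k \<beta> \<alpha> \<Longrightarrow> good \<beta> Ms"
  shows "\<forall>\<^sub>F t in at_right 0. good \<alpha> (Ms @ [M t])"
proof -
  let ?Z = "limit_points \<alpha> Ms"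
  have Msc: "\<forall>N\<in>set Ms. N \<in> carrier_mat (n - k) n" using Ms by blast
  have Ms': "\<forall>N\<in>set (Ms @ [M t]). N \<in> carrier_mat (n - k) n" for t using Msc M_carrier by auto
  have Z: "finite ?Z" "card ?Z = dnum n k \<alpha>"
    by (rule limit_points_card[OF Msc E \<alpha>], erule g)+
  \<comment> \<open>The order of choices matters: \<open>r0\<close> separates the limit points, each
    \<open>\<rho> p\<close> is found for this \<open>r0\<close>, and \<open>t\<close> is small with
    respect to all of them.\<close>
  obtain r0 where r0: "r0 > 0" and
    sep: "\<forall>p\<in>?Z. \<forall>p'\<in>?Z. p \<noteq> p' \<longrightarrow> separated k n r0 p p'"
    using limit_points_separated[OF E \<alpha>(2) Z(1)] by blast
  have "\<exists>\<rho>>0. \<forall>\<^sub>F t in at_right 0. \<exists>X. deformation \<alpha> (Ms @ [M t]) p r0 \<rho> X" if p: "p \<in> ?Z" for p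
  proof -
    obtain \<beta> X0 where pe: "p = (\<beta>, X0)" by (cases p)
    have cov: "bruhat_cover n k \<beta> \<alpha>" and X0: "solution n k \<beta> Ms X0" "cols_of X0 \<beta> = 1\<^sub>m k"
      using p by (auto simp: pe limit_points_def)
    obtain j where \<beta>: "\<beta> \<in> kset n k" and j: "covers_at k j \<beta> \<alpha>" using cov bruhat_cover_iff by blast
    have w: "length Ms = wt \<beta>" using wt_cover[OF cov] \<alpha>(2) by simp
    have nd: "nondegenerate n k \<beta> Ms X0" and "real_point n k (rowspace X0)"
      using g[OF cov] X0(1) by (auto simp: good_def)
    hence "map_mat cnj X0 = X0" by (intro cnj_if_real_point[OF solutionD[OF X0(1)] X0(2) \<beta>])
    from local_solution[OF \<beta> \<alpha>(1) j w Ms X0 nd this r0]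
    show ?thesis by (simp add: deformation_def pe)
  qed
  hence "\<forall>p\<in>?Z. \<exists>\<rho>. \<rho> > 0 \<and> (\<forall>\<^sub>F t in at_right 0. \<exists>X. deformation \<alpha> (Ms @ [M t]) p r0 \<rho> X)" by blast
  from bchoice[OF this] obtain \<rho> where
    "\<forall>p\<in>?Z. \<rho> p > 0 \<and> (\<forall>\<^sub>F t in at_right 0. \<exists>X. deformation \<alpha> (Ms @ [M t]) p r0 (\<rho> p) X)" ..
  hence \<rho>: "\<forall>p\<in>?Z. \<rho> p > 0" "\<forall>p\<in>?Z. \<forall>\<^sub>F t in at_right 0. \<exists>X. deformation \<alpha> (Ms @ [M t]) p r0 (\<rho> p) X" by blast+
  have "\<forall>\<^sub>F t in at_right 0. \<forall>p\<in>?Z. \<exists>X. deformation \<alpha> (Ms @ [M t]) p r0 (\<rho> p) X"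
    by (rule eventually_ball_finite[OF Z(1) \<rho>(2)])
  with solutions_near_limit_points[OF Msc E \<alpha> \<rho>(1)] show ?thesis
  proof eventually_elim
    case (elim t)
    let ?Ms = "Ms @ [M t]"
    from bchoice[OF elim(2)] obtain S where S: "\<And>p. p \<in> ?Z \<Longrightarrow> deformation \<alpha> ?Ms p r0 (\<rho> p) (S p)" by blast
    have inj: "inj_on (\<lambda>p. rowspace (S p)) ?Z"
    proof (rule inj_onI, rule ccontr)
      fix p p' assume a: "p \<in> ?Z" "p' \<in> ?Z" "rowspace (S p) = rowspace (S p')" "p \<noteq> p'"
      have P: "deformation \<alpha> ?Ms p r0 (\<rho> p) (S p)" "deformation \<alpha> ?Ms p' r0 (\<rho> p') (S p')" using S a(1,2) by blast+
      have "S p \<in> carrier_mat k n" "S p' \<in> carrier_mat k n" using P solutionD unfolding deformation_def by blast+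
      moreover have "separated k n r0 p p'" using sep a(1,2,4) by blast
      ultimately have "rowspace (S p) \<noteq> rowspace (S p')" using P unfolding deformation_def separated_def by blast
      thus False using a(3) by blast
    qed
    have cover: "\<exists>p\<in>?Z. rowspace X = rowspace (S p)" if X: "solution n k \<alpha> ?Ms X" for X
    proof -
      obtain \<beta> X0 Y where Y: "(\<beta>, X0) \<in> ?Z" "rowspace Y = rowspace X" "solution n k \<alpha> ?Ms Y"
        "cols_of Y \<beta> = 1\<^sub>m k" "near k n (\<rho> (\<beta>, X0)) Y X0"
        using elim(1) X by blast
      have "Y = S (\<beta>, X0)" using S[OF Y(1)] Y(3-5) by (simp add: deformation_def)
      thus ?thesis using Y(1,2) by (intro bexI[of _ "(\<beta>, X0)"]) auto
    qed
    have im: "(\<lambda>p. rowspace (S p)) ` ?Z = isect n k \<alpha> ?Ms"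
    proof (intro equalityI subsetI)
      fix K assume "K \<in> (\<lambda>p. rowspace (S p)) ` ?Z"
      then obtain p where "p \<in> ?Z" "K = rowspace (S p)" by blast
      thus "K \<in> isect n k \<alpha> ?Ms" using S[of p] unfolding isect_eq deformation_def by blast
    next
      fix K assume "K \<in> isect n k \<alpha> ?Ms"
      then obtain X where "solution n k \<alpha> ?Ms X" "K = rowspace X" unfolding isect_eq by blast
      thus "K \<in> (\<lambda>p. rowspace (S p)) ` ?Z" using cover[of X] by blast
    qed
    show ?case
      unfolding good_def
    proof (intro conjI allI impI)
      show "finite (isect n k \<alpha> ?Ms)" unfolding im[symmetric] using Z(1) by simp
      show "card (isect n k \<alpha> ?Ms) = dnum n k \<alpha>" unfolding im[symmetric] card_image[OF inj] by (rule Z(2))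
      fix X assume X: "solution n k \<alpha> ?Ms X"
      obtain p where p: "p \<in> ?Z" "rowspace X = rowspace (S p)" using cover[OF X] by blast
      have Sp: "solution n k \<alpha> ?Ms (S p)" "nondegenerate n k \<alpha> ?Ms (S p)" "map_mat cnj (S p) = S p"
        using S[OF p(1)] by (auto simp: deformation_def)
      show "real_point n k (rowspace X)" unfolding p(2) by (rule real_point_if_cnj[OF solutionD[OF Sp(1)] Sp(3)])
      obtain G where G: "G \<in> carrier_mat k k" "det G \<noteq> 0" "X = G * S p"
        by (rule rowspace_eq_invertible[of n k "S p" X]) (use Sp(1) X p(2) in \<open>auto simp: solution_def\<close>)
      show "nondegenerate n k \<alpha> ?Ms X"
        unfolding G(3) by (rule nondegenerate_mult[OF kn' Ms' solutionD[OF Sp(1)] Sp(2) G(1,2)])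
    qed
  qed
qed

text \<open>Only weight equal to \<open>length Ms\<close> is new. The intersection is finite there
  by \<open>good\<close>, and each of its points is avoided by the new condition for small
  \<open>t\<close>.\<close>

lemma eventually_dimensionally_proper:
  assumes Ms: "\<forall>N\<in>set Ms. N \<in> carrier_mat (n - k) n" and E: "dimensionally_proper Ms"
    and g: "\<And>\<alpha>. \<alpha> \<in> kset n k \<Longrightarrow> wt \<alpha> = length Ms \<Longrightarrow> good \<alpha> Ms"
  shows "\<forall>\<^sub>F t in at_right 0. dimensionally_proper (Ms @ [M t])"
proof -
  have "\<forall>\<^sub>F t in at_right 0. wt \<delta> < length (Ms @ [M t]) \<longrightarrow> (\<forall>X. \<not> solution n k \<delta> (Ms @ [M t]) X)"
    if \<delta>: "\<delta> \<in> kset n k" for \<delta>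
  proof (cases "wt \<delta> = length Ms")
    case True
    have fin: "finite (isect n k \<delta> Ms)" using g[OF \<delta> True] by (simp add: good_def)
    have "\<forall>\<^sub>F t in at_right 0. \<forall>K\<in>isect n k \<delta> Ms. \<forall>X. solution n k \<delta> Ms X \<longrightarrow> K = rowspace X \<longrightarrow> \<not> meets X (M t)"
    proof (rule eventually_ball_finite[OF fin], rule ballI)
      fix K assume "K \<in> isect n k \<delta> Ms"
      then obtain Y where Y: "solution n k \<delta> Ms Y" "K = rowspace Y" by (auto simp: isect_eq)
      hence fr: "full_rank n k Y" by (simp add: solution_def)
      show "\<forall>\<^sub>F t in at_right 0. \<forall>X. solution n k \<delta> Ms X \<longrightarrow> K = rowspace X \<longrightarrow> \<not> meets X (M t)"
        using eventually_not_meets[OF fr]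
      proof eventually_elim
        case (elim t)
        show ?case
        proof (intro allI impI notI)
          fix X assume X: "solution n k \<delta> Ms X" "K = rowspace X" "meets X (M t)"
          obtain C where C: "C \<in> carrier_mat k k" "Y = C * X"
            using rowspace_eq_factor[OF solutionD[OF X(1)] solutionD[OF Y(1)]] X(2) Y(2) by metis
          have "meets Y (M t)" unfolding C(2) by (rule meets_mult[OF kn' solutionD[OF X(1)] C(1) M_carrier X(3)])
          thus False using elim by blast
        qed
      qed
    qed
    thus ?thesis by eventually_elim (auto simp: solution_append isect_eq)
  next
    case False
    have "\<not> solution n k \<delta> (Ms @ [M t]) X" if "wt \<delta> < length (Ms @ [M t])" for t X
      using E \<delta> that False by (auto simp: dimensionally_proper_def solution_append)
    thus ?thesis by simp
  qed
  hence "\<forall>\<^sub>F t in at_right 0. \<forall>\<delta>\<in>kset n k. wt \<delta> < length (Ms @ [M t]) \<longrightarrow> (\<forall>X. \<not> solution n k \<delta> (Ms @ [M t]) X)"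
    by (intro eventually_ball_finite[OF finite_kset]) blast
  thus ?thesis by (simp add: dimensionally_proper_def)
qed

text \<open>Without free entries the chart consists of one real matrix, and
  \<open>tangent_support\<close> leaves no tangent vector.\<close>

lemma good_hat0: "good (hat0 k) []"
proof -
  note h = hat0_kset[OF kn']
  have E: "dimensionally_proper []" by (simp add: dimensionally_proper_def)
  have w: "wt (hat0 k) = length ([] :: complex mat list)" by (simp add: wt_hat0)
  let ?S = "{X. solution n k (hat0 k) [] X \<and> cols_of X (hat0 k) = 1\<^sub>m k}"
  let ?c = "schubert_chart n k (hat0 k) (hat0 k)"
  have free: "free_pos n k (hat0 k) (hat0 k) = {}"
    using card_free_pos_self[OF h] wt_hat0 finite_free_pos by (metis card_0_eq)
  have sol: "solution n k (hat0 k) [] (?c x)" for x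
    using in_OmegaI[OF schubert_chart_carrier h schubert_chart_support[OF order_refl]]
      full_rankI[OF schubert_chart_carrier h] plucker_chart[OF schubert_chart_cols[OF h]]
    by (auto simp: solution_def)
  have c0: "X = ?c (\<lambda>_. 0)" if "X \<in> ?S" for X
  proof -
    have X: "solution n k (hat0 k) [] X" "cols_of X (hat0 k) = 1\<^sub>m k" using that by auto
    have "?c (\<lambda>ic. X $$ ic) = X"
      by (rule schubert_chart_surj[OF solutionD[OF X(1)] X(2) h h bruhat_refl])
        (use X(1) in \<open>auto simp: solution_def\<close>)
    moreover have "?c (\<lambda>ic. X $$ ic) = ?c (\<lambda>_. 0)"
      by (rule eq_matI) (auto simp: schubert_chart_def free)
    ultimately show ?thesis by simp
  qed
  have S: "?S = {?c (\<lambda>_. 0)}" using c0 sol schubert_chart_cols[OF h] by blast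
  have bij: "bij_betw rowspace ?S (isect n k (hat0 k) [])"
    by (rule chart_solutions_bij[OF _ E h w]) simp
  have nd: "nondegenerate n k (hat0 k) [] (?c (\<lambda>_. 0))"
  proof (rule nondegenerate_chartI[OF kn' _ sol schubert_chart_cols[OF h] h])
    let ?X = "?c (\<lambda>_. 0)"
    fix V assume V: "V \<in> carrier_mat k n" "cols_of V (hat0 k) = 0\<^sub>m k k" "tangent n k (hat0 k) [] ?X V"
    have "V $$ (i, c) = 0" if ic: "i < k" "c < n" for i c
    proof (rule tangent_support[OF schubert_chart_carrier schubert_chart_cols[OF h] h h bruhat_refl _ V ic])
      have "(i, c) \<notin> free_pos n k (hat0 k) (hat0 k)" by (simp add: free)
      hence "Suc c \<in> hat0 k \<or> seq (hat0 k) ! i < Suc c" using ic by (auto simp: free_pos_def)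
      thus "Suc c \<in> hat0 k \<or> seq (hat0 k) ! i < Suc c \<and> ?X $$ (i, c) = 0"
        using schubert_chart_support[OF order_refl ic] by blast
    qed simp
    thus "V = 0\<^sub>m k n" using V(1) by (intro eq_matI) auto
  qed simp
  show ?thesis
    unfolding good_def
  proof (intro conjI allI impI)
    show "finite (isect n k (hat0 k) [])" using bij_betw_finite[OF bij] S by simp
    show "card (isect n k (hat0 k) []) = dnum n k (hat0 k)"
      using bij_betw_same_card[OF bij] S dnum_hat0 by simp
    fix X assume X: "solution n k (hat0 k) [] X"
    hence "rowspace X \<in> isect n k (hat0 k) []" by (auto simp: isect_eq)
    hence e: "rowspace X = rowspace (?c (\<lambda>_. 0))" using bij S by (auto simp: bij_betw_def)
    have "map_mat cnj (?c (\<lambda>_. 0)) = ?c (\<lambda>_. 0)" by (rule eq_matI) (auto simp: schubert_chart_def)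
    thus "real_point n k (rowspace X)" unfolding e by (rule real_point_if_cnj[OF schubert_chart_carrier])
    obtain G where G: "G \<in> carrier_mat k k" "det G \<noteq> 0" "X = G * ?c (\<lambda>_. 0)"
      by (rule rowspace_eq_invertible[of n k "?c (\<lambda>_. 0)" X]) (use sol X e in \<open>auto simp: solution_def\<close>)
    show "nondegenerate n k (hat0 k) [] X"
      unfolding G(3) by (rule nondegenerate_mult[OF kn' _ schubert_chart_carrier nd G(1,2)]) simp
  qed
qed

text \<open>\<open>take (wt \<alpha>)\<close> ties the claim for \<alpha> to a prefix of the list,
  so later choices do not disturb it. In the induction step only weight \<open>Suc m\<close> and
  properness are new: finitely many eventual conditions, which some positive \<open>t\<close>
  satisfies simultaneously.\<close>

lemma exists_parameters:
  "\<exists>ts. length ts = m \<and> (\<forall>t\<in>set ts. 0 < t) \<and> dimensionally_proper (map M ts) \<and>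
    (\<forall>\<alpha>\<in>kset n k. wt \<alpha> \<le> m \<longrightarrow> good \<alpha> (map M (take (wt \<alpha>) ts)))"
proof (induction m)
  case 0
  show ?case
    using good_hat0 wt_0_iff[OF _ kn'] by (auto simp: dimensionally_proper_def)
next
  case (Suc m)
  then obtain ts where ts: "length ts = m" "\<forall>t\<in>set ts. 0 < t" "dimensionally_proper (map M ts)"
    "\<And>\<alpha>. \<alpha> \<in> kset n k \<Longrightarrow> wt \<alpha> \<le> m \<Longrightarrow> good \<alpha> (map M (take (wt \<alpha>) ts))" by blast
  let ?Ms = "map M ts"
  have Ms: "\<forall>N\<in>set ?Ms. N \<in> carrier_mat (n - k) n \<and> map_mat cnj N = N" using M_carrier M_cnj by auto
  have gm: "good \<alpha> ?Ms" if "\<alpha> \<in> kset n k" "wt \<alpha> = length ?Ms" for \<alpha>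
    using ts(4)[OF that(1)] that(2) ts(1) by simp
  have "\<forall>\<^sub>F t in at_right 0. wt \<alpha> = Suc m \<longrightarrow> good \<alpha> (?Ms @ [M t])" if "\<alpha> \<in> kset n k" for \<alpha>
  proof (cases "wt \<alpha> = Suc m")
    case True
    have "good \<beta> ?Ms" if "bruhat_cover n k \<beta> \<alpha>" for \<beta>
      using that wt_cover[OF that] True ts(1) by (intro gm) (auto simp: bruhat_cover_def)
    thus ?thesis using eventually_good[OF Ms ts(3) that] True ts(1) by simp
  qed simp
  hence "\<forall>\<^sub>F t in at_right 0. \<forall>\<alpha>\<in>kset n k. wt \<alpha> = Suc m \<longrightarrow> good \<alpha> (?Ms @ [M t])"
    by (intro eventually_ball_finite[OF finite_kset]) blast
  moreover have "\<forall>\<^sub>F t in at_right 0. dimensionally_proper (?Ms @ [M t])"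
    by (rule eventually_dimensionally_proper[OF _ ts(3) gm]) (use Ms in auto)
  moreover have "\<forall>\<^sub>F t :: real in at_right 0. 0 < t" by (rule eventually_at_right_less)
  ultimately have "\<forall>\<^sub>F t in at_right 0. (\<forall>\<alpha>\<in>kset n k. wt \<alpha> = Suc m \<longrightarrow> good \<alpha> (?Ms @ [M t])) \<and>
      dimensionally_proper (?Ms @ [M t]) \<and> 0 < t"
    by eventually_elim blast
  then obtain t where t: "\<forall>\<alpha>\<in>kset n k. wt \<alpha> = Suc m \<longrightarrow> good \<alpha> (?Ms @ [M t])"
    "dimensionally_proper (?Ms @ [M t])" "0 < t"
    using eventually_happens'[OF trivial_limit_at_right_real] by blast
  have "good \<alpha> (map M (take (wt \<alpha>) (ts @ [t])))" if "\<alpha> \<in> kset n k" "wt \<alpha> \<le> Suc m" for \<alpha>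
  proof (cases "wt \<alpha> = Suc m")
    case True
    thus ?thesis using t(1) that(1) ts(1) by simp
  next
    case False
    thus ?thesis using ts(4)[OF that(1)] that(2) ts(1) by simp
  qed
  thus ?case using ts(1,2) t by (intro exI[of _ "ts @ [t]"]) auto
qed

end

theorem mainTheorem5:
  fixes n k :: nat and B :: "real mat"
  assumes "0 < k" and "k < n"
    and "B \<in> carrier_mat (n - k) n"
    and "\<forall>\<gamma> \<in> kset n (n - k). plucker B \<gamma> \<noteq> 0"
  shows "\<exists>ts :: real list. length ts = k * (n - k) \<and> (\<forall>t \<in> set ts. t \<noteq> 0) \<and>
    (\<forall>\<alpha> \<in> kset n k.
       let Ms = map (\<lambda>t. map_mat complex_of_real (tact t B)) (take (wt \<alpha>) ts) in
       transverse n k \<alpha> Ms \<and>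
       finite (isect n k \<alpha> Ms) \<and> card (isect n k \<alpha> Ms) = dnum n k \<alpha> \<and>
       (\<forall>K \<in> isect n k \<alpha> Ms. real_point n k K))"
proof -
  interpret transverse_subspace n k B using assms by unfold_locales
  obtain ts where ts: "length ts = k * (n - k)" "\<forall>t\<in>set ts. 0 < t"
    "\<forall>\<alpha>\<in>kset n k. wt \<alpha> \<le> k * (n - k) \<longrightarrow> good \<alpha> (map M (take (wt \<alpha>) ts))"
    using exists_parameters[of "k * (n - k)"] by blast
  have M_fun: "(\<lambda>t. map_mat complex_of_real (tact t B)) = M" by (simp add: M_def fun_eq_iff)
  show ?thesis
  proof (intro exI[of _ ts] conjI ballI)
    show "length ts = k * (n - k)" by (rule ts(1))
    show "t \<noteq> 0" if "t \<in> set ts" for t using ts(2) that by auto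
    fix \<alpha> assume \<alpha>: "\<alpha> \<in> kset n k"
    let ?Ms = "map M (take (wt \<alpha>) ts)"
    \<comment> \<open>No weight exceeds \<open>k * (n - k)\<close>, so the list is long enough for
      every \<alpha>.\<close>
    have g: "good \<alpha> ?Ms" using ts(3) \<alpha> wt_le[OF \<alpha>] by blast
    have Ms: "\<forall>N\<in>set ?Ms. N \<in> carrier_mat (n - k) n" using M_carrier by auto
    have "transverse n k \<alpha> ?Ms"
      unfolding transverse_def
    proof
      fix K assume "K \<in> isect n k \<alpha> ?Ms"
      then obtain X where X: "solution n k \<alpha> ?Ms X" "K = rowspace X" by (auto simp: isect_eq)
      show "transverse_at n k \<alpha> ?Ms K"
        unfolding X(2) by (rule transverse_atI[OF kn' Ms]) (use X(1) g in \<open>auto simp: solution_def good_def\<close>)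
    qed
    moreover have "\<forall>K\<in>isect n k \<alpha> ?Ms. real_point n k K"
      using g by (auto simp: isect_eq good_def)
    ultimately show "let Ms = map (\<lambda>t. map_mat complex_of_real (tact t B)) (take (wt \<alpha>) ts) in
       transverse n k \<alpha> Ms \<and>
       finite (isect n k \<alpha> Ms) \<and> card (isect n k \<alpha> Ms) = dnum n k \<alpha> \<and>
       (\<forall>K \<in> isect n k \<alpha> Ms. real_point n k K)"
      using g unfolding M_fun Let_def good_def by blast
  qed
qed

end
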